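(* Let $(\Omega,\mathcal{A},P)$ be a probability space with a filtration $\mathcal{G}=(\mathcal{G}_n)_{n\ge0}$, and let $(X_n)_{n\ge1}$ be a $\mathcal{G}$-c.i.d. sequence with values in a measurable space $(E,\mathcal{E})$. Suppose $f$ and $f^2$ are in $\mathcal{H}$ and $\sup_nE[C_{n,f}^2]<\infty$, where $$C_{n,f}=\frac{1}{\sqrt n}\bigl(f(X_1)+\cdots+f(X_n)-nE[f(X_{n+1})\mid\mathcal{G}_n]\bigr).$$ (a) If $$M_n=\frac1n\sum_{k=1}^n\bigl(f(X_k)-kE[f(X_{k+1})\mid\mathcal{G}_k]+(k-1)E[f(X_k)\mid\mathcal{G}_{k-1}]\bigr)^2\to\sigma^2\qquad\text{a.s.}$$ for some real random variable $\sigma^2$, then $(C_{n,f})_n$ converges stably with representing measure $\mathcal{N}(0,\sigma^2)$. (b) Moreover, if $$\frac1n\sum_{k=1}^nk^2\bigl(E[f(X_{k+1})\mid\mathcal{G}_k]-E[f(X_k)\mid\mathcal{G}_{k-1}]\bigr)^2\to0\qquad\text{in probability,}$$ then $B_{n,f}-C_{n,f}\to0$ in probability, where $B_{n,f}=\frac{1}{\sqrt n}\sum_{k=1}^n\bigl(f(X_k)-E[f(X_k)\mid\mathcal{G}_{k-1}]\bigr)$, and $(C_{n,f})_n$ converges stably with representing measure $\mathcal{N}(0,V_{f^2}-(V_f)^2)$.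
   Context: $(X_n)_{n\ge1}$ is $\mathcal{G}$-c.i.d. (conditionally identically distributed with respect to $\mathcal{G}$) if it is adapted to $\mathcal{G}$ and, for all $k>n\ge0$ and all bounded measurable $g:E\to\mathbb{R}$, $E[g(X_k)\mid\mathcal{G}_n]=E[g(X_{n+1})\mid\mathcal{G}_n]$ a.s. $\mathcal{H}$ is the class of measurable $f:E\to\mathbb{R}$ with $E[|f(X_1)|]<\infty$. For $(X_n)_n$ $\mathcal{G}$-c.i.d. and $f\in\mathcal{H}$, $V_f$ denotes (a version of) the limit, a.s. and in $L^1$, of $E[f(X_{n+1})\mid\mathcal{G}_n]$, which always exists. $\mathcal{N}(0,c)$ is the Gaussian law on $\mathbb{R}$ with mean $0$ and variance $c\ge0$, with $\mathcal{N}(0,0)=\delta_0$. For an a.s. nonnegative real random variable $L$, a sequence $(Z_n)_n$ of real random variables converges stably with representing measure $\mathcal{N}(0,L)$ if, for every $H\in\mathcal{A}$ with $P(H)>0$, $(Z_n)_n$ converges in distribution under $P(\cdot\mid H)$ to the law $\mu_H(\cdot)=\int\mathcal{N}(0,L(\omega))(\cdot)\,P(d\omega\mid H)$. *)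

theory Defs
  imports "HOL-Probability.Probability"
begin

section \<open>Conditionally identically distributed sequences\<close>

text \<open>
  The sequence \<open>X\<close> is indexed from \<open>1\<close>: the value \<open>X 0\<close> is never used. The measurable space
  \<open>(E, \<E>)\<close> is given by a measure \<open>E\<close> of which only the space and the sigma-algebra matter.
\<close>

definition cid ::
  "'a measure \<Rightarrow> (nat \<Rightarrow> 'a measure) \<Rightarrow> 'e measure \<Rightarrow> (nat \<Rightarrow> 'a \<Rightarrow> 'e) \<Rightarrow> bool" where
  "cid M G E X \<longleftrightarrow>
     (\<forall>n\<ge>1. X n \<in> measurable (G n) E) \<and>
     (\<forall>n k g. n < k \<longrightarrow> g \<in> borel_measurable E \<longrightarrow> bounded (g ` space E) \<longrightarrow>
        (AE \<omega> in M. real_cond_exp M (G n) (\<lambda>\<omega>. g (X k \<omega>)) \<omega> =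
                    real_cond_exp M (G n) (\<lambda>\<omega>. g (X (n + 1) \<omega>)) \<omega>))"

definition class_H ::
  "'a measure \<Rightarrow> 'e measure \<Rightarrow> (nat \<Rightarrow> 'a \<Rightarrow> 'e) \<Rightarrow> ('e \<Rightarrow> real) set" where
  "class_H M E X = {f. f \<in> borel_measurable E \<and> integrable M (\<lambda>\<omega>. f (X 1 \<omega>))}"

definition pred_mean ::
  "'a measure \<Rightarrow> (nat \<Rightarrow> 'a measure) \<Rightarrow> (nat \<Rightarrow> 'a \<Rightarrow> 'e) \<Rightarrow> ('e \<Rightarrow> real) \<Rightarrow> nat \<Rightarrow> 'a \<Rightarrow> real" where
  "pred_mean M G X f n = real_cond_exp M (G n) (\<lambda>\<omega>. f (X (n + 1) \<omega>))"

text \<open>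
  \<open>is_V M G X f V\<close>: the random variable \<open>V\<close> is a version of \<open>V\<^sub>f\<close>. Versions are unique up to
  null sets only, hence a predicate.
\<close>

definition is_V ::
  "'a measure \<Rightarrow> (nat \<Rightarrow> 'a measure) \<Rightarrow> (nat \<Rightarrow> 'a \<Rightarrow> 'e) \<Rightarrow> ('e \<Rightarrow> real) \<Rightarrow> ('a \<Rightarrow> real) \<Rightarrow> bool" where
  "is_V M G X f V \<longleftrightarrow>
     V \<in> borel_measurable M \<and>
     (AE \<omega> in M. (\<lambda>n. pred_mean M G X f n \<omega>) \<longlonglongrightarrow> V \<omega>) \<and>
     (\<lambda>n. \<integral>\<^sup>+ \<omega>. ennreal \<bar>pred_mean M G X f n \<omega> - V \<omega>\<bar> \<partial>M) \<longlonglongrightarrow> 0"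

definition C_stat ::
  "'a measure \<Rightarrow> (nat \<Rightarrow> 'a measure) \<Rightarrow> (nat \<Rightarrow> 'a \<Rightarrow> 'e) \<Rightarrow> ('e \<Rightarrow> real) \<Rightarrow> nat \<Rightarrow> 'a \<Rightarrow> real" where
  "C_stat M G X f n \<omega> =
     1 / sqrt (real n) * ((\<Sum>k=1..n. f (X k \<omega>)) - real n * pred_mean M G X f n \<omega>)"

definition B_stat ::
  "'a measure \<Rightarrow> (nat \<Rightarrow> 'a measure) \<Rightarrow> (nat \<Rightarrow> 'a \<Rightarrow> 'e) \<Rightarrow> ('e \<Rightarrow> real) \<Rightarrow> nat \<Rightarrow> 'a \<Rightarrow> real" where
  "B_stat M G X f n \<omega> =
     1 / sqrt (real n) * (\<Sum>k=1..n. f (X k \<omega>) - pred_mean M G X f (k - 1) \<omega>)"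

definition M_stat ::
  "'a measure \<Rightarrow> (nat \<Rightarrow> 'a measure) \<Rightarrow> (nat \<Rightarrow> 'a \<Rightarrow> 'e) \<Rightarrow> ('e \<Rightarrow> real) \<Rightarrow> nat \<Rightarrow> 'a \<Rightarrow> real" where
  "M_stat M G X f n \<omega> =
     1 / real n * (\<Sum>k=1..n. (f (X k \<omega>) - real k * pred_mean M G X f k \<omega>
                               + (real k - 1) * pred_mean M G X f (k - 1) \<omega>)\<^sup>2)"

section \<open>Convergence in probability and stable convergence\<close>

definition conv_in_prob :: "'a measure \<Rightarrow> (nat \<Rightarrow> 'a \<Rightarrow> real) \<Rightarrow> ('a \<Rightarrow> real) \<Rightarrow> bool" where
  "conv_in_prob M Z Y \<longleftrightarrow>
     (\<forall>\<epsilon>>0. (\<lambda>n. measure M {\<omega> \<in> space M. \<bar>Z n \<omega> - Y \<omega>\<bar> > \<epsilon>}) \<longlonglongrightarrow> 0)"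

text \<open>
  The second argument of \<^const>\<open>normal_density\<close> is the standard deviation. The value at \<open>c < 0\<close>
  is a junk value; it is only needed on a null set.
\<close>

definition gauss :: "real \<Rightarrow> real measure" where
  "gauss c = (if c > 0 then density lborel (\<lambda>x. ennreal (normal_density 0 (sqrt c) x))
              else return borel 0)"

text \<open>
  The conditional law \<open>P(\<cdot> | H)\<close> is \<^term>\<open>uniform_measure M H\<close>, and the mixture is the monadic bind
  of the Giry monad; \<open>emeasure_gauss_mixture\<close> below gives its values.
\<close>

definition gauss_mixture :: "'a measure \<Rightarrow> ('a \<Rightarrow> real) \<Rightarrow> 'a set \<Rightarrow> real measure" where
  "gauss_mixture M L H = uniform_measure M H \<bind> (\<lambda>\<omega>. gauss (L \<omega>))"

definition stably_conv_gauss :: "'a measure \<Rightarrow> (nat \<Rightarrow> 'a \<Rightarrow> real) \<Rightarrow> ('a \<Rightarrow> real) \<Rightarrow> bool" where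
  "stably_conv_gauss M Z L \<longleftrightarrow>
     (\<forall>n. Z n \<in> borel_measurable M) \<and>
     L \<in> borel_measurable M \<and> (AE \<omega> in M. 0 \<le> L \<omega>) \<and>
     (\<forall>H\<in>sets M. measure M H > 0 \<longrightarrow>
        weak_conv_m (\<lambda>n. distr (uniform_measure M H) borel (Z n)) (gauss_mixture M L H))"

lemma sets_gauss [simp]: "sets (gauss c) = sets borel"
  by (simp add: gauss_def)

lemma prob_space_gauss: "prob_space (gauss c)"
  by (auto simp: gauss_def intro!: prob_space_normal_density prob_space_return)

lemma measurable_gauss [measurable]: "gauss \<in> measurable borel (subprob_algebra borel)"
proof (rule measurable_subprob_algebra)
  fix c :: real
  show "subprob_space (gauss c)"
    by (intro prob_space_imp_subprob_space prob_space_gauss)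
  show "sets (gauss c) = sets borel" by simp
next
  fix A :: "real set" assume A [measurable]: "A \<in> sets borel"
  have eq: "emeasure (gauss c) A =
      (if c > 0 then \<integral>\<^sup>+x. ennreal (normal_density 0 (sqrt c) x) * indicator A x \<partial>lborel
       else indicator A 0)" for c
    by (auto simp: gauss_def emeasure_density)
  have "(\<lambda>p. ennreal (normal_density 0 (sqrt (fst p)) (snd p)) * indicator A (snd p))
          \<in> borel_measurable (borel \<Otimes>\<^sub>M lborel)"
    unfolding normal_density_def by measurable
  then have "(\<lambda>c. \<integral>\<^sup>+x. ennreal (normal_density 0 (sqrt c) x) * indicator A x \<partial>lborel)
          \<in> borel_measurable borel"
    by (intro lborel.borel_measurable_nn_integral) (simp add: case_prod_beta)
  then show "(\<lambda>c. emeasure (gauss c) A) \<in> borel_measurable borel"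
    unfolding eq by measurable
qed

lemma emeasure_gauss_mixture:
  assumes "L \<in> borel_measurable M" "H \<in> sets M" "A \<in> sets borel" "space M \<noteq> {}"
  shows "emeasure (gauss_mixture M L H) A = (\<integral>\<^sup>+\<omega>. emeasure (gauss (L \<omega>)) A \<partial>uniform_measure M H)"
  unfolding gauss_mixture_def
  by (rule emeasure_bind[where N=borel]) (use assms in \<open>auto intro: measurable_compose[OF _ measurable_gauss]\<close>)

end

theory Submission
  imports Defs
begin

text \<open>
  We have \<open>sqrt n * C\<^sub>n = (\<Sum>k\<le>n. Y\<^sub>k)\<close>, where the
  \<open>Y\<^sub>k = f (X\<^sub>k) - k E[f (X\<^sub>k\<^sub>+\<^sub>1) | G\<^sub>k] + (k - 1) E[f (X\<^sub>k) | G\<^sub>k\<^sub>-\<^sub>1]\<close> are martingale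
  differences, so (a) is a stable martingale central limit theorem: if
  \<open>Q\<^sub>n = (\<Sum>k\<le>n. Y\<^sub>k\<^sup>2) / n\<close> converges in probability to \<open>L\<close> and is bounded in \<open>L\<^sup>1\<close>, then
  \<open>E[h exp (\<i> t S\<^sub>n / sqrt n)]\<close> tends to \<open>E[h exp (- t\<^sup>2 L / 2)]\<close> for every bounded random variable
  \<open>h\<close>. It is proved by McLeish's argument: after stopping at the level \<open>Q\<^sub>n \<le> c\<close>, the exponential is
  compared with \<open>\<Prod>k (1 + \<i> t Y\<^sub>k / sqrt n)\<close>, which is bounded in \<open>L\<^sup>2\<close> and satisfies
  \<open>E[h \<Prod>k (1 + \<i> t Y\<^sub>k / sqrt n)] \<rightarrow> E[h]\<close>; finally \<open>c \<rightarrow> \<infinity>\<close>.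

  For (b), the same limit theorem with \<open>L = 0\<close> applies to
  \<open>D\<^sub>k = k (E[f (X\<^sub>k\<^sub>+\<^sub>1) | G\<^sub>k] - E[f (X\<^sub>k) | G\<^sub>k\<^sub>-\<^sub>1])\<close>, whose normalised sums are
  \<open>B\<^sub>n - C\<^sub>n\<close>. As \<open>Y\<^sub>k + D\<^sub>k = f (X\<^sub>k) - E[f (X\<^sub>k) | G\<^sub>k\<^sub>-\<^sub>1]\<close>, laws of large numbers for \<open>f\<close> and
  \<open>f\<^sup>2\<close> identify the limit of \<open>Q\<^sub>n\<close> as \<open>V2 - V\<^sup>2\<close>.
\<close>

section \<open>Pathwise estimates\<close>

text \<open>The convergence of \<open>Q_n\<close> is the only control on single differences: there
  is no Lindeberg condition and no conditional variance. That the largest \<open>Y_k^2 / n\<close>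
  is negligible is therefore extracted from the convergence of \<open>Q_n\<close> itself, along the
  times \<open>j n div N\<close>. The product has squared modulus
  \<open>prod (1 + t^2 Y_k^2 / n)\<close>, which need not be bounded in \<open>L^1\<close>; this
  forces the stopping. A predictable stopping rule lets one uncontrolled term through, which is paid
  for by a factor \<open>1 + t^2 Q_n\<close>; so the \<open>L^1\<close> bound on \<open>Q_n\<close>
  becomes an \<open>L^2\<close> bound on the product. By orthogonality of the differences, that
  \<open>L^1\<close> bound is the hypothesis on \<open>E[C_n^2]\<close>. The limit
  \<open>exp (- t^2 L / 2)\<close> is random and in general not measurable for any
  \<open>G n\<close>, and it has to be multiplied into the test function; hence the limit statement
  about the product must allow an arbitrary bounded \<open>h\<close>. The limit theorem asks for
  convergence in probability only, so weak laws of large numbers suffice in (b).\<close>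

lemma cmod_one_plus_ii_times: "cmod (1 + \<i> * complex_of_real x) = sqrt (1 + x\<^sup>2)"
  by (simp add: cmod_def)

lemma cmod_one_plus_ii_times_exp_le:
  "cmod ((1 + \<i> * complex_of_real x) * complex_of_real (exp (- x\<^sup>2 / 2))) \<le> 1"
proof -
  have "1 + x\<^sup>2 \<le> exp (x\<^sup>2)" by (simp add: exp_ge_add_one_self)
  then have "sqrt (1 + x\<^sup>2) \<le> sqrt (exp (x\<^sup>2))" by simp
  also have "sqrt (exp (x\<^sup>2)) = exp (x\<^sup>2 / 2)"
    by (rule real_sqrt_unique) (simp_all add: power2_eq_square flip: exp_add)
  finally have "sqrt (1 + x\<^sup>2) * exp (- x\<^sup>2 / 2) \<le> exp (x\<^sup>2 / 2) * exp (- x\<^sup>2 / 2)"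
    by (rule mult_right_mono) simp
  then show ?thesis
    by (simp add: norm_mult cmod_one_plus_ii_times flip: exp_add)
qed

lemma exp_minus_quadratic_bound:
  fixes u :: real
  assumes "0 \<le> u"
  shows "\<bar>exp (- u) - 1 + u\<bar> \<le> u\<^sup>2"
proof -
  have "exp (- u) = inverse (exp u)" by (rule exp_minus)
  also have "\<dots> \<le> inverse (1 + u)"
    using assms by (intro le_imp_inverse_le) (auto simp: exp_ge_add_one_self)
  \<comment> \<open>Clearing the denominator,
    \<open>(1 + u) (1 - u + u^2) = 1 + u^3\<close>.\<close>
  also have "\<dots> \<le> 1 - u + u\<^sup>2"
    using assms by (simp add: field_simps power2_eq_square)
  finally show ?thesis
    using exp_ge_add_one_self[of "- u"] by linarith
qed

text \<open>Both terms agree with \<open>1 + i x - x^2 / 2\<close> up to third order, which settles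
  \<open>\<bar>x\<bar> \<le> 1\<close> with the constant \<open>1/6 + 1\<close>. Beyond that the two
  terms of modulus at most \<open>1\<close> differ by at most \<open>2\<close>, and this case fixes
  the constant.\<close>

lemma cmod_iexp_minus_factor_le:
  "cmod (iexp x - (1 + \<i> * complex_of_real x) * complex_of_real (exp (- x\<^sup>2 / 2))) \<le> 2 * \<bar>x\<bar> ^ 3"
proof (cases "\<bar>x\<bar> \<le> 1")
  case False
  have "cmod (iexp x - (1 + \<i> * complex_of_real x) * complex_of_real (exp (- x\<^sup>2 / 2))) \<le> 1 + 1"
    by (intro norm_triangle_le_diff add_mono cmod_one_plus_ii_times_exp_le) simp
  also have "1 \<le> \<bar>x\<bar> ^ 3" using False by (intro one_le_power) auto
  then have "1 + 1 \<le> 2 * \<bar>x\<bar> ^ 3" by simp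
  finally show ?thesis .
next
  case True
  define u where "u = x\<^sup>2 / 2"
  define r where "r = exp (- u) - 1 + u"
  have u: "0 \<le> u" by (simp add: u_def)
  have r: "\<bar>r\<bar> \<le> u\<^sup>2" using exp_minus_quadratic_bound[OF u] by (simp add: r_def)
  have 1: "cmod (iexp x - (1 + \<i> * x - u)) \<le> \<bar>x\<bar> ^ 3 / 6"
    using iexp_approx1[of x 2]
    by (simp add: u_def numeral_2_eq_2 numeral_3_eq_3 power2_eq_square algebra_simps)
  \<comment> \<open>Only the real exponential is expanded, with remainder \<open>r\<close>;
    multiplication by \<open>1 + i x\<close> also produces the cubic cross term
    \<open>i x u\<close>.\<close>
  have "(1 + \<i> * x) * complex_of_real (exp (- u)) - (1 + \<i> * x - u) = (1 + \<i> * x) * r - \<i> * (x * u)"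
    by (simp add: r_def algebra_simps)
  then have "cmod ((1 + \<i> * x) * complex_of_real (exp (- u)) - (1 + \<i> * x - u))
      \<le> cmod ((1 + \<i> * x) * r) + cmod (\<i> * (x * u))"
    using norm_triangle_ineq4 by metis
  also have "\<dots> \<le> (1 + \<bar>x\<bar>) * \<bar>r\<bar> + \<bar>x\<bar> * u"
    using u by (intro add_mono) (auto simp: norm_mult intro!: mult_right_mono order_trans[OF norm_triangle_ineq])
  also have "\<dots> \<le> 2 * u\<^sup>2 + \<bar>x\<bar> * u"
    using True r u by (intro add_mono mult_mono) auto
  also have "\<dots> = \<bar>x\<bar> ^ 4 / 2 + \<bar>x\<bar> ^ 3 / 2"
    by (simp add: u_def power2_eq_square power4_eq_xxxx power3_eq_cube abs_mult)
  also have "\<bar>x\<bar> ^ 4 \<le> \<bar>x\<bar> ^ 3" using True by (intro power_decreasing) auto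
  finally have 2: "cmod ((1 + \<i> * x) * complex_of_real (exp (- u)) - (1 + \<i> * x - u)) \<le> \<bar>x\<bar> ^ 3"
    by simp
  have "cmod (iexp x - (1 + \<i> * x) * complex_of_real (exp (- u))) \<le> \<bar>x\<bar> ^ 3 / 6 + \<bar>x\<bar> ^ 3"
    using norm_triangle_le_diff[OF add_mono[OF 1 2]] by simp
  also have "\<dots> \<le> 2 * \<bar>x\<bar> ^ 3" by simp
  finally show ?thesis by (simp add: u_def)
qed

text \<open>Both factors have modulus at most \<open>1\<close>, since \<open>sqrt (1 + x\<^sup>2) \<le> exp (x\<^sup>2 / 2)\<close>; hence the
  products differ at most by the sum of the differences of the factors.\<close>

lemma iexp_sum_minus_prod_le:
  fixes x :: "nat \<Rightarrow> real" and n :: nat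
  defines "D \<equiv> cmod (iexp (\<Sum>k<n. x k)
      - (\<Prod>k<n. 1 + \<i> * complex_of_real (x k)) * complex_of_real (exp (- (\<Sum>k<n. (x k)\<^sup>2) / 2)))"
  shows "D \<le> 2"
    and "(\<And>k. k < n \<Longrightarrow> \<bar>x k\<bar> \<le> \<delta>) \<Longrightarrow> D \<le> 2 * \<delta> * (\<Sum>k<n. (x k)\<^sup>2)"
proof -
  let ?w = "\<lambda>k. (1 + \<i> * complex_of_real (x k)) * complex_of_real (exp (- (x k)\<^sup>2 / 2))"
  have e: "(\<Prod>k<n. 1 + \<i> * complex_of_real (x k)) * complex_of_real (exp (- (\<Sum>k<n. (x k)\<^sup>2) / 2))
      = (\<Prod>k<n. ?w k)"
    by (simp add: prod.distrib exp_sum sum_divide_distrib flip: of_real_prod sum_negf)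
  have i: "iexp (\<Sum>k<n. x k) = (\<Prod>k<n. iexp (x k))"
    by (simp add: exp_sum sum_distrib_left)
  have D: "D = cmod ((\<Prod>k<n. iexp (x k)) - (\<Prod>k<n. ?w k))"
    unfolding D_def e i ..
  have "cmod (\<Prod>k<n. ?w k) \<le> 1"
    using cmod_one_plus_ii_times_exp_le by (auto simp: norm_mult simp flip: prod_norm intro!: prod_le_1)
  moreover have "cmod (\<Prod>k<n. iexp (x k)) = 1"
    by (simp flip: prod_norm)
  ultimately show "D \<le> 2"
    unfolding D using norm_triangle_ineq4[of "\<Prod>k<n. iexp (x k)" "\<Prod>k<n. ?w k"] by linarith
  assume \<delta>: "\<And>k. k < n \<Longrightarrow> \<bar>x k\<bar> \<le> \<delta>"
  have "D \<le> (\<Sum>k<n. cmod (iexp (x k) - ?w k))"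
    unfolding D by (intro norm_prod_diff cmod_one_plus_ii_times_exp_le) simp
  also have "\<dots> \<le> (\<Sum>k<n. 2 * \<bar>x k\<bar> ^ 3)"
    by (intro sum_mono cmod_iexp_minus_factor_le)
  also have "\<dots> \<le> (\<Sum>k<n. 2 * (\<delta> * (x k)\<^sup>2))"
  proof (intro sum_mono mult_left_mono)
    fix k assume "k \<in> {..<n}"
    then show "\<bar>x k\<bar> ^ 3 \<le> \<delta> * (x k)\<^sup>2"
      using mult_right_mono[OF \<delta>, of k "\<bar>x k\<bar>\<^sup>2"]
      by (simp add: power3_eq_cube power2_eq_square mult.assoc)
  qed simp
  finally show "D \<le> 2 * \<delta> * (\<Sum>k<n. (x k)\<^sup>2)"
    by (simp add: sum_distrib_left mult.assoc)
qed

text \<open>The test involves the terms before index \<open>k\<close> only, which keeps the stopped sequence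
  predictable; the price is that its sum of squares may exceed \<open>c\<close> by its last nonzero term.\<close>

definition stopped :: "real \<Rightarrow> (nat \<Rightarrow> real) \<Rightarrow> nat \<Rightarrow> real" where
  "stopped c a k = (if (\<Sum>j<k. (a j)\<^sup>2) \<le> c then a k else 0)"

lemma sum_squares_mono:
  fixes a :: "nat \<Rightarrow> real"
  shows "m \<le> n \<Longrightarrow> (\<Sum>j<m. (a j)\<^sup>2) \<le> (\<Sum>j<n. (a j)\<^sup>2)"
  by (rule sum_mono2) (auto intro: less_le_trans)

lemma stopped_eq:
  assumes "(\<Sum>j<n. (a j)\<^sup>2) \<le> c" "k < n"
  shows "stopped c a k = a k"
  using assms sum_squares_mono[of k n a] by (auto simp: stopped_def)

lemma sum_stopped_eq:
  assumes "(\<Sum>j<n. (a j)\<^sup>2) \<le> c"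
  shows "(\<Sum>j<n. (stopped c a j)\<^sup>2) = (\<Sum>j<n. (a j)\<^sup>2)"
  using stopped_eq[OF assms] by (intro sum.cong) auto

text \<open>Before the threshold is crossed nothing is set to zero, and
  \<open>1 + z \<le> exp z\<close> reduces the product to the sum of squares.\<close>

lemma prod_stopped_le_exp:
  assumes "(\<Sum>j<n. (a j)\<^sup>2) \<le> c"
  shows "(\<Prod>k<n. 1 + (s * stopped c a k)\<^sup>2) \<le> exp (s\<^sup>2 * c)"
proof -
  have "(\<Prod>k<n. 1 + (s * stopped c a k)\<^sup>2) \<le> (\<Prod>k<n. exp ((s * stopped c a k)\<^sup>2))"
    by (intro prod_mono) (auto simp: exp_ge_add_one_self add_nonneg_nonneg)
  also have "\<dots> = exp (s\<^sup>2 * (\<Sum>j<n. (a j)\<^sup>2))"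
    unfolding sum_stopped_eq[OF assms, symmetric]
    by (simp add: exp_sum sum_distrib_left power_mult_distrib)
  also have "\<dots> \<le> exp (s\<^sup>2 * c)"
    using assms by (simp add: mult_left_mono)
  finally show ?thesis .
qed

text \<open>The last term that passes the test may be arbitrarily large. All earlier factors
  together are at most \<open>exp (s^2 c)\<close>, and that single one contributes at most
  \<open>1 + s^2\<close> times the full sum of squares.\<close>

lemma prod_stopped_le:
  assumes "0 \<le> c"
  shows "(\<Prod>k<n. 1 + (s * stopped c a k)\<^sup>2) \<le> exp (s\<^sup>2 * c) * (1 + s\<^sup>2 * (\<Sum>k<n. (a k)\<^sup>2))"
proof (induction n)
  case 0
  then show ?case using assms by simp
next
  case (Suc n)
  show ?case
  proof (cases "(\<Sum>j<n. (a j)\<^sup>2) \<le> c")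
    \<comment> \<open>The test at index \<open>n\<close> is passed, so the exponential bounds the
      first \<open>n\<close> factors; the new factor has no a priori bound and goes into the linear
      term.\<close>
    case True
    have "(\<Prod>k<Suc n. 1 + (s * stopped c a k)\<^sup>2) \<le> exp (s\<^sup>2 * c) * (1 + (s * a n)\<^sup>2)"
      using prod_stopped_le_exp[OF True, of s] True
      by (auto simp: stopped_def intro!: mult_right_mono add_nonneg_nonneg)
    also have "\<dots> \<le> exp (s\<^sup>2 * c) * (1 + s\<^sup>2 * (\<Sum>k<Suc n. (a k)\<^sup>2))"
      by (intro mult_left_mono) (auto simp: power_mult_distrib distrib_left sum_nonneg)
    finally show ?thesis .
  next
    case False
    then have "(\<Prod>k<Suc n. 1 + (s * stopped c a k)\<^sup>2) = (\<Prod>k<n. 1 + (s * stopped c a k)\<^sup>2)"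
      by (simp add: stopped_def)
    also note Suc
    also have "exp (s\<^sup>2 * c) * (1 + s\<^sup>2 * (\<Sum>k<n. (a k)\<^sup>2)) \<le> exp (s\<^sup>2 * c) * (1 + s\<^sup>2 * (\<Sum>k<Suc n. (a k)\<^sup>2))"
      by (intro mult_left_mono add_left_mono sum_squares_mono) auto
    finally show ?thesis .
  qed
qed

text \<open>The stopped sum follows the full one until it exceeds \<open>c\<close> and then freezes,
  so its overshoot over \<open>c\<close> is at most one squared term.\<close>

lemma sum_stopped_bounds:
  assumes "0 \<le> c" "\<And>k. k < n \<Longrightarrow> (a k)\<^sup>2 \<le> \<delta>" "0 \<le> \<delta>"
  shows "\<bar>(\<Sum>k<n. (stopped c a k)\<^sup>2) - min (\<Sum>k<n. (a k)\<^sup>2) c\<bar> \<le> \<delta>"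
proof -
  have "(\<Sum>k<n. (stopped c a k)\<^sup>2) \<le> c + \<delta> \<and> min (\<Sum>k<n. (a k)\<^sup>2) c \<le> (\<Sum>k<n. (stopped c a k)\<^sup>2)"
    using assms(2)
  proof (induction n)
    case 0
    then show ?case using assms by simp
  next
    case (Suc n)
    show ?case
    proof (cases "(\<Sum>j<n. (a j)\<^sup>2) \<le> c")
      case True
      then have "(\<Sum>k<Suc n. (stopped c a k)\<^sup>2) = (\<Sum>k<Suc n. (a k)\<^sup>2)"
        using sum_stopped_eq[OF True] by (simp add: stopped_def)
      then show ?thesis
        using True Suc.prems[of n] by simp
    next
      case False
      then have "stopped c a n = 0" by (simp add: stopped_def)
      moreover have "min (\<Sum>k<Suc n. (a k)\<^sup>2) c = c" "min (\<Sum>k<n. (a k)\<^sup>2) c = c"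
        using False sum_squares_mono[of n "Suc n" a] by linarith+
      ultimately show ?thesis
        using Suc.IH Suc.prems by (auto simp del: sum.lessThan_Suc simp: sum.lessThan_Suc[of "\<lambda>k. (stopped c a k)\<^sup>2"])
    qed
  qed
  moreover have "(\<Sum>k<n. (stopped c a k)\<^sup>2) \<le> (\<Sum>k<n. (a k)\<^sup>2)"
    by (intro sum_mono) (simp add: stopped_def)
  ultimately show ?thesis
    using assms(3) by linarith
qed

section \<open>Convergence in probability\<close>

lemma LIMSEQ_null_sandwich:
  fixes f g :: "nat \<Rightarrow> real"
  assumes "\<And>n. 0 \<le> f n" "\<And>n. f n \<le> g n" "g \<longlonglongrightarrow> 0"
  shows "f \<longlonglongrightarrow> 0"
  by (rule tendsto_sandwich[OF _ _ tendsto_const assms(3)]) (use assms in auto)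

context prob_space begin

lemma conv_in_prob_AE:
  assumes [measurable]: "\<And>n. Z n \<in> borel_measurable M" "Y \<in> borel_measurable M"
    and lim: "AE \<omega> in M. (\<lambda>n. Z n \<omega>) \<longlonglongrightarrow> Y \<omega>"
  shows "conv_in_prob M Z Y"
  unfolding conv_in_prob_def
proof (intro allI impI)
  fix \<epsilon> :: real assume \<epsilon>: "\<epsilon> > 0"
  let ?A = "\<lambda>n. {\<omega> \<in> space M. \<bar>Z n \<omega> - Y \<omega>\<bar> > \<epsilon>}"
  have "(\<lambda>n. \<integral>\<omega>. indicator (?A n) \<omega> \<partial>M) \<longlonglongrightarrow> (\<integral>\<omega>. 0 \<partial>M :: real)"
  proof (rule integral_dominated_convergence[where w="\<lambda>_. 1"])
    show "AE \<omega> in M. (\<lambda>n. indicator (?A n) \<omega> :: real) \<longlonglongrightarrow> 0"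
      using lim
    proof eventually_elim
      case (elim \<omega>)
      from tendstoD[OF this \<epsilon>] have "\<forall>\<^sub>F n in sequentially. indicator (?A n) \<omega> = (0::real)"
        by eventually_elim (auto simp: dist_real_def)
      then show ?case by (rule tendsto_eventually)
    qed
  qed (auto split: split_indicator)
  then show "(\<lambda>n. prob (?A n)) \<longlonglongrightarrow> 0" by simp
qed

lemma conv_in_probD: "conv_in_prob M Z Y \<Longrightarrow> \<epsilon> > 0 \<Longrightarrow>
    (\<lambda>n. prob {\<omega> \<in> space M. \<bar>Z n \<omega> - Y \<omega>\<bar> > \<epsilon>}) \<longlonglongrightarrow> 0"
  by (simp add: conv_in_prob_def)

lemma conv_in_prob_dominated:
  assumes [measurable]: "\<And>n. Z n \<in> borel_measurable M" "Y \<in> borel_measurable M"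
    and Z: "conv_in_prob M Z Y"
    and le: "\<And>n \<omega>. \<omega> \<in> space M \<Longrightarrow> \<bar>Z' n \<omega> - Y' \<omega>\<bar> \<le> \<bar>Z n \<omega> - Y \<omega>\<bar>"
  shows "conv_in_prob M Z' Y'"
  unfolding conv_in_prob_def
proof (intro allI impI)
  fix \<epsilon> :: real assume "\<epsilon> > 0"
  then show "(\<lambda>n. prob {\<omega> \<in> space M. \<bar>Z' n \<omega> - Y' \<omega>\<bar> > \<epsilon>}) \<longlonglongrightarrow> 0"
    by (intro LIMSEQ_null_sandwich[OF measure_nonneg _ conv_in_probD[OF Z]] finite_measure_mono)
       (auto intro: less_le_trans[OF _ le])
qed

lemma conv_in_prob_add:
  assumes [measurable]: "\<And>n. Z n \<in> borel_measurable M" "Y \<in> borel_measurable M"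
      "\<And>n. Z' n \<in> borel_measurable M" "Y' \<in> borel_measurable M"
    and Z: "conv_in_prob M Z Y" and Z': "conv_in_prob M Z' Y'"
  shows "conv_in_prob M (\<lambda>n \<omega>. Z n \<omega> + Z' n \<omega>) (\<lambda>\<omega>. Y \<omega> + Y' \<omega>)"
  unfolding conv_in_prob_def
proof (intro allI impI)
  fix \<epsilon> :: real assume "\<epsilon> > 0"
  then have \<epsilon>: "\<epsilon> / 2 > 0" by simp
  let ?A = "\<lambda>n. {\<omega> \<in> space M. \<bar>Z n \<omega> - Y \<omega>\<bar> > \<epsilon> / 2}"
  let ?B = "\<lambda>n. {\<omega> \<in> space M. \<bar>Z' n \<omega> - Y' \<omega>\<bar> > \<epsilon> / 2}"
  have le: "prob {\<omega> \<in> space M. \<bar>Z n \<omega> + Z' n \<omega> - (Y \<omega> + Y' \<omega>)\<bar> > \<epsilon>} \<le> prob (?A n) + prob (?B n)" for n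
  proof (rule order_trans[OF finite_measure_mono measure_Un_le])
    show "{\<omega> \<in> space M. \<bar>Z n \<omega> + Z' n \<omega> - (Y \<omega> + Y' \<omega>)\<bar> > \<epsilon>} \<subseteq> ?A n \<union> ?B n"
    proof (rule subsetI, rule ccontr)
      fix \<omega> assume "\<omega> \<in> {\<omega> \<in> space M. \<bar>Z n \<omega> + Z' n \<omega> - (Y \<omega> + Y' \<omega>)\<bar> > \<epsilon>}" "\<omega> \<notin> ?A n \<union> ?B n"
      then show False
        using abs_triangle_ineq[of "Z n \<omega> - Y \<omega>" "Z' n \<omega> - Y' \<omega>"] by (simp add: algebra_simps)
    qed
  qed auto
  have "(\<lambda>n. prob (?A n) + prob (?B n)) \<longlonglongrightarrow> 0"
    using tendsto_add[OF conv_in_probD[OF Z \<epsilon>] conv_in_probD[OF Z' \<epsilon>]] by simp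
  with le show "(\<lambda>n. prob {\<omega> \<in> space M. \<bar>Z n \<omega> + Z' n \<omega> - (Y \<omega> + Y' \<omega>)\<bar> > \<epsilon>}) \<longlonglongrightarrow> 0"
    by (rule LIMSEQ_null_sandwich[OF measure_nonneg])
qed

lemma conv_in_prob_cmult:
  assumes Z: "conv_in_prob M Z Y"
  shows "conv_in_prob M (\<lambda>n \<omega>. c * Z n \<omega>) (\<lambda>\<omega>. c * Y \<omega>)"
proof (cases "c = 0")
  case False
  have "\<epsilon> < \<bar>c * Z n \<omega> - c * Y \<omega>\<bar> \<longleftrightarrow> \<epsilon> / \<bar>c\<bar> < \<bar>Z n \<omega> - Y \<omega>\<bar>" for \<epsilon> n \<omega>
  proof -
    have "\<bar>c * Z n \<omega> - c * Y \<omega>\<bar> = \<bar>c\<bar> * \<bar>Z n \<omega> - Y \<omega>\<bar>"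
      by (simp flip: right_diff_distrib abs_mult)
    then show ?thesis using False by (simp add: pos_divide_less_eq mult.commute)
  qed
  then show ?thesis
    using False Z by (simp add: conv_in_prob_def)
qed (simp add: conv_in_prob_def)

lemma conv_in_prob_L1:
  assumes [measurable]: "\<And>n. integrable M (Z n)"
    and Z: "(\<lambda>n. \<integral>\<omega>. \<bar>Z n \<omega>\<bar> \<partial>M) \<longlonglongrightarrow> 0"
  shows "conv_in_prob M Z (\<lambda>_. 0)"
  unfolding conv_in_prob_def
proof (intro allI impI)
  fix \<epsilon> :: real assume \<epsilon>: "\<epsilon> > 0"
  have "prob {\<omega> \<in> space M. \<bar>Z n \<omega> - 0\<bar> > \<epsilon>} \<le> (\<integral>\<omega>. \<bar>Z n \<omega>\<bar> \<partial>M) / \<epsilon>" for n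
    using \<epsilon> assms(1)
    by (intro order_trans[OF finite_measure_mono integral_Markov_inequality_measure[where A="{}" and c=\<epsilon>]]) auto
  moreover have "(\<lambda>n. (\<integral>\<omega>. \<bar>Z n \<omega>\<bar> \<partial>M) / \<epsilon>) \<longlonglongrightarrow> 0"
    using tendsto_divide[OF Z tendsto_const[of \<epsilon>]] \<epsilon> by simp
  ultimately show "(\<lambda>n. prob {\<omega> \<in> space M. \<bar>Z n \<omega> - 0\<bar> > \<epsilon>}) \<longlonglongrightarrow> 0"
    by (rule LIMSEQ_null_sandwich[OF measure_nonneg])
qed

text \<open>By Markov's inequality \<open>U n\<close> is below a fixed \<open>R\<close> up to small
  probability, uniformly in \<open>n\<close>, and there \<open>W^2 \<le> R \<bar>Z\<bar>\<close>.
  The lemma disposes of Cauchy-Schwarz cross terms with one factor bounded in \<open>L^1\<close> and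
  the other negligible.\<close>

lemma conv_in_prob_tight_product:
  assumes U: "\<And>n. integrable M (U n)" "\<And>n \<omega>. 0 \<le> U n \<omega>" "\<And>n. (\<integral>\<omega>. U n \<omega> \<partial>M) \<le> K"
    and [measurable]: "\<And>n. Z n \<in> borel_measurable M"
    and Z: "conv_in_prob M Z (\<lambda>_. 0)"
    and W: "\<And>n \<omega>. \<omega> \<in> space M \<Longrightarrow> (W n \<omega>)\<^sup>2 \<le> U n \<omega> * \<bar>Z n \<omega>\<bar>"
  shows "conv_in_prob M W (\<lambda>_. 0)"
  unfolding conv_in_prob_def
proof (intro allI impI LIMSEQ_I)
  fix \<epsilon> \<eta> :: real assume \<epsilon>: "\<epsilon> > 0" and \<eta>: "\<eta> > 0"
  have [measurable]: "U n \<in> borel_measurable M" for n using U(1) by auto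
  have K: "0 \<le> K" using U(3)[of 0] U(2) by (auto intro: order_trans[OF Bochner_Integration.integral_nonneg])
  \<comment> \<open>Chosen for \<open>K / R < \<eta> / 2\<close>; the summand \<open>1\<close> keeps
    \<open>R\<close> positive when \<open>K = 0\<close>.\<close>
  define R where "R = 2 * (K + 1) / \<eta>"
  have R: "R > 0" using K \<eta> by (simp add: R_def)
  have "K / R < \<eta> / 2" using K \<eta> R by (simp add: R_def field_simps)
  have "\<epsilon>\<^sup>2 / R > 0" using \<epsilon> R by simp
  from LIMSEQ_D[OF conv_in_probD[OF Z this], of "\<eta> / 2"] \<eta>
  obtain n0 where n0: "\<And>n. n \<ge> n0 \<Longrightarrow> prob {\<omega> \<in> space M. \<bar>Z n \<omega> - 0\<bar> > \<epsilon>\<^sup>2 / R} < \<eta> / 2"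
    by auto
  show "\<exists>no. \<forall>n\<ge>no. norm (prob {\<omega> \<in> space M. \<epsilon> < \<bar>W n \<omega> - 0\<bar>} - 0) < \<eta>"
  proof (intro exI allI impI)
    fix n assume n: "n \<ge> n0"
    have "{\<omega> \<in> space M. \<epsilon> < \<bar>W n \<omega> - 0\<bar>}
        \<subseteq> {\<omega> \<in> space M. U n \<omega> \<ge> R} \<union> {\<omega> \<in> space M. \<bar>Z n \<omega> - 0\<bar> > \<epsilon>\<^sup>2 / R}"
    proof (clarsimp, rule ccontr)
      fix \<omega> assume *: "\<omega> \<in> space M" "\<epsilon> < \<bar>W n \<omega>\<bar>" "\<not> R \<le> U n \<omega>" "\<not> \<epsilon>\<^sup>2 / R < \<bar>Z n \<omega>\<bar>"
      have "\<epsilon>\<^sup>2 < \<bar>W n \<omega>\<bar>\<^sup>2" using * \<epsilon> by (intro power_strict_mono) auto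
      also have "\<dots> \<le> U n \<omega> * \<bar>Z n \<omega>\<bar>" using W[OF *(1)] by simp
      also have "\<dots> \<le> R * (\<epsilon>\<^sup>2 / R)" using * U(2) R by (intro mult_mono) auto
      finally show False using R by simp
    qed
    then have "prob {\<omega> \<in> space M. \<epsilon> < \<bar>W n \<omega> - 0\<bar>}
        \<le> prob {\<omega> \<in> space M. U n \<omega> \<ge> R} + prob {\<omega> \<in> space M. \<bar>Z n \<omega> - 0\<bar> > \<epsilon>\<^sup>2 / R}"
      by (intro order_trans[OF finite_measure_mono measure_Un_le]) auto
    also have "prob {\<omega> \<in> space M. U n \<omega> \<ge> R} \<le> (\<integral>\<omega>. U n \<omega> \<partial>M) / R"
      using U R by (intro integral_Markov_inequality_measure[where A="{}"]) auto
    also have "\<dots> \<le> K / R" using U(3) R by (intro divide_right_mono) auto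
    finally show "norm (prob {\<omega> \<in> space M. \<epsilon> < \<bar>W n \<omega> - 0\<bar>} - 0) < \<eta>"
      using n0[OF n] \<open>K / R < \<eta> / 2\<close>
      unfolding diff_0_right real_norm_def abs_of_nonneg[OF measure_nonneg] by linarith
  qed
qed

text \<open>Bounded convergence in probability: where \<open>C \<bar>Z - Y\<bar>\<close> is at most
  \<open>\<eta> / 2\<close> the integrand is small, and elsewhere the bound \<open>1\<close> costs
  only the probability of the exceptional set.\<close>

lemma conv_in_prob_integral:
  assumes [measurable]: "\<And>n. Z n \<in> borel_measurable M" "Y \<in> borel_measurable M"
      "\<And>n. W n \<in> borel_measurable M"
    and Z: "conv_in_prob M Z Y"
    and W: "\<And>n. AE \<omega> in M. 0 \<le> W n \<omega> \<and> W n \<omega> \<le> 1 \<and> W n \<omega> \<le> C * \<bar>Z n \<omega> - Y \<omega>\<bar>" and C: "C > 0"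
  shows "(\<lambda>n. \<integral>\<omega>. W n \<omega> \<partial>M) \<longlonglongrightarrow> 0"
proof (rule LIMSEQ_I)
  fix \<eta> :: real assume \<eta>: "\<eta> > 0"
  let ?A = "\<lambda>n. {\<omega> \<in> space M. \<bar>Z n \<omega> - Y \<omega>\<bar> > \<eta> / (2 * C)}"
  have "\<eta> / (2 * C) > 0" using \<eta> C by simp
  from LIMSEQ_D[OF conv_in_probD[OF Z this], of "\<eta> / 2"] \<eta>
  obtain n0 where n0: "\<And>n. n \<ge> n0 \<Longrightarrow> prob (?A n) < \<eta> / 2"
    by auto
  show "\<exists>no. \<forall>n\<ge>no. norm ((\<integral>\<omega>. W n \<omega> \<partial>M) - 0) < \<eta>"
  proof (intro exI allI impI)
    fix n assume n: "n \<ge> n0"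
    have "(\<integral>\<omega>. W n \<omega> \<partial>M) \<le> (\<integral>\<omega>. \<eta> / 2 + indicator (?A n) \<omega> \<partial>M)"
    proof (rule integral_mono_AE)
      show "integrable M (W n)"
      proof (rule integrable_const_bound[where B=1])
        show "AE \<omega> in M. norm (W n \<omega>) \<le> 1"
          using W[of n] by eventually_elim simp
      qed simp
      show "AE \<omega> in M. W n \<omega> \<le> \<eta> / 2 + indicator (?A n) \<omega>"
        using W[of n] AE_space
      proof eventually_elim
        case (elim \<omega>)
        show "W n \<omega> \<le> \<eta> / 2 + indicator (?A n) \<omega>"
        proof (cases "\<omega> \<in> ?A n")
          case False
          then have "C * \<bar>Z n \<omega> - Y \<omega>\<bar> \<le> \<eta> / 2" using elim(2) C by (simp add: field_simps)
          then show ?thesis using elim False by simp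
        qed (use elim \<eta> in auto)
      qed
    qed (auto intro!: Bochner_Integration.integrable_add integrable_real_indicator simp: less_top[symmetric])
    also have "\<dots> = \<eta> / 2 + prob (?A n)"
      by (subst Bochner_Integration.integral_add)
         (auto simp: prob_space less_top[symmetric] intro!: integrable_real_indicator)
    finally have "(\<integral>\<omega>. W n \<omega> \<partial>M) < \<eta>" using n0[OF n] by linarith
    moreover have "0 \<le> (\<integral>\<omega>. W n \<omega> \<partial>M)"
    proof (rule integral_nonneg_AE)
      show "AE \<omega> in M. 0 \<le> W n \<omega>" using W[of n] by eventually_elim simp
    qed
    ultimately show "norm ((\<integral>\<omega>. W n \<omega> \<partial>M) - 0) < \<eta>" by simp
  qed
qed

lemma conv_in_prob_subseq:
  assumes "conv_in_prob M Z Y" "filterlim r at_top sequentially"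
  shows "conv_in_prob M (\<lambda>n. Z (r n)) Y"
  unfolding conv_in_prob_def
proof (intro allI impI)
  fix \<epsilon> :: real assume "\<epsilon> > 0"
  from filterlim_compose[OF conv_in_probD[OF assms(1) this] assms(2)]
  show "(\<lambda>n. prob {\<omega> \<in> space M. \<bar>Z (r n) \<omega> - Y \<omega>\<bar> > \<epsilon>}) \<longlonglongrightarrow> 0" .
qed

text \<open>Since \<open>Z n \<ge> 0\<close>, the negative part of \<open>Y\<close> is at most
  \<open>\<bar>Z n - Y\<bar>\<close>. Its truncated integral does not depend on \<open>n\<close> and
  tends to \<open>0\<close>, hence vanishes.\<close>

lemma conv_in_prob_nonneg_limit:
  assumes [measurable]: "\<And>n. Z n \<in> borel_measurable M" "Y \<in> borel_measurable M"
    and Z: "conv_in_prob M Z Y" and nn: "\<And>n \<omega>. 0 \<le> Z n \<omega>"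
  shows "AE \<omega> in M. 0 \<le> Y \<omega>"
proof -
  have "(\<lambda>n. \<integral>\<omega>. min 1 (max 0 (- Y \<omega>)) \<partial>M) \<longlonglongrightarrow> 0"
  proof (rule conv_in_prob_integral[OF _ _ _ Z, where C=1])
    show "AE \<omega> in M. 0 \<le> min 1 (max 0 (- Y \<omega>)) \<and> min 1 (max 0 (- Y \<omega>)) \<le> 1 \<and>
        min 1 (max 0 (- Y \<omega>)) \<le> 1 * \<bar>Z n \<omega> - Y \<omega>\<bar>" for n
    proof (rule AE_I2)
      fix \<omega> show "0 \<le> min 1 (max 0 (- Y \<omega>)) \<and> min 1 (max 0 (- Y \<omega>)) \<le> 1 \<and>
        min 1 (max 0 (- Y \<omega>)) \<le> 1 * \<bar>Z n \<omega> - Y \<omega>\<bar>"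
        using nn[of n \<omega>] by (cases "0 \<le> Y \<omega>") auto
    qed
  qed auto
  then have "(\<integral>\<omega>. min 1 (max 0 (- Y \<omega>)) \<partial>M) = 0"
    by (simp add: LIMSEQ_const_iff)
  then have "AE \<omega> in M. min 1 (max 0 (- Y \<omega>)) = 0"
    by (subst (asm) integral_nonneg_eq_0_iff_AE) (auto intro!: integrable_const_bound[where B=1])
  then show ?thesis by eventually_elim (auto simp: min_def max_def split: if_splits)
qed

text \<open>Polya's argument: as the partial sums of squares are monotone, their convergence at finitely
  many times rules out large increments.\<close>

lemma max_square_negligible:
  fixes Y :: "nat \<Rightarrow> 'a \<Rightarrow> real"
  assumes [measurable]: "\<And>k. Y k \<in> borel_measurable M" "L \<in> borel_measurable M"
    and Q: "conv_in_prob M (\<lambda>n \<omega>. (\<Sum>k<n. (Y k \<omega>)\<^sup>2) / real n) L" and \<delta>: "\<delta> > 0"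
  shows "(\<lambda>n. prob {\<omega> \<in> space M. \<exists>k<n. (Y k \<omega>)\<^sup>2 > \<delta> * real n}) \<longlonglongrightarrow> 0"
proof -
  define q where "q n \<omega> = (\<Sum>k<n. (Y k \<omega>)\<^sup>2)" for n \<omega>
  have [measurable]: "q n \<in> borel_measurable M" for n unfolding q_def by measurable
  \<comment> \<open>Convergence at the fraction \<open>j / N\<close> of the time:
    \<open>q (r n) / n\<close> is \<open>a n\<close> times \<open>q (r n) / r n\<close>, where
    \<open>r n = j * n div N\<close> and \<open>a n\<close> tends to \<open>j / N\<close>.\<close>
  have conv: "conv_in_prob M (\<lambda>n \<omega>. q (j * n div N) \<omega> / real n) (\<lambda>\<omega>. real j / real N * L \<omega>)"
    if N: "N > 0" for j N :: nat
  proof (cases "j = 0")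
    case True
    then show ?thesis by (simp add: conv_in_prob_def q_def)
  next
    case False
    define r where "r n = j * n div N" for n
    define a where "a n = real (r n) / real n" for n
    have "filterlim r at_top sequentially"
      unfolding filterlim_at_top
    proof
      fix Z
      show "\<forall>\<^sub>F n in sequentially. Z \<le> r n"
        using eventually_ge_at_top[of "Z * N"]
      proof eventually_elim
        case (elim n)
        have "Z = Z * N div N" using N by simp
        also have "\<dots> \<le> j * n div N"
          using elim False by (intro div_le_mono) (cases j, auto)
        finally show ?case by (simp add: r_def)
      qed
    qed
    from conv_in_prob_subseq[OF Q this]
    have Qr: "conv_in_prob M (\<lambda>n \<omega>. q (r n) \<omega> / real (r n)) L"
      by (simp add: q_def)
    have r: "real j * real n / real N - 1 \<le> real (r n)" "real (r n) \<le> real j * real n / real N" for n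
    proof -
      have "real (j * n) = real (r n * N + j * n mod N)" by (simp add: r_def)
      then have e: "real j * real n = real (r n) * real N + real (j * n mod N)" by simp
      have "real (j * n mod N) \<le> real N" using N by (simp add: less_imp_le)
      with e N show "real j * real n / real N - 1 \<le> real (r n)" "real (r n) \<le> real j * real n / real N"
        by (simp_all add: field_simps)
    qed
    have a_le: "\<bar>a n\<bar> \<le> real j" for n
    proof (cases "n = 0")
      case False
      have "real j * real n / real N \<le> real j * real n"
        using N mult_left_mono[of 1 "real N" "real j * real n"] by (simp add: field_simps)
      with r(2)[of n] show ?thesis using False by (simp add: a_def field_simps)
    qed (simp add: a_def)
    have "a \<longlonglongrightarrow> real j / real N"
    proof (rule tendsto_sandwich)
      show "\<forall>\<^sub>F n in sequentially. real j / real N - 1 / real n \<le> a n"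
        using eventually_gt_at_top[of 0]
      proof eventually_elim
        case (elim n)
        then show ?case
          using divide_right_mono[OF r(1)[of n], of "real n"] by (simp add: a_def diff_divide_distrib)
      qed
      show "\<forall>\<^sub>F n in sequentially. a n \<le> real j / real N"
        using eventually_gt_at_top[of 0]
        by eventually_elim (use r N in \<open>auto simp: a_def field_simps\<close>)
      show "(\<lambda>n. real j / real N - 1 / real n) \<longlonglongrightarrow> real j / real N"
        using tendsto_diff[OF tendsto_const lim_1_over_n, of "real j / real N"] by simp
    qed simp
    then have aL: "conv_in_prob M (\<lambda>n \<omega>. a n * L \<omega>) (\<lambda>\<omega>. real j / real N * L \<omega>)"
      by (intro conv_in_prob_AE AE_I2 tendsto_mult_right) auto
    have jQ: "conv_in_prob M (\<lambda>n \<omega>. real j * (q (r n) \<omega> / real (r n))) (\<lambda>\<omega>. real j * L \<omega>)"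
      by (rule conv_in_prob_cmult[OF Qr])
    \<comment> \<open>The deterministic factor \<open>a n\<close> is bounded by \<open>j\<close>, so
      multiplication by it preserves convergence to \<open>0\<close> in probability.\<close>
    have "conv_in_prob M (\<lambda>n \<omega>. a n * (q (r n) \<omega> / real (r n) - L \<omega>)) (\<lambda>_. 0)"
    proof (rule conv_in_prob_dominated[OF _ _ jQ])
      fix n \<omega>
      show "\<bar>a n * (q (r n) \<omega> / real (r n) - L \<omega>) - 0\<bar> \<le> \<bar>real j * (q (r n) \<omega> / real (r n)) - real j * L \<omega>\<bar>"
        using mult_right_mono[OF a_le abs_ge_zero[of "q (r n) \<omega> / real (r n) - L \<omega>"], of n]
        by (simp only: abs_mult abs_of_nat diff_0_right flip: right_diff_distrib)
    qed auto
    from conv_in_prob_add[OF _ _ _ _ this aL]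
    have "conv_in_prob M (\<lambda>n \<omega>. a n * (q (r n) \<omega> / real (r n) - L \<omega>) + a n * L \<omega>) (\<lambda>\<omega>. real j / real N * L \<omega>)"
      by simp
    \<comment> \<open>When \<open>r n = 0\<close> the division by zero is harmless:
      \<open>a n\<close> and \<open>q 0\<close> both vanish.\<close>
    also have "(\<lambda>n \<omega>. a n * (q (r n) \<omega> / real (r n) - L \<omega>) + a n * L \<omega>) = (\<lambda>n \<omega>. q (r n) \<omega> / real n)"
    proof (intro ext)
      fix n \<omega>
      show "a n * (q (r n) \<omega> / real (r n) - L \<omega>) + a n * L \<omega> = q (r n) \<omega> / real n"
        by (cases "r n = 0") (auto simp: a_def q_def algebra_simps)
    qed
    finally show ?thesis by (simp add: r_def)
  qed
  show ?thesis
  proof (rule LIMSEQ_I)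
    fix \<eta> :: real assume \<eta>: "\<eta> > 0"
    \<comment> \<open>Over one of the \<open>N\<close> blocks the limit grows by
      \<open>L / N\<close>. \<open>N\<close> is fixed so that this is at most
      \<open>\<delta> / 3\<close> with high probability; the other two thirds are for the errors at
      the two ends of a block.\<close>
    have "conv_in_prob M (\<lambda>N \<omega>. L \<omega> / real N) (\<lambda>_. 0)"
      by (intro conv_in_prob_AE AE_I2 lim_const_over_n) auto
    then have "(\<lambda>N. prob {\<omega> \<in> space M. \<bar>L \<omega> / real N - 0\<bar> > \<delta> / 3}) \<longlonglongrightarrow> 0"
      using \<delta> by (intro conv_in_probD) auto
    then have "\<forall>\<^sub>F N in sequentially. prob {\<omega> \<in> space M. \<bar>L \<omega> / real N - 0\<bar> > \<delta> / 3} < \<eta> / 2"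
      using \<eta> by (intro order_tendstoD) auto
    with eventually_gt_at_top[of 0]
    have "\<forall>\<^sub>F N in sequentially. 0 < N \<and> prob {\<omega> \<in> space M. \<bar>L \<omega> / real N - 0\<bar> > \<delta> / 3} < \<eta> / 2"
      by eventually_elim auto
    then obtain N where N: "0 < N" and LN: "prob {\<omega> \<in> space M. \<bar>L \<omega> / real N - 0\<bar> > \<delta> / 3} < \<eta> / 2"
      using eventually_happens'[OF sequentially_bot] by blast
    let ?L = "{\<omega> \<in> space M. \<bar>L \<omega> / real N - 0\<bar> > \<delta> / 3}"
    let ?A = "\<lambda>j n. {\<omega> \<in> space M. \<bar>q (j * n div N) \<omega> / real n - real j / real N * L \<omega>\<bar> > \<delta> / 3}"
    have "(\<lambda>n. \<Sum>j\<le>N. prob (?A j n)) \<longlonglongrightarrow> (\<Sum>j\<le>N. 0)"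
      using \<delta> by (intro tendsto_sum conv_in_probD conv[OF N]) auto
    then have "\<forall>\<^sub>F n in sequentially. (\<Sum>j\<le>N. prob (?A j n)) < \<eta> / 2"
      using \<eta> by (intro order_tendstoD) auto
    with eventually_gt_at_top[of 0]
    have "\<forall>\<^sub>F n in sequentially. 0 < n \<and> (\<Sum>j\<le>N. prob (?A j n)) < \<eta> / 2"
      by eventually_elim auto
    then obtain n0 where n0: "\<And>n. n \<ge> n0 \<Longrightarrow> 0 < n \<and> (\<Sum>j\<le>N. prob (?A j n)) < \<eta> / 2"
      unfolding eventually_sequentially by blast
    show "\<exists>no. \<forall>n\<ge>no. norm (prob {\<omega> \<in> space M. \<exists>k<n. \<delta> * real n < (Y k \<omega>)\<^sup>2} - 0) < \<eta>"
    proof (intro exI allI impI)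
      fix n assume "n \<ge> n0"
      from n0[OF this] have n: "0 < n" and An: "(\<Sum>j\<le>N. prob (?A j n)) < \<eta> / 2" by auto
      have "{\<omega> \<in> space M. \<exists>k<n. \<delta> * real n < (Y k \<omega>)\<^sup>2} \<subseteq> ?L \<union> (\<Union>j\<le>N. ?A j n)"
      proof (rule subsetI, rule ccontr)
        fix \<omega> assume "\<omega> \<in> {\<omega> \<in> space M. \<exists>k<n. \<delta> * real n < (Y k \<omega>)\<^sup>2}"
        then obtain k where \<omega>: "\<omega> \<in> space M" and k: "k < n" "\<delta> * real n < (Y k \<omega>)\<^sup>2" by auto
        assume nin: "\<omega> \<notin> ?L \<union> (\<Union>j\<le>N. ?A j n)"
        then have "\<bar>L \<omega> / real N - 0\<bar> \<le> \<delta> / 3" using \<omega> by (simp add: not_less)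
        then have 1: "L \<omega> / real N \<le> \<delta> / 3" by linarith
        have 2: "\<bar>q (j * n div N) \<omega> / real n - real j / real N * L \<omega>\<bar> \<le> \<delta> / 3" if "j \<le> N" for j
          using nin \<omega> that by (auto simp: not_less)
        \<comment> \<open>The block that contains \<open>k\<close>: its right end
          \<open>j * n div N\<close> is the first one beyond \<open>k\<close>, and its left end
          belongs to \<open>i = j - 1\<close>. The increment of \<open>q\<close> over this block
          includes \<open>(Y k)^2\<close>.\<close>
        define j where "j = (LEAST j. k < j * n div N)"
        have kN: "k < N * n div N" using N k by simp
        have j: "k < j * n div N" unfolding j_def by (rule LeastI[of _ N]) (rule kN)
        have jN: "j \<le> N" unfolding j_def by (rule Least_le) (rule kN)
        from j obtain i where i: "j = Suc i" by (cases j) auto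
        have ik: "i * n div N \<le> k"
          using not_less_Least[of i "\<lambda>j. k < j * n div N"] i by (simp add: j_def[symmetric] not_less)
        have "q (i * n div N) \<omega> + (Y k \<omega>)\<^sup>2 \<le> q (Suc k) \<omega>"
          using sum_squares_mono[OF ik, of "\<lambda>k. Y k \<omega>"] by (simp add: q_def)
        also have "q (Suc k) \<omega> \<le> q (j * n div N) \<omega>"
          unfolding q_def using j by (intro sum_squares_mono) simp
        finally have "(q (i * n div N) \<omega> + (Y k \<omega>)\<^sup>2) / real n \<le> q (j * n div N) \<omega> / real n"
          by (rule divide_right_mono) simp
        then have 3: "q (i * n div N) \<omega> / real n + (Y k \<omega>)\<^sup>2 / real n \<le> q (j * n div N) \<omega> / real n"
          by (simp add: add_divide_distrib)
        have 4: "real j / real N * L \<omega> = real i / real N * L \<omega> + L \<omega> / real N"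
          by (simp add: i add_divide_distrib distrib_right)
        have "\<delta> < (Y k \<omega>)\<^sup>2 / real n" using k n by (simp add: pos_less_divide_eq)
        moreover have "i \<le> N" using jN i by simp
        ultimately show False
          using 1 3 4 2[OF \<open>i \<le> N\<close>] 2[OF jN] unfolding abs_le_iff by linarith
      qed
      then have "prob {\<omega> \<in> space M. \<exists>k<n. \<delta> * real n < (Y k \<omega>)\<^sup>2} \<le> prob (?L \<union> (\<Union>j\<le>N. ?A j n))"
        by (intro finite_measure_mono) auto
      also have "\<dots> \<le> prob ?L + prob (\<Union>j\<le>N. ?A j n)"
        by (intro measure_Un_le) auto
      also have "prob (\<Union>j\<le>N. ?A j n) \<le> (\<Sum>j\<le>N. prob (?A j n))"
        by (intro finite_measure_subadditive_finite) auto
      finally show "norm (prob {\<omega> \<in> space M. \<exists>k<n. \<delta> * real n < (Y k \<omega>)\<^sup>2} - 0) < \<eta>"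
        using LN An unfolding diff_0_right real_norm_def abs_of_nonneg[OF measure_nonneg] by linarith
    qed
  qed
qed

end

section \<open>A stable central limit theorem for martingale differences\<close>

lemma mult_le_weighted_squares:
  fixes a b :: real
  assumes "w > 0"
  shows "a * b \<le> w * a\<^sup>2 + b\<^sup>2 / w"
proof -
  have "0 \<le> (w * a - b)\<^sup>2 + (w * a)\<^sup>2 + b\<^sup>2" by simp
  then have "2 * (w * (a * b)) \<le> 2 * (w * (w * a\<^sup>2) + b\<^sup>2)"
    by (simp add: power2_eq_square algebra_simps)
  then have "w * (a * b) \<le> w * (w * a\<^sup>2 + b\<^sup>2 / w)"
    using assms by (simp add: distrib_left)
  then show ?thesis using assms by (simp only: mult_le_cancel_left_pos)
qed

lemma integrable_mult_of_squares:
  fixes f g :: "'a \<Rightarrow> real"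
  assumes [measurable]: "f \<in> borel_measurable M" "g \<in> borel_measurable M"
    and "integrable M (\<lambda>x. (f x)\<^sup>2)" "integrable M (\<lambda>x. (g x)\<^sup>2)"
  shows "integrable M (\<lambda>x. f x * g x)"
proof (rule Bochner_Integration.integrable_bound)
  show "integrable M (\<lambda>x. (f x)\<^sup>2 + (g x)\<^sup>2)" using assms by simp
  show "AE x in M. norm (f x * g x) \<le> norm ((f x)\<^sup>2 + (g x)\<^sup>2)"
  proof (rule AE_I2)
    fix x
    have "\<bar>f x\<bar> * \<bar>g x\<bar> \<le> (f x)\<^sup>2 + (g x)\<^sup>2"
      using mult_le_weighted_squares[of 1 "\<bar>f x\<bar>" "\<bar>g x\<bar>"] by simp
    then show "norm (f x * g x) \<le> norm ((f x)\<^sup>2 + (g x)\<^sup>2)"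
      by (simp add: abs_mult)
  qed
qed simp

lemma integrable_square_add:
  fixes f g :: "'a \<Rightarrow> real"
  assumes "f \<in> borel_measurable M" "g \<in> borel_measurable M"
    and "integrable M (\<lambda>x. (f x)\<^sup>2)" "integrable M (\<lambda>x. (g x)\<^sup>2)"
  shows "integrable M (\<lambda>x. (f x + g x)\<^sup>2)"
  using assms integrable_mult_of_squares[OF assms] by (simp add: power2_sum mult.assoc)

lemma (in finite_measure) integrable_of_square:
  fixes f :: "'a \<Rightarrow> real"
  assumes "f \<in> borel_measurable M" "integrable M (\<lambda>x. (f x)\<^sup>2)"
  shows "integrable M f"
  using integrable_mult_of_squares[of f M "\<lambda>_. 1"] assms by simp

text \<open>A substitute for the Cauchy-Schwarz inequality without square roots. The weight is taken
  large where the second factor is merely bounded in \<open>L^2\<close>, and small where the first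
  one is.\<close>

lemma integral_mult_le_weighted:
  fixes f g :: "'a \<Rightarrow> real"
  assumes [measurable]: "f \<in> borel_measurable M" "g \<in> borel_measurable M"
    and "integrable M (\<lambda>x. (f x)\<^sup>2)" "integrable M (\<lambda>x. (g x)\<^sup>2)" "w > 0"
  shows "(\<integral>x. f x * g x \<partial>M) \<le> w * (\<integral>x. (f x)\<^sup>2 \<partial>M) + (\<integral>x. (g x)\<^sup>2 \<partial>M) / w"
proof -
  have "(\<integral>x. f x * g x \<partial>M) \<le> (\<integral>x. w * (f x)\<^sup>2 + (g x)\<^sup>2 / w \<partial>M)"
    using assms by (intro integral_mono integrable_mult_of_squares mult_le_weighted_squares) auto
  also have "\<dots> = w * (\<integral>x. (f x)\<^sup>2 \<partial>M) + (\<integral>x. (g x)\<^sup>2 \<partial>M) / w"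
    using assms by (subst Bochner_Integration.integral_add) auto
  finally show ?thesis .
qed

lemma stopped_measurable:
  assumes "\<And>j. j \<le> k \<Longrightarrow> Y j \<in> borel_measurable F"
  shows "(\<lambda>\<omega>. stopped c (\<lambda>j. Y j \<omega>) k) \<in> borel_measurable F"
proof -
  have [measurable]: "(\<lambda>\<omega>. \<Sum>j<k. (Y j \<omega>)\<^sup>2) \<in> borel_measurable F" "Y k \<in> borel_measurable F"
    using assms by (auto intro!: borel_measurable_sum borel_measurable_power)
  show ?thesis unfolding stopped_def by measurable
qed

text \<open>McLeish's product. It approximates \<open>exp (\<i> S + V / 2)\<close> with \<open>S\<close> the sum and \<open>V\<close> the sum of
  squares of the stopped terms scaled by \<open>s\<close>, and for martingale differences it has mean \<open>1\<close>.\<close>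

definition stopped_prod :: "real \<Rightarrow> real \<Rightarrow> (nat \<Rightarrow> real) \<Rightarrow> nat \<Rightarrow> complex" where
  "stopped_prod c s a n = (\<Prod>k<n. 1 + \<i> * complex_of_real (s * stopped c a k))"

lemma stopped_prod_measurable:
  assumes "\<And>j. j < n \<Longrightarrow> Y j \<in> borel_measurable F"
  shows "(\<lambda>\<omega>. stopped_prod c s (\<lambda>j. Y j \<omega>) n) \<in> borel_measurable F"
  unfolding stopped_prod_def
proof (rule borel_measurable_prod)
  fix k assume "k \<in> {..<n}"
  then have [measurable]: "(\<lambda>\<omega>. stopped c (\<lambda>j. Y j \<omega>) k) \<in> borel_measurable F"
    by (intro stopped_measurable assms) simp
  show "(\<lambda>\<omega>. 1 + \<i> * complex_of_real (s * stopped c (\<lambda>j. Y j \<omega>) k)) \<in> borel_measurable F"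
    by measurable
qed

lemma cmod_stopped_prod_square:
  "(cmod (stopped_prod c s a n))\<^sup>2 = (\<Prod>k<n. 1 + (s * stopped c a k)\<^sup>2)"
  unfolding stopped_prod_def prod_norm[symmetric] prod_power_distrib cmod_one_plus_ii_times
  by (simp add: add_nonneg_nonneg)

lemma cmod_le_one_plus_square: "cmod z \<le> 1 + (cmod z)\<^sup>2"
  using mult_le_weighted_squares[of 1 1 "cmod z"] by simp

lemma (in sigma_finite_subalgebra) real_cond_exp_abs_le:
  assumes int: "integrable M h" and B: "AE x in M. \<bar>h x\<bar> \<le> B"
  shows "AE x in M. \<bar>real_cond_exp M F h x\<bar> \<le> B"
proof -
  have "AE x in M. h x \<le> B" "AE x in M. - B \<le> h x"
    using B by (eventually_elim, simp)+
  then have "AE x in M. real_cond_exp M F h x \<le> B" "AE x in M. - B \<le> real_cond_exp M F h x"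
    using real_cond_exp_le_c[OF int] real_cond_exp_ge_c[OF int] by blast+
  then show ?thesis by eventually_elim auto
qed

section \<open>Filtrations and square-integrable martingale differences\<close>

locale filtered_prob_space = prob_space M for M :: "'a measure" +
  fixes G :: "nat \<Rightarrow> 'a measure"
  assumes filtration: "filtration (space M) G" and subalg: "\<And>n. subalgebra M (G n)"
begin

lemma sigma_finite_sub: "sigma_finite_subalgebra M (G n)"
  by (intro finite_measure_subalgebra_is_sigma_finite finite_measure_subalgebra.intro
      finite_measure_subalgebra_axioms.intro subalg finite_measure_axioms)

lemma subalgebra_G: "m \<le> n \<Longrightarrow> subalgebra (G n) (G m)"
  using filtration.sets_F_mono[OF filtration] filtration.space_F[OF filtration]
  by (simp add: subalgebra_def)

lemma measurable_mono_G: "m \<le> n \<Longrightarrow> f \<in> measurable (G m) N \<Longrightarrow> f \<in> measurable (G n) N"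
  by (rule measurable_from_subalg[OF subalgebra_G])

lemma measurable_G_M: "f \<in> measurable (G n) N \<Longrightarrow> f \<in> measurable M N"
  by (rule measurable_from_subalg[OF subalg])

lemma sets_G_M: "A \<in> sets (G n) \<Longrightarrow> A \<in> events"
  using subalg[of n] by (auto simp: subalgebra_def)

lemma space_in_G: "space M \<in> sets (G n)"
  using subalg[of n] sets.top[of "G n"] by (simp add: subalgebra_def)

end

text \<open>Indices are shifted: \<open>Y k\<close> is the difference revealed at time \<open>k + 1\<close>.\<close>

locale square_integrable_mds = filtered_prob_space M G for M :: "'a measure" and G +
  fixes Y :: "nat \<Rightarrow> 'a \<Rightarrow> real"
  assumes adapted: "\<And>k. Y k \<in> borel_measurable (G (Suc k))"
    and square_integrable: "\<And>k. integrable M (\<lambda>\<omega>. (Y k \<omega>)\<^sup>2)"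
    and cond_mean_zero: "\<And>k. AE \<omega> in M. real_cond_exp M (G k) (Y k) \<omega> = 0"
begin

lemma adapted_le: "k < n \<Longrightarrow> Y k \<in> borel_measurable (G n)"
  using measurable_mono_G[OF _ adapted, of k n] by simp

lemma measurable_Y [measurable]: "Y k \<in> borel_measurable M"
  using measurable_G_M[OF adapted] .

lemma integrable_Y: "integrable M (Y k)"
  using integrable_of_square[OF _ square_integrable] by simp

lemma integral_mult_Y:
  assumes h: "h \<in> borel_measurable (G k)" and hY: "integrable M (\<lambda>\<omega>. h \<omega> * Y k \<omega>)"
  shows "(\<integral>\<omega>. h \<omega> * Y k \<omega> \<partial>M) = 0"
proof -
  interpret F: sigma_finite_subalgebra M "G k" by (rule sigma_finite_sub)
  have "(\<integral>\<omega>. h \<omega> * Y k \<omega> \<partial>M) = (\<integral>\<omega>. h \<omega> * real_cond_exp M (G k) (Y k) \<omega> \<partial>M)"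
    by (rule F.real_cond_exp_intg(2)[symmetric, OF hY h]) simp
  also have "\<dots> = (\<integral>\<omega>. 0 \<partial>M)"
    using cond_mean_zero[of k] measurable_G_M[OF h]
    by (intro integral_cong_AE) auto
  finally show ?thesis by simp
qed

text \<open>Boundedness of \<open>W\<close> makes the product integrable from \<open>Y k\<close>
  alone; real and imaginary parts then fall under the real case.\<close>

lemma integral_complex_mult_Y:
  fixes W :: "'a \<Rightarrow> complex"
  assumes W: "W \<in> borel_measurable (G k)" and B: "\<And>\<omega>. \<omega> \<in> space M \<Longrightarrow> cmod (W \<omega>) \<le> B"
  shows "integrable M (\<lambda>\<omega>. W \<omega> * complex_of_real (Y k \<omega>))"
    and "(\<integral>\<omega>. W \<omega> * complex_of_real (Y k \<omega>) \<partial>M) = 0"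
proof -
  have [measurable]: "W \<in> borel_measurable M" by (rule measurable_G_M[OF W])
  show int: "integrable M (\<lambda>\<omega>. W \<omega> * complex_of_real (Y k \<omega>))"
  proof (rule Bochner_Integration.integrable_bound)
    show "integrable M (\<lambda>\<omega>. B * Y k \<omega>)" using integrable_Y by simp
    show "AE \<omega> in M. norm (W \<omega> * complex_of_real (Y k \<omega>)) \<le> norm (B * Y k \<omega>)"
      by (intro AE_I2) (auto simp: norm_mult abs_mult intro!: mult_right_mono order_trans[OF B])
  qed simp
  have "(\<integral>\<omega>. Re (W \<omega>) * Y k \<omega> \<partial>M) = 0"
    using integrable_Re[OF int] W by (intro integral_mult_Y) simp_all
  moreover have "(\<integral>\<omega>. Im (W \<omega>) * Y k \<omega> \<partial>M) = 0"
    using integrable_Im[OF int] W by (intro integral_mult_Y) simp_all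
  ultimately show "(\<integral>\<omega>. W \<omega> * complex_of_real (Y k \<omega>) \<partial>M) = 0"
    using integral_Re[OF int] integral_Im[OF int] by (simp add: complex_eq_iff)
qed

lemma integrable_square_sum: "integrable M (\<lambda>\<omega>. (\<Sum>k<n. Y k \<omega>)\<^sup>2)"
proof (induction n)
  case (Suc n)
  then show ?case
    using integrable_square_add[of "\<lambda>\<omega>. \<Sum>k<n. Y k \<omega>" M "Y n"] square_integrable by simp
qed simp

lemma integral_square_sum: "(\<integral>\<omega>. (\<Sum>k<n. Y k \<omega>)\<^sup>2 \<partial>M) = (\<Sum>k<n. \<integral>\<omega>. (Y k \<omega>)\<^sup>2 \<partial>M)"
proof (induction n)
  case (Suc n)
  let ?S = "\<lambda>\<omega>. \<Sum>k<n. Y k \<omega>"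
  have SY: "integrable M (\<lambda>\<omega>. ?S \<omega> * Y n \<omega>)"
    by (intro integrable_mult_of_squares integrable_square_sum square_integrable) auto
  have "?S \<in> borel_measurable (G n)"
    by (intro borel_measurable_sum adapted_le) simp
  from integral_mult_Y[OF this SY] have 0: "(\<integral>\<omega>. ?S \<omega> * Y n \<omega> \<partial>M) = 0" .
  have "(\<integral>\<omega>. (?S \<omega> + Y n \<omega>)\<^sup>2 \<partial>M) = (\<integral>\<omega>. ((?S \<omega>)\<^sup>2 + (Y n \<omega>)\<^sup>2) + 2 * (?S \<omega> * Y n \<omega>) \<partial>M)"
    by (simp add: power2_sum mult.assoc)
  also have "\<dots> = (\<integral>\<omega>. (?S \<omega>)\<^sup>2 \<partial>M) + (\<integral>\<omega>. (Y n \<omega>)\<^sup>2 \<partial>M) + 2 * (\<integral>\<omega>. ?S \<omega> * Y n \<omega> \<partial>M)"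
    using SY integrable_square_sum[of n] square_integrable[of n] by simp
  finally show ?case using Suc 0 by simp
qed simp

section \<open>McLeish's product along the martingale differences\<close>

abbreviation T :: "real \<Rightarrow> real \<Rightarrow> nat \<Rightarrow> 'a \<Rightarrow> complex" where
  "T c s n \<omega> \<equiv> stopped_prod c s (\<lambda>j. Y j \<omega>) n"

lemma measurable_T_G: "T c s n \<in> borel_measurable (G n)"
  by (rule stopped_prod_measurable) (rule adapted_le)

lemma measurable_T [measurable]: "T c s n \<in> borel_measurable M"
  by (rule measurable_G_M[OF measurable_T_G])

lemma T_square_le:
  "0 \<le> c \<Longrightarrow> (cmod (T c s n \<omega>))\<^sup>2 \<le> exp (s\<^sup>2 * c) * (1 + s\<^sup>2 * (\<Sum>k<n. (Y k \<omega>)\<^sup>2))"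
  unfolding cmod_stopped_prod_square by (rule prod_stopped_le)

lemma integrable_T_square: "0 \<le> c \<Longrightarrow> integrable M (\<lambda>\<omega>. (cmod (T c s n \<omega>))\<^sup>2)"
  by (rule Bochner_Integration.integrable_bound[where
      f="\<lambda>\<omega>. exp (s\<^sup>2 * c) * (1 + s\<^sup>2 * (\<Sum>k<n. (Y k \<omega>)\<^sup>2))"])
     (auto intro!: square_integrable AE_I2 order_trans[OF T_square_le] add_nonneg_nonneg sum_nonneg
        Bochner_Integration.integrable_sum Bochner_Integration.integrable_add integrable_mult_right)

lemma integrable_T:
  assumes "0 \<le> c"
  shows "integrable M (T c s n)"
proof (rule Bochner_Integration.integrable_bound[where f="\<lambda>\<omega>. 1 + (cmod (T c s n \<omega>))\<^sup>2"])
  show "AE \<omega> in M. cmod (T c s n \<omega>) \<le> norm (1 + (cmod (T c s n \<omega>))\<^sup>2)"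
    using cmod_le_one_plus_square by (intro AE_I2) (simp add: abs_of_nonneg add_nonneg_nonneg)
qed (use integrable_T_square[OF assms] in auto)

lemma integrable_bounded_mult_T:
  assumes c: "0 \<le> c" and [measurable]: "h \<in> borel_measurable M" and B: "AE \<omega> in M. \<bar>h \<omega>\<bar> \<le> B"
  shows "integrable M (\<lambda>\<omega>. complex_of_real (h \<omega>) * T c s n \<omega>)"
proof (rule Bochner_Integration.integrable_bound[where f="\<lambda>\<omega>. B * cmod (T c s n \<omega>)"])
  show "integrable M (\<lambda>\<omega>. B * cmod (T c s n \<omega>))" using integrable_T[OF c] by simp
  show "AE \<omega> in M. norm (complex_of_real (h \<omega>) * T c s n \<omega>) \<le> norm (B * cmod (T c s n \<omega>))"
    using B by eventually_elim (auto simp: norm_mult abs_mult intro!: mult_right_mono)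
qed simp

text \<open>Passing from \<open>n\<close> to \<open>n + 1\<close> adds \<open>\<i> s W Y n\<close>,
  where \<open>W\<close> is \<open>h T\<close> restricted to the event that the test at
  \<open>n\<close> is passed. The test involves the past only, so \<open>W\<close> is
  \<open>G n\<close>-measurable, and on that event \<open>T\<close> is bounded; hence the added term
  integrates to \<open>0\<close>.\<close>

lemma integral_mult_T_Suc:
  assumes c: "0 \<le> c" and h: "h \<in> borel_measurable (G n)" and B: "AE \<omega> in M. \<bar>h \<omega>\<bar> \<le> B"
  shows "(\<integral>\<omega>. complex_of_real (h \<omega>) * T c s (Suc n) \<omega> \<partial>M) = (\<integral>\<omega>. complex_of_real (h \<omega>) * T c s n \<omega> \<partial>M)"
proof -
  \<comment> \<open>A version of \<open>h\<close> bounded everywhere, because the orthogonality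
    lemma asks for a pointwise bound.\<close>
  define h' where "h' \<omega> = (if \<bar>h \<omega>\<bar> \<le> B then h \<omega> else 0)" for \<omega>
  have h'_meas [measurable]: "h' \<in> borel_measurable (G n)" using h unfolding h'_def by measurable
  have hh': "AE \<omega> in M. h \<omega> = h' \<omega>" using B by eventually_elim (simp add: h'_def)
  have [measurable]: "h \<in> borel_measurable M" "h' \<in> borel_measurable M"
    by (rule measurable_G_M[OF h], rule measurable_G_M[OF h'_meas])
  have B': "AE \<omega> in M. \<bar>h' \<omega>\<bar> \<le> \<bar>B\<bar>" by (intro AE_I2) (simp add: h'_def)
  \<comment> \<open>Building the test of \<open>stopped\<close> into \<open>W\<close> is what makes
    it bounded: without it \<open>T\<close> is only square integrable.\<close>
  define W where "W \<omega> = (if (\<Sum>j<n. (Y j \<omega>)\<^sup>2) \<le> c then complex_of_real (h' \<omega>) * T c s n \<omega> else 0)" for \<omega>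
  have [measurable]: "(\<lambda>\<omega>. \<Sum>j<n. (Y j \<omega>)\<^sup>2) \<in> borel_measurable (G n)" "T c s n \<in> borel_measurable (G n)"
    using adapted_le by (auto intro!: borel_measurable_sum borel_measurable_power measurable_T_G)
  have W: "W \<in> borel_measurable (G n)"
    unfolding W_def by measurable
  have WB: "cmod (W \<omega>) \<le> \<bar>B\<bar> * sqrt (exp (s\<^sup>2 * c))" for \<omega>
  proof (cases "(\<Sum>j<n. (Y j \<omega>)\<^sup>2) \<le> c")
    case True
    have "cmod (T c s n \<omega>) \<le> sqrt (exp (s\<^sup>2 * c))"
      using prod_stopped_le_exp[OF True, of s] by (intro real_le_rsqrt) (simp add: cmod_stopped_prod_square)
    then show ?thesis using True by (auto simp: W_def h'_def norm_mult intro!: mult_mono)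
  qed (simp add: W_def)
  have e: "complex_of_real (h' \<omega>) * T c s (Suc n) \<omega> =
      complex_of_real (h' \<omega>) * T c s n \<omega> + \<i> * complex_of_real s * (W \<omega> * complex_of_real (Y n \<omega>))" for \<omega>
    by (simp add: stopped_prod_def W_def stopped_def algebra_simps)
  have "(\<integral>\<omega>. complex_of_real (h \<omega>) * T c s (Suc n) \<omega> \<partial>M) = (\<integral>\<omega>. complex_of_real (h' \<omega>) * T c s (Suc n) \<omega> \<partial>M)"
    using hh' by (intro integral_cong_AE) auto
  also have "\<dots> = (\<integral>\<omega>. complex_of_real (h' \<omega>) * T c s n \<omega> \<partial>M) + \<i> * complex_of_real s * (\<integral>\<omega>. W \<omega> * complex_of_real (Y n \<omega>) \<partial>M)"
    unfolding e using integral_complex_mult_Y(1)[OF W WB] integrable_bounded_mult_T[OF c _ B']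
    by (subst Bochner_Integration.integral_add) auto
  also have "\<dots> = (\<integral>\<omega>. complex_of_real (h' \<omega>) * T c s n \<omega> \<partial>M)"
    using integral_complex_mult_Y(2)[OF W WB] by simp
  also have "\<dots> = (\<integral>\<omega>. complex_of_real (h \<omega>) * T c s n \<omega> \<partial>M)"
    using hh' by (intro integral_cong_AE) auto
  finally show ?thesis .
qed

lemma integral_mult_T_stable:
  assumes c: "0 \<le> c" and h: "h \<in> borel_measurable (G m)" and B: "AE \<omega> in M. \<bar>h \<omega>\<bar> \<le> B" and "m \<le> n"
  shows "(\<integral>\<omega>. complex_of_real (h \<omega>) * T c s n \<omega> \<partial>M) = (\<integral>\<omega>. complex_of_real (h \<omega>) * T c s m \<omega> \<partial>M)"
  using \<open>m \<le> n\<close>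
proof (induction n rule: dec_induct)
  case (step n)
  then show ?case
    using integral_mult_T_Suc[OF c measurable_mono_G[OF _ h, of n] B] by simp
qed simp

lemma integral_T_mult_cond_exp:
  assumes c: "0 \<le> c" and h [measurable]: "h \<in> borel_measurable M" and B: "AE \<omega> in M. \<bar>h \<omega>\<bar> \<le> B"
  shows "(\<integral>\<omega>. complex_of_real (real_cond_exp M (G n) h \<omega>) * T c s n \<omega> \<partial>M)
    = (\<integral>\<omega>. complex_of_real (h \<omega>) * T c s n \<omega> \<partial>M)"
proof -
  interpret F: sigma_finite_subalgebra M "G n" by (rule sigma_finite_sub)
  note int = integrable_bounded_mult_T[OF c h B, of s n]
  have int_h: "integrable M h" using B by (intro integrable_const_bound[where B=B]) auto
  have B': "AE \<omega> in M. \<bar>real_cond_exp M (G n) h \<omega>\<bar> \<le> B"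
    by (rule F.real_cond_exp_abs_le[OF int_h B])
  have int': "integrable M (\<lambda>\<omega>. complex_of_real (real_cond_exp M (G n) h \<omega>) * T c s n \<omega>)"
    by (rule integrable_bounded_mult_T[OF c _ B']) simp
  have TG: "T c s n \<in> borel_measurable (G n)" by (rule measurable_T_G)
  have "(\<integral>\<omega>. Re (T c s n \<omega>) * real_cond_exp M (G n) h \<omega> \<partial>M) = (\<integral>\<omega>. Re (T c s n \<omega>) * h \<omega> \<partial>M)"
    using integrable_Re[OF int] TG by (intro F.real_cond_exp_intg(2)) (simp_all add: mult.commute)
  moreover have "(\<integral>\<omega>. Im (T c s n \<omega>) * real_cond_exp M (G n) h \<omega> \<partial>M) = (\<integral>\<omega>. Im (T c s n \<omega>) * h \<omega> \<partial>M)"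
    using integrable_Im[OF int] TG by (intro F.real_cond_exp_intg(2)) (simp_all add: mult.commute)
  ultimately show ?thesis
    using integral_Re[OF int] integral_Im[OF int] integral_Re[OF int'] integral_Im[OF int']
    by (simp add: complex_eq_iff mult.commute)
qed

end

lemma square_le_of_abs_le: "\<bar>x\<bar> \<le> B \<Longrightarrow> x\<^sup>2 \<le> (B :: real)\<^sup>2"
  using power_mono[of "\<bar>x\<bar>" B 2] by simp

section \<open>Limits of integrals against the product\<close>

context square_integrable_mds begin

text \<open>Pythagoras: testing against the \<open>G m\<close>-measurable \<open>E[h | G m]\<close>,
  both \<open>E[h | G n]\<close> and \<open>E[h | G m]\<close> may be replaced by \<open>h\<close>,
  so the mixed term equals the smaller square.\<close>

lemma integral_cond_exp_square_diff:
  assumes h [measurable]: "h \<in> borel_measurable M" and B: "AE \<omega> in M. \<bar>h \<omega>\<bar> \<le> B" and "m \<le> n"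
  shows "(\<integral>\<omega>. (real_cond_exp M (G n) h \<omega> - real_cond_exp M (G m) h \<omega>)\<^sup>2 \<partial>M)
    = (\<integral>\<omega>. (real_cond_exp M (G n) h \<omega>)\<^sup>2 \<partial>M) - (\<integral>\<omega>. (real_cond_exp M (G m) h \<omega>)\<^sup>2 \<partial>M)"
proof -
  interpret Fm: sigma_finite_subalgebra M "G m" by (rule sigma_finite_sub)
  interpret Fn: sigma_finite_subalgebra M "G n" by (rule sigma_finite_sub)
  let ?m = "real_cond_exp M (G m) h" and ?n = "real_cond_exp M (G n) h"
  have int_h: "integrable M h" using B by (intro integrable_const_bound[where B=B]) auto
  have bm: "AE \<omega> in M. \<bar>?m \<omega>\<bar> \<le> B" and bn: "AE \<omega> in M. \<bar>?n \<omega>\<bar> \<le> B"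
    using Fm.real_cond_exp_abs_le[OF int_h B] Fn.real_cond_exp_abs_le[OF int_h B] by auto
  have bounded_mult: "integrable M (\<lambda>\<omega>. f \<omega> * g \<omega>)"
    if "AE \<omega> in M. \<bar>f \<omega>\<bar> \<le> B" "AE \<omega> in M. \<bar>g \<omega>\<bar> \<le> B" "f \<in> borel_measurable M" "g \<in> borel_measurable M"
    for f g :: "'a \<Rightarrow> real"
  proof (rule integrable_const_bound[where B="B * B"])
    show "AE \<omega> in M. norm (f \<omega> * g \<omega>) \<le> B * B"
      using that(1,2)
    proof eventually_elim
      case (elim \<omega>)
      then show ?case
        unfolding real_norm_def abs_mult
        by (intro mult_mono order_trans[OF abs_ge_zero elim(1)]) simp_all
    qed
    show "(\<lambda>\<omega>. f \<omega> * g \<omega>) \<in> borel_measurable M" using that(3,4) by measurable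
  qed
  have m: "?m \<in> borel_measurable (G m)" by simp
  note m = m measurable_mono_G[OF \<open>m \<le> n\<close> m]
  have "(\<integral>\<omega>. ?m \<omega> * ?n \<omega> \<partial>M) = (\<integral>\<omega>. ?m \<omega> * h \<omega> \<partial>M)"
    by (rule Fn.real_cond_exp_intg(2)[OF bounded_mult[OF bm B _ h] m(2) h]) simp
  moreover have "(\<integral>\<omega>. ?m \<omega> * ?m \<omega> \<partial>M) = (\<integral>\<omega>. ?m \<omega> * h \<omega> \<partial>M)"
    by (rule Fm.real_cond_exp_intg(2)[OF bounded_mult[OF bm B _ h] m(1) h]) simp
  ultimately have "(\<integral>\<omega>. ?m \<omega> * ?n \<omega> \<partial>M) = (\<integral>\<omega>. (?m \<omega>)\<^sup>2 \<partial>M)"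
    by (simp add: power2_eq_square)
  moreover have "(\<integral>\<omega>. (?n \<omega> - ?m \<omega>)\<^sup>2 \<partial>M) = (\<integral>\<omega>. ((?n \<omega>)\<^sup>2 + (?m \<omega>)\<^sup>2) - 2 * (?m \<omega> * ?n \<omega>) \<partial>M)"
    by (simp add: power2_diff mult.commute mult.left_commute)
  moreover have "\<dots> = (\<integral>\<omega>. (?n \<omega>)\<^sup>2 \<partial>M) + (\<integral>\<omega>. (?m \<omega>)\<^sup>2 \<partial>M) - 2 * (\<integral>\<omega>. ?m \<omega> * ?n \<omega> \<partial>M)"
    using bounded_mult[OF bm bm] bounded_mult[OF bn bn] bounded_mult[OF bm bn]
    by (simp add: power2_eq_square)
  ultimately show ?thesis by simp
qed

text \<open>By the Pythagorean identity the second moments increase, and they are bounded by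
  \<open>B^2\<close>; the squared distances are their increments. The Cauchy property is enough, and
  the limit of \<open>E[h | G n]\<close> need not be identified.\<close>

lemma cond_exp_L2_Cauchy:
  assumes h [measurable]: "h \<in> borel_measurable M" and B: "AE \<omega> in M. \<bar>h \<omega>\<bar> \<le> B" and "\<epsilon> > 0"
  obtains m where "\<And>n. m \<le> n \<Longrightarrow>
    (\<integral>\<omega>. (real_cond_exp M (G n) h \<omega> - real_cond_exp M (G m) h \<omega>)\<^sup>2 \<partial>M) < \<epsilon>"
proof -
  define a where "a n = (\<integral>\<omega>. (real_cond_exp M (G n) h \<omega>)\<^sup>2 \<partial>M)" for n
  have int_h: "integrable M h" using B by (intro integrable_const_bound[where B=B]) auto
  have d: "(\<integral>\<omega>. (real_cond_exp M (G n) h \<omega> - real_cond_exp M (G m) h \<omega>)\<^sup>2 \<partial>M) = a n - a m" if "m \<le> n" for m n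
    unfolding a_def by (rule integral_cond_exp_square_diff[OF h B that])
  have "incseq a"
  proof (rule incseq_SucI)
    fix n
    have "0 \<le> (\<integral>\<omega>. (real_cond_exp M (G (Suc n)) h \<omega> - real_cond_exp M (G n) h \<omega>)\<^sup>2 \<partial>M)"
      by simp
    then show "a n \<le> a (Suc n)" using d[of n "Suc n"] by simp
  qed
  moreover have "a n \<le> B\<^sup>2" for n
  proof -
    interpret F: sigma_finite_subalgebra M "G n" by (rule sigma_finite_sub)
    have "AE \<omega> in M. (real_cond_exp M (G n) h \<omega>)\<^sup>2 \<le> B\<^sup>2"
      using F.real_cond_exp_abs_le[OF int_h B] by eventually_elim (rule square_le_of_abs_le)
    then have "a n \<le> (\<integral>\<omega>. B\<^sup>2 \<partial>M)"
      unfolding a_def by (intro integral_mono_AE integrable_const_bound[where B="B\<^sup>2"]) auto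
    then show ?thesis by (simp add: prob_space)
  qed
  ultimately obtain L where L: "a \<longlonglongrightarrow> L" "\<And>n. a n \<le> L"
    using incseq_convergent[of a "B\<^sup>2"] by metis
  from order_tendstoD(1)[OF L(1), of "L - \<epsilon>"] \<open>\<epsilon> > 0\<close>
  obtain m where m: "\<And>n. m \<le> n \<Longrightarrow> L - \<epsilon> < a n" unfolding eventually_sequentially by auto
  show ?thesis
  proof (rule that)
    fix n assume "m \<le> n"
    then show "(\<integral>\<omega>. (real_cond_exp M (G n) h \<omega> - real_cond_exp M (G m) h \<omega>)\<^sup>2 \<partial>M) < \<epsilon>"
      using d[of m n] m[of m] L(2)[of n] by simp
  qed
qed

text \<open>With the number \<open>m\<close> of factors fixed, each factor tends to
  \<open>1\<close>, whether stopped or not. The overshoot bound of \<open>prod_stopped_le\<close>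
  gives an integrable majorant independent of \<open>n\<close>.\<close>

lemma tendsto_integral_T_fixed:
  assumes c: "0 \<le> c" and h [measurable]: "h \<in> borel_measurable M" and B: "AE \<omega> in M. \<bar>h \<omega>\<bar> \<le> B"
  shows "(\<lambda>n. \<integral>\<omega>. complex_of_real (h \<omega>) * T (c * real n) (t / sqrt (real n)) m \<omega> \<partial>M)
    \<longlonglongrightarrow> (\<integral>\<omega>. complex_of_real (h \<omega>) \<partial>M)"
proof (rule integral_dominated_convergence[where
      w="\<lambda>\<omega>. \<bar>B\<bar> * (1 + exp (t\<^sup>2 * c) * (1 + t\<^sup>2 * (\<Sum>k<m. (Y k \<omega>)\<^sup>2)))"])
  show "integrable M (\<lambda>\<omega>. \<bar>B\<bar> * (1 + exp (t\<^sup>2 * c) * (1 + t\<^sup>2 * (\<Sum>k<m. (Y k \<omega>)\<^sup>2))))"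
    by (auto intro!: Bochner_Integration.integrable_add integrable_mult_right
        Bochner_Integration.integrable_sum square_integrable)
  have lim0: "(\<lambda>n. stopped (c * real n) a k / sqrt (real n)) \<longlonglongrightarrow> 0" for a k
  proof (rule Lim_null_comparison)
    show "\<forall>\<^sub>F n in sequentially. norm (stopped (c * real n) a k / sqrt (real n)) \<le> \<bar>a k\<bar> / sqrt (real n)"
      by (intro always_eventually allI) (simp add: stopped_def divide_right_mono)
    show "(\<lambda>n. \<bar>a k\<bar> / sqrt (real n)) \<longlonglongrightarrow> 0"
      by (intro tendsto_divide_0[OF tendsto_const] filterlim_at_top_imp_at_infinity
          filterlim_compose[OF sqrt_at_top filterlim_real_sequentially])
  qed
  have "(\<lambda>n. T (c * real n) (t / sqrt (real n)) m \<omega>) \<longlonglongrightarrow> 1" for \<omega>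
  proof -
    have "(\<lambda>n. \<Prod>k<m. 1 + \<i> * complex_of_real (t * (stopped (c * real n) (\<lambda>j. Y j \<omega>) k / sqrt (real n))))
        \<longlonglongrightarrow> (\<Prod>k<m. 1 + \<i> * complex_of_real (t * 0))"
      by (intro tendsto_intros lim0)
    then show ?thesis by (simp add: stopped_prod_def)
  qed
  then have "(\<lambda>n. complex_of_real (h \<omega>) * T (c * real n) (t / sqrt (real n)) m \<omega>) \<longlonglongrightarrow> complex_of_real (h \<omega>) * 1" for \<omega>
    by (rule tendsto_mult_left)
  then show "AE \<omega> in M. (\<lambda>n. complex_of_real (h \<omega>) * T (c * real n) (t / sqrt (real n)) m \<omega>) \<longlonglongrightarrow> complex_of_real (h \<omega>)"
    by simp
  fix n
  \<comment> \<open>The level \<open>c n\<close> and the scale \<open>t / sqrt n\<close> are matched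
    so that \<open>n\<close> cancels. For \<open>n = 0\<close> the scale is
    \<open>t / 0 = 0\<close>.\<close>
  have s: "(t / sqrt (real n))\<^sup>2 * (c * real n) \<le> t\<^sup>2 * c" "(t / sqrt (real n))\<^sup>2 \<le> t\<^sup>2"
    using c by (cases "n = 0"; simp add: power_divide divide_le_eq mult_le_cancel_left1)+
  have T_le: "cmod (T (c * real n) (t / sqrt (real n)) m \<omega>) \<le> 1 + exp (t\<^sup>2 * c) * (1 + t\<^sup>2 * (\<Sum>k<m. (Y k \<omega>)\<^sup>2))" for \<omega>
  proof (rule order_trans[OF cmod_le_one_plus_square], rule add_left_mono, rule order_trans[OF T_square_le])
    show "exp ((t / sqrt (real n))\<^sup>2 * (c * real n)) * (1 + (t / sqrt (real n))\<^sup>2 * (\<Sum>k<m. (Y k \<omega>)\<^sup>2))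
      \<le> exp (t\<^sup>2 * c) * (1 + t\<^sup>2 * (\<Sum>k<m. (Y k \<omega>)\<^sup>2))"
      using s by (intro mult_mono add_left_mono) (auto intro!: add_nonneg_nonneg mult_right_mono mult_nonneg_nonneg sum_nonneg)
  qed (use c in simp)
  show "AE \<omega> in M. norm (complex_of_real (h \<omega>) * T (c * real n) (t / sqrt (real n)) m \<omega>)
      \<le> \<bar>B\<bar> * (1 + exp (t\<^sup>2 * c) * (1 + t\<^sup>2 * (\<Sum>k<m. (Y k \<omega>)\<^sup>2)))"
    using B
  proof eventually_elim
    case (elim \<omega>)
    show ?case
      unfolding norm_mult norm_of_real using elim by (intro mult_mono T_le) auto
  qed
qed auto

text \<open>Integrated form of the overshoot bound, uniform in \<open>n\<close>: the only place
  where the extra term needs the \<open>L^1\<close> bound \<open>K\<close>.\<close>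

lemma integral_T_square_le:
  assumes c: "0 \<le> c" and K: "(\<integral>\<omega>. (\<Sum>k<n. (Y k \<omega>)\<^sup>2) / real n \<partial>M) \<le> K"
  shows "(\<integral>\<omega>. (cmod (T (c * real n) (t / sqrt (real n)) n \<omega>))\<^sup>2 \<partial>M) \<le> exp (t\<^sup>2 * c) * (1 + t\<^sup>2 * K)"
proof (cases "n = 0")
  case True
  then have "0 \<le> K" using K by simp
  then have "1 * 1 \<le> exp (t\<^sup>2 * c) * (1 + t\<^sup>2 * K)"
    using c by (intro mult_mono) auto
  then show ?thesis using True by (simp add: stopped_prod_def prob_space)
next
  case False
  let ?q = "\<lambda>\<omega>. (\<Sum>k<n. (Y k \<omega>)\<^sup>2) / real n"
  have q: "integrable M ?q"
    using square_integrable by auto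
  have "(\<integral>\<omega>. (cmod (T (c * real n) (t / sqrt (real n)) n \<omega>))\<^sup>2 \<partial>M) \<le> (\<integral>\<omega>. exp (t\<^sup>2 * c) * (1 + t\<^sup>2 * ?q \<omega>) \<partial>M)"
  proof (rule integral_mono)
    fix \<omega>
    show "(cmod (T (c * real n) (t / sqrt (real n)) n \<omega>))\<^sup>2 \<le> exp (t\<^sup>2 * c) * (1 + t\<^sup>2 * ?q \<omega>)"
      using T_square_le[of "c * real n" "t / sqrt (real n)" \<omega> n] c False
      by (simp add: power_divide)
    show "integrable M (\<lambda>\<omega>. exp (t\<^sup>2 * c) * (1 + t\<^sup>2 * ?q \<omega>))"
      using q by (intro integrable_mult_right Bochner_Integration.integrable_add) auto
  qed (use c in \<open>auto intro!: integrable_T_square\<close>)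
  also have "\<dots> = exp (t\<^sup>2 * c) * (1 + t\<^sup>2 * (\<integral>\<omega>. ?q \<omega> \<partial>M))"
  proof -
    have "(\<integral>\<omega>. 1 + t\<^sup>2 * ?q \<omega> \<partial>M) = 1 + t\<^sup>2 * (\<integral>\<omega>. ?q \<omega> \<partial>M)"
      using q by (subst Bochner_Integration.integral_add)
        (auto simp: prob_space simp del: integral_divide_zero times_divide_eq_right intro!: integrable_mult_right)
    then show ?thesis by simp
  qed
  also have "\<dots> \<le> exp (t\<^sup>2 * c) * (1 + t\<^sup>2 * K)"
    using K by (intro mult_left_mono add_left_mono) auto
  finally show ?thesis .
qed

text \<open>Since \<open>T\<close> is adapted, \<open>h\<close> may be replaced by \<open>E[h | G n]\<close>, then up to a small \<open>L\<^sup>2\<close>-error by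
  \<open>E[h | G m]\<close> with \<open>m\<close> fixed. The martingale property reduces \<open>T\<close> to its first \<open>m\<close> factors, which
  tend to \<open>1\<close>. No measurability of \<open>h\<close> with respect to the filtration is involved, and this is what
  makes the convergence stable.\<close>

lemma tendsto_integral_T:
  assumes c: "0 \<le> c" and h [measurable]: "h \<in> borel_measurable M" and B: "AE \<omega> in M. \<bar>h \<omega>\<bar> \<le> B"
    and K: "\<And>n :: nat. (\<integral>\<omega>. (\<Sum>k<n. (Y k \<omega>)\<^sup>2) / real n \<partial>M) \<le> K"
  shows "(\<lambda>n. \<integral>\<omega>. complex_of_real (h \<omega>) * T (c * real n) (t / sqrt (real n)) n \<omega> \<partial>M)
    \<longlonglongrightarrow> (\<integral>\<omega>. complex_of_real (h \<omega>) \<partial>M)"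
proof (rule LIMSEQ_I)
  fix \<epsilon> :: real assume \<epsilon>: "\<epsilon> > 0"
  define Tn where "Tn n = T (c * real n) (t / sqrt (real n))" for n
  define C where "C = exp (t\<^sup>2 * c) * (1 + t\<^sup>2 * K)"
  define H where "H n = real_cond_exp M (G n) h" for n
  have "0 \<le> K" using K[of 0] by simp
  then have C: "C > 0" by (simp add: C_def add_pos_nonneg)
  \<comment> \<open>The weight makes the contribution of the product
    \<open>C / w = \<epsilon> / 4\<close>; afterwards \<open>m\<close> is chosen so that
    \<open>w\<close> times the squared distance of the conditional expectations is below
    \<open>\<epsilon> / 4\<close>.\<close>
  define w where "w = 4 * C / \<epsilon>"
  have w: "w > 0" using C \<epsilon> by (simp add: w_def)
  have Cw: "C / w = \<epsilon> / 4" using C \<epsilon> by (simp add: w_def)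
  have "\<epsilon> / (4 * w) > 0" using \<epsilon> w by simp
  from cond_exp_L2_Cauchy[OF h B this] obtain m where
    m: "\<And>n. m \<le> n \<Longrightarrow> (\<integral>\<omega>. (H n \<omega> - H m \<omega>)\<^sup>2 \<partial>M) < \<epsilon> / (4 * w)"
    unfolding H_def by auto
  have int_h: "integrable M h" using B by (intro integrable_const_bound[where B=B]) auto
  have HB: "AE \<omega> in M. \<bar>H n \<omega>\<bar> \<le> B" for n
    unfolding H_def by (rule sigma_finite_subalgebra.real_cond_exp_abs_le[OF sigma_finite_sub int_h B])
  have [measurable]: "H n \<in> borel_measurable M" for n unfolding H_def by simp
  have [measurable]: "Tn n k \<in> borel_measurable M" for n k unfolding Tn_def by simp
  have "(\<integral>\<omega>. H m \<omega> \<partial>M) = (\<integral>\<omega>. h \<omega> \<partial>M)"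
    unfolding H_def by (rule sigma_finite_subalgebra.real_cond_exp_int(2)[OF sigma_finite_sub int_h])
  then have Hh: "(\<integral>\<omega>. complex_of_real (H m \<omega>) \<partial>M) = (\<integral>\<omega>. complex_of_real (h \<omega>) \<partial>M)" by simp
  have cn: "0 \<le> c * real n" for n using c by simp
  have "(\<lambda>n. \<integral>\<omega>. complex_of_real (H m \<omega>) * Tn n m \<omega> \<partial>M) \<longlonglongrightarrow> (\<integral>\<omega>. complex_of_real (h \<omega>) \<partial>M)"
    unfolding Hh[symmetric] Tn_def by (rule tendsto_integral_T_fixed[OF c _ HB]) simp
  from LIMSEQ_D[OF this, of "\<epsilon> / 2"] \<epsilon> obtain n0 where
    n0: "\<And>n. n0 \<le> n \<Longrightarrow> cmod ((\<integral>\<omega>. complex_of_real (H m \<omega>) * Tn n m \<omega> \<partial>M) - (\<integral>\<omega>. complex_of_real (h \<omega>) \<partial>M)) < \<epsilon> / 2"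
    by auto
  show "\<exists>no. \<forall>n\<ge>no. norm ((\<integral>\<omega>. complex_of_real (h \<omega>) * T (c * real n) (t / sqrt (real n)) n \<omega> \<partial>M) - (\<integral>\<omega>. complex_of_real (h \<omega>) \<partial>M)) < \<epsilon>"
  proof (intro exI allI impI)
    fix n assume n: "max n0 m \<le> n"
    have D: "AE \<omega> in M. \<bar>H n \<omega> - H m \<omega>\<bar> \<le> 2 * B"
      using HB[of n] HB[of m] by eventually_elim auto
    have D2: "integrable M (\<lambda>\<omega>. \<bar>H n \<omega> - H m \<omega>\<bar>\<^sup>2)"
    proof (rule integrable_const_bound[where B="(2 * B)\<^sup>2"])
      show "AE \<omega> in M. norm (\<bar>H n \<omega> - H m \<omega>\<bar>\<^sup>2) \<le> (2 * B)\<^sup>2"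
        using D by eventually_elim (simp only: power2_abs real_norm_def square_le_of_abs_le abs_power2)
    qed simp
    note int = integrable_bounded_mult_T[OF cn _ HB]
    have "(\<integral>\<omega>. complex_of_real (h \<omega>) * Tn n n \<omega> \<partial>M) = (\<integral>\<omega>. complex_of_real (H n \<omega>) * Tn n n \<omega> \<partial>M)"
      unfolding H_def Tn_def by (rule integral_T_mult_cond_exp[OF cn h B, symmetric])
    also have "\<dots> = (\<integral>\<omega>. complex_of_real (H n \<omega> - H m \<omega>) * Tn n n \<omega> + complex_of_real (H m \<omega>) * Tn n n \<omega> \<partial>M)"
      by (simp add: algebra_simps)
    also have "\<dots> = (\<integral>\<omega>. complex_of_real (H n \<omega> - H m \<omega>) * Tn n n \<omega> \<partial>M) + (\<integral>\<omega>. complex_of_real (H m \<omega>) * Tn n n \<omega> \<partial>M)"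
      unfolding Tn_def
      by (intro Bochner_Integration.integral_add integrable_bounded_mult_T[OF cn _ D] int) simp_all
    also have "(\<integral>\<omega>. complex_of_real (H m \<omega>) * Tn n n \<omega> \<partial>M) = (\<integral>\<omega>. complex_of_real (H m \<omega>) * Tn n m \<omega> \<partial>M)"
      unfolding Tn_def by (rule integral_mult_T_stable[OF cn _ HB]) (use n in \<open>auto simp: H_def\<close>)
    finally have 1: "(\<integral>\<omega>. complex_of_real (h \<omega>) * Tn n n \<omega> \<partial>M) =
      (\<integral>\<omega>. complex_of_real (H n \<omega> - H m \<omega>) * Tn n n \<omega> \<partial>M) + (\<integral>\<omega>. complex_of_real (H m \<omega>) * Tn n m \<omega> \<partial>M)" .
    have "cmod (\<integral>\<omega>. complex_of_real (H n \<omega> - H m \<omega>) * Tn n n \<omega> \<partial>M)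
        \<le> (\<integral>\<omega>. cmod (complex_of_real (H n \<omega> - H m \<omega>) * Tn n n \<omega>) \<partial>M)"
      by (rule integral_norm_bound)
    also have "\<dots> = (\<integral>\<omega>. \<bar>H n \<omega> - H m \<omega>\<bar> * cmod (Tn n n \<omega>) \<partial>M)"
      by (simp add: norm_mult flip: of_real_diff)
    also have "\<dots> \<le> w * (\<integral>\<omega>. \<bar>H n \<omega> - H m \<omega>\<bar>\<^sup>2 \<partial>M) + (\<integral>\<omega>. (cmod (Tn n n \<omega>))\<^sup>2 \<partial>M) / w"
      using D2 integrable_T_square[OF cn] w by (intro integral_mult_le_weighted) (auto simp: Tn_def)
    also have "\<dots> \<le> w * (\<epsilon> / (4 * w)) + C / w"
      using m[of n] n w integral_T_square_le[OF c K] unfolding C_def Tn_def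
      by (intro add_mono mult_left_mono divide_right_mono) auto
    also have "\<dots> = \<epsilon> / 2" unfolding Cw using w by simp
    finally have 2: "cmod (\<integral>\<omega>. complex_of_real (H n \<omega> - H m \<omega>) * Tn n n \<omega> \<partial>M) \<le> \<epsilon> / 2" .
    have "cmod ((\<integral>\<omega>. complex_of_real (h \<omega>) * Tn n n \<omega> \<partial>M) - (\<integral>\<omega>. complex_of_real (h \<omega>) \<partial>M)) < \<epsilon> / 2 + \<epsilon> / 2"
      unfolding 1 add_diff_eq[symmetric]
      using n by (intro le_less_trans[OF norm_triangle_ineq] add_le_less_mono 2 n0) auto
    then show "norm ((\<integral>\<omega>. complex_of_real (h \<omega>) * T (c * real n) (t / sqrt (real n)) n \<omega> \<partial>M) - (\<integral>\<omega>. complex_of_real (h \<omega>) \<partial>M)) < \<epsilon>"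
      by (simp add: Tn_def)
  qed
qed

end

section \<open>From the product to the characteristic functions\<close>

lemma abs_exp_minus_diff_le:
  fixes a b :: real
  assumes "0 \<le> a" "0 \<le> b"
  shows "\<bar>exp (- a) - exp (- b)\<bar> \<le> \<bar>a - b\<bar>"
proof -
  have *: "exp (- a) - exp (- b) \<le> b - a" if "0 \<le> a" "a \<le> b" for a b :: real
  proof -
    have "exp (- a) - exp (- b) = exp (- a) * (1 - exp (- (b - a)))"
      by (simp add: right_diff_distrib flip: exp_add)
    also have "\<dots> \<le> 1 * (b - a)"
    proof (intro mult_mono)
      show "1 - exp (- (b - a)) \<le> b - a"
        using exp_ge_add_one_self[of "- (b - a)"] by linarith
    qed (use that in auto)
    finally show ?thesis by simp
  qed
  show ?thesis
  proof (cases "a \<le> b")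
    case True
    then show ?thesis using *[of a b] assms by simp
  next
    case False
    then show ?thesis using *[of b a] assms by simp
  qed
qed

lemma norm_diff_triangle3:
  fixes a b c d :: "'a::real_normed_vector"
  shows "norm (a - d) \<le> norm (a - b) + norm (b - c) + norm (c - d)"
  using norm_triangle_ineq[of "a - b + (b - c)" "c - d"] norm_triangle_ineq[of "a - b" "b - c"] by simp

lemma abs_min_max_diff_le:
  fixes x l c :: real
  shows "0 \<le> x \<Longrightarrow> \<bar>min x c - min (max 0 l) c\<bar> \<le> \<bar>x - l\<bar>"
  by (cases "x \<le> c"; cases "0 \<le> l"; cases "l \<le> c"; cases "0 \<le> c") (simp_all add: min_def max_def)

context square_integrable_mds begin

lemma measurable_stopped [measurable]: "(\<lambda>\<omega>. stopped c (\<lambda>j. Y j \<omega>) k) \<in> borel_measurable M"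
  by (rule stopped_measurable) simp

text \<open>The stopped mean differs from \<open>min Q c\<close> by at most the largest
  \<open>Y_k^2 / n\<close>, which is negligible, and capping at \<open>c\<close> is 1-Lipschitz. As
  nonnegativity of \<open>L\<close> is not yet at hand, \<open>L\<close> is replaced by
  \<open>max 0 L\<close>.\<close>

lemma conv_in_prob_stopped_variance:
  assumes c: "0 \<le> c" and [measurable]: "L \<in> borel_measurable M"
    and Q: "conv_in_prob M (\<lambda>n \<omega>. (\<Sum>k<n. (Y k \<omega>)\<^sup>2) / real n) L"
  shows "conv_in_prob M (\<lambda>n \<omega>. (\<Sum>k<n. (stopped (c * real n) (\<lambda>j. Y j \<omega>) k)\<^sup>2) / real n) (\<lambda>\<omega>. min (max 0 (L \<omega>)) c)"
  unfolding conv_in_prob_def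
proof (intro allI impI)
  fix \<epsilon> :: real assume "\<epsilon> > 0"
  then have \<epsilon>: "\<epsilon> / 2 > 0" by simp
  let ?q = "\<lambda>n \<omega>. \<Sum>k<n. (stopped (c * real n) (\<lambda>j. Y j \<omega>) k)\<^sup>2"
  let ?J = "\<lambda>n. {\<omega> \<in> space M. \<exists>k<n. (Y k \<omega>)\<^sup>2 > \<epsilon> / 2 * real n}"
  let ?A = "\<lambda>n. {\<omega> \<in> space M. \<bar>(\<Sum>k<n. (Y k \<omega>)\<^sup>2) / real n - L \<omega>\<bar> > \<epsilon> / 2}"
  let ?B = "\<lambda>n. {\<omega> \<in> space M. \<bar>?q n \<omega> / real n - min (max 0 (L \<omega>)) c\<bar> > \<epsilon>}"
  have "prob (?B n) \<le> prob (?J n) + prob (?A n)" for n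
  proof (rule order_trans[OF finite_measure_mono measure_Un_le])
    show "?B n \<subseteq> ?J n \<union> ?A n"
    proof (rule subsetI, rule ccontr)
      fix \<omega> assume B: "\<omega> \<in> ?B n" and n: "\<omega> \<notin> ?J n \<union> ?A n"
      let ?Q = "(\<Sum>k<n. (Y k \<omega>)\<^sup>2) / real n"
      have \<omega>: "\<omega> \<in> space M" using B by blast
      have J: "(Y k \<omega>)\<^sup>2 \<le> \<epsilon> / 2 * real n" if "k < n" for k
      proof (rule ccontr)
        assume "\<not> (Y k \<omega>)\<^sup>2 \<le> \<epsilon> / 2 * real n"
        then have "\<omega> \<in> ?J n" using \<omega> that by (auto simp: not_le)
        then show False using n by blast
      qed
      have A: "\<bar>?Q - L \<omega>\<bar> \<le> \<epsilon> / 2"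
        using n \<omega> by (intro leI) blast
      have Q0: "0 \<le> ?Q" by (simp add: sum_nonneg)
      have "\<bar>?q n \<omega> - min (\<Sum>k<n. (Y k \<omega>)\<^sup>2) (c * real n)\<bar> \<le> \<epsilon> / 2 * real n"
        using c \<epsilon> J by (intro sum_stopped_bounds) auto
      then have "\<bar>?q n \<omega> - min (\<Sum>k<n. (Y k \<omega>)\<^sup>2) (c * real n)\<bar> / real n \<le> \<epsilon> / 2"
        using \<epsilon> by (cases "n = 0") (auto simp: divide_le_eq)
      also have "\<bar>?q n \<omega> - min (\<Sum>k<n. (Y k \<omega>)\<^sup>2) (c * real n)\<bar> / real n
          = \<bar>?q n \<omega> / real n - min ?Q c\<bar>"
      proof (cases "n = 0")
        case False
        then have "min (\<Sum>k<n. (Y k \<omega>)\<^sup>2) (c * real n) / real n = min ?Q c"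
          by (auto simp: min_def field_simps)
        then have "?q n \<omega> / real n - min ?Q c = (?q n \<omega> - min (\<Sum>k<n. (Y k \<omega>)\<^sup>2) (c * real n)) / real n"
          by (simp add: diff_divide_distrib)
        then show ?thesis by simp
      qed (use c in auto)
      finally have 1: "\<bar>?q n \<omega> / real n - min ?Q c\<bar> \<le> \<epsilon> / 2" .
      have 2: "\<bar>min ?Q c - min (max 0 (L \<omega>)) c\<bar> \<le> \<bar>?Q - L \<omega>\<bar>"
        by (rule abs_min_max_diff_le[OF Q0])
      have "\<bar>?q n \<omega> / real n - min (max 0 (L \<omega>)) c\<bar> \<le> \<epsilon>"
        using 1 2 A by linarith
      then show False using B by simp
    qed
  qed auto
  moreover have "(\<lambda>n. prob (?J n) + prob (?A n)) \<longlonglongrightarrow> 0"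
    using tendsto_add[OF max_square_negligible[OF _ _ Q \<epsilon>] conv_in_probD[OF Q \<epsilon>]] by simp
  ultimately show "(\<lambda>n. prob (?B n)) \<longlonglongrightarrow> 0"
    by (rule LIMSEQ_null_sandwich[OF measure_nonneg])
qed

text \<open>If no \<open>Y_k^2\<close> exceeds \<open>\<rho>^2 n\<close>, the pathwise estimate
  gives a bound of order \<open>\<rho> Q_n\<close>, whose mean is at most of order
  \<open>\<rho> K\<close>. On the exceptional event, of vanishing probability, the difference is at
  most \<open>2\<close>.\<close>

lemma iexp_stopped_approx:
  fixes K c t :: real
  assumes [measurable]: "L \<in> borel_measurable M"
    and Q: "conv_in_prob M (\<lambda>n \<omega>. (\<Sum>k<n. (Y k \<omega>)\<^sup>2) / real n) L"
    and K: "\<And>n :: nat. (\<integral>\<omega>. (\<Sum>k<n. (Y k \<omega>)\<^sup>2) / real n \<partial>M) \<le> K"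
  defines "y \<equiv> \<lambda>n \<omega> k. t / sqrt (real n) * stopped (c * real n) (\<lambda>j. Y j \<omega>) k"
  shows "(\<lambda>n. \<integral>\<omega>. cmod (iexp (\<Sum>k<n. y n \<omega> k) - T (c * real n) (t / sqrt (real n)) n \<omega>
           * complex_of_real (exp (- (\<Sum>k<n. (y n \<omega> k)\<^sup>2) / 2))) \<partial>M) \<longlonglongrightarrow> 0"
proof -
  define D where "D n \<omega> = cmod (iexp (\<Sum>k<n. y n \<omega> k) - T (c * real n) (t / sqrt (real n)) n \<omega>
           * complex_of_real (exp (- (\<Sum>k<n. (y n \<omega> k)\<^sup>2) / 2)))" for n \<omega>
  have [measurable]: "(\<lambda>\<omega>. y n \<omega> k) \<in> borel_measurable M" for n k unfolding y_def by measurable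
  have [measurable]: "D n \<in> borel_measurable M" for n unfolding D_def by measurable
  have T: "T (c * real n) (t / sqrt (real n)) n \<omega> = (\<Prod>k<n. 1 + \<i> * complex_of_real (y n \<omega> k))" for n \<omega>
    by (simp add: stopped_prod_def y_def)
  have D2: "D n \<omega> \<le> 2" for n \<omega> unfolding D_def T by (rule iexp_sum_minus_prod_le(1))
  have D0: "0 \<le> D n \<omega>" for n \<omega> by (simp add: D_def)
  have K0: "0 \<le> K" using K[of 0] by simp
  have "(\<lambda>n. \<integral>\<omega>. D n \<omega> \<partial>M) \<longlonglongrightarrow> 0"
  proof (rule LIMSEQ_I)
    fix \<eta> :: real assume \<eta>: "\<eta> > 0"
    \<comment> \<open>With \<open>\<rho> = \<eta> / (2 a)\<close> the main term is at most
      \<open>\<eta> / 2\<close>; the summand \<open>1\<close> only keeps \<open>a\<close> positive.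
      The exceptional event costs twice its probability, hence the \<open>\<eta> / 4\<close>
      below.\<close>
    define a where "a = 2 * (\<bar>t\<bar> * t\<^sup>2) * K + 1"
    have a: "a > 0" using K0 by (simp add: a_def add_nonneg_pos)
    define \<rho> where "\<rho> = \<eta> / (2 * a)"
    have \<rho>: "\<rho> > 0" using \<eta> a by (simp add: \<rho>_def)
    have "(a - 1) * \<rho> \<le> a * \<rho>" using \<rho> by simp
    also have "a * \<rho> = \<eta> / 2" using a by (simp add: \<rho>_def)
    finally have a\<rho>: "2 * (\<bar>t\<bar> * \<rho>) * (t\<^sup>2 * K) \<le> \<eta> / 2" by (simp add: a_def ac_simps)
    let ?J = "\<lambda>n. {\<omega> \<in> space M. \<exists>k<n. (Y k \<omega>)\<^sup>2 > \<rho>\<^sup>2 * real n}"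
    let ?Q = "\<lambda>n \<omega>. (\<Sum>k<n. (Y k \<omega>)\<^sup>2) / real n"
    have "\<rho>\<^sup>2 > 0" using \<rho> by simp
    from LIMSEQ_D[OF max_square_negligible[OF _ _ Q this], of "\<eta> / 4"] \<eta>
    obtain n0 where n0: "\<And>n. n \<ge> n0 \<Longrightarrow> prob (?J n) < \<eta> / 4" by auto
    have le: "D n \<omega> \<le> 2 * indicator (?J n) \<omega> + 2 * (\<bar>t\<bar> * \<rho>) * (t\<^sup>2 * ?Q n \<omega>)" if \<omega>: "\<omega> \<in> space M" for n \<omega>
    proof (cases "\<omega> \<in> ?J n")
      case True
      have "0 \<le> 2 * (\<bar>t\<bar> * \<rho>) * (t\<^sup>2 * ?Q n \<omega>)"
        using \<rho> by (intro mult_nonneg_nonneg divide_nonneg_nonneg sum_nonneg) auto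
      then show ?thesis using True D2[of n \<omega>] by simp
    next
      case False
      have "\<bar>y n \<omega> k\<bar> \<le> \<bar>t\<bar> * \<rho>" if "k < n" for k
      proof -
        have "(Y k \<omega>)\<^sup>2 \<le> (\<rho> * sqrt (real n))\<^sup>2"
        proof (rule ccontr)
          assume "\<not> (Y k \<omega>)\<^sup>2 \<le> (\<rho> * sqrt (real n))\<^sup>2"
          then have "\<omega> \<in> ?J n" using \<omega> that by (auto simp: not_le power_mult_distrib)
          then show False using False by blast
        qed
        then have "\<bar>Y k \<omega>\<bar> \<le> \<rho> * sqrt (real n)"
          using \<rho> by (simp add: abs_le_square_iff[symmetric])
        then have "\<bar>stopped (c * real n) (\<lambda>j. Y j \<omega>) k\<bar> / sqrt (real n) \<le> \<rho>"
          using that \<rho> by (auto simp: stopped_def divide_le_eq)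
        from mult_left_mono[OF this, of "\<bar>t\<bar>"] show ?thesis
          by (simp add: y_def abs_mult)
      qed
      then have "D n \<omega> \<le> 2 * (\<bar>t\<bar> * \<rho>) * (\<Sum>k<n. (y n \<omega> k)\<^sup>2)"
        unfolding D_def T by (rule iexp_sum_minus_prod_le(2))
      also have "(\<Sum>k<n. (y n \<omega> k)\<^sup>2) \<le> (\<Sum>k<n. t\<^sup>2 * (Y k \<omega>)\<^sup>2 / real n)"
        by (intro sum_mono) (auto simp: y_def stopped_def power_mult_distrib power_divide)
      also have "\<dots> = t\<^sup>2 * ?Q n \<omega>"
        by (simp add: sum_distrib_left sum_divide_distrib)
      finally show ?thesis using False \<rho> by (simp add: mult_left_mono)
    qed
    show "\<exists>no. \<forall>n\<ge>no. norm ((\<integral>\<omega>. D n \<omega> \<partial>M) - 0) < \<eta>"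
    proof (intro exI allI impI)
      fix n assume n: "n0 \<le> n"
      have Qint: "integrable M (?Q n)" using square_integrable by auto
      have Jint: "integrable M (indicator (?J n) :: 'a \<Rightarrow> real)"
        by (intro integrable_real_indicator) (auto simp: less_top[symmetric])
      have "(\<integral>\<omega>. D n \<omega> \<partial>M) \<le> (\<integral>\<omega>. 2 * indicator (?J n) \<omega> + 2 * (\<bar>t\<bar> * \<rho>) * (t\<^sup>2 * ?Q n \<omega>) \<partial>M)"
        by (intro integral_mono le Bochner_Integration.integrable_add integrable_mult_right Qint Jint
            integrable_const_bound[where B=2]) (auto intro!: AE_I2 simp: D0 D2)
      also have "\<dots> = 2 * prob (?J n) + 2 * (\<bar>t\<bar> * \<rho>) * (t\<^sup>2 * (\<integral>\<omega>. ?Q n \<omega> \<partial>M))"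
        using Qint Jint
        by (subst Bochner_Integration.integral_add) (auto simp del: times_divide_eq_right integral_divide_zero)
      also have "\<dots> \<le> 2 * prob (?J n) + 2 * (\<bar>t\<bar> * \<rho>) * (t\<^sup>2 * K)"
        using \<rho> by (intro add_left_mono mult_left_mono K) auto
      also have "\<dots> < \<eta>" using n0[OF n] a\<rho> by linarith
      finally have "(\<integral>\<omega>. D n \<omega> \<partial>M) < \<eta>" .
      moreover have "0 \<le> (\<integral>\<omega>. D n \<omega> \<partial>M)" by (rule Bochner_Integration.integral_nonneg) (rule D0)
      ultimately show "norm ((\<integral>\<omega>. D n \<omega> \<partial>M) - 0) < \<eta>" by simp
    qed
  qed
  then show ?thesis by (simp only: D_def)
qed

text \<open>Three replacements: \<open>?A\<close> exchanges the exponential for \<open>E n\<close>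
  times the product; \<open>?B\<close> exchanges the random factor \<open>E n\<close> for its limit
  \<open>e\<close>, which is small in \<open>L^2\<close> against a product bounded in
  \<open>L^2\<close>; \<open>?C\<close> is the limit theorem for the product with test function
  \<open>h e\<close>.\<close>

lemma tendsto_integral_iexp_stopped:
  fixes K c t :: real
  assumes c: "0 \<le> c" and [measurable]: "L \<in> borel_measurable M"
    and Q: "conv_in_prob M (\<lambda>n \<omega>. (\<Sum>k<n. (Y k \<omega>)\<^sup>2) / real n) L"
    and K: "\<And>n :: nat. (\<integral>\<omega>. (\<Sum>k<n. (Y k \<omega>)\<^sup>2) / real n \<partial>M) \<le> K"
    and h [measurable]: "h \<in> borel_measurable M" and h1: "\<And>\<omega>. \<bar>h \<omega>\<bar> \<le> 1"
  defines "y \<equiv> \<lambda>n \<omega> k. t / sqrt (real n) * stopped (c * real n) (\<lambda>j. Y j \<omega>) k"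
  shows "(\<lambda>n. \<integral>\<omega>. complex_of_real (h \<omega>) * iexp (\<Sum>k<n. y n \<omega> k) \<partial>M)
    \<longlonglongrightarrow> (\<integral>\<omega>. complex_of_real (h \<omega> * exp (- (t\<^sup>2 / 2 * min (max 0 (L \<omega>)) c))) \<partial>M)"
proof -
  have [measurable]: "(\<lambda>\<omega>. y n \<omega> k) \<in> borel_measurable M" for n k unfolding y_def by measurable
  define Tn where "Tn n = T (c * real n) (t / sqrt (real n)) n" for n
  have [measurable]: "Tn n \<in> borel_measurable M" for n unfolding Tn_def by simp
  define e where "e \<omega> = exp (- (t\<^sup>2 / 2 * min (max 0 (L \<omega>)) c))" for \<omega>
  define E where "E n \<omega> = exp (- (\<Sum>k<n. (y n \<omega> k)\<^sup>2) / 2)" for n \<omega>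
  have [measurable]: "e \<in> borel_measurable M" "E n \<in> borel_measurable M" for n
    unfolding e_def E_def by measurable
  have e01: "0 \<le> e \<omega>" "e \<omega> \<le> 1" for \<omega> using c by (auto simp: e_def)
  have E01: "0 \<le> E n \<omega>" "E n \<omega> \<le> 1" for n \<omega> by (auto simp: E_def sum_nonneg)
  have cn: "0 \<le> c * real n" for n using c by simp
  have he: "AE \<omega> in M. \<bar>h \<omega> * e \<omega>\<bar> \<le> 1" and hE: "AE \<omega> in M. \<bar>h \<omega> * E n \<omega>\<bar> \<le> 1" for n
    using e01 E01 h1 by (auto intro!: AE_I2 simp: abs_mult mult_le_one)
  have int_e: "integrable M (\<lambda>\<omega>. complex_of_real (h \<omega> * e \<omega>) * Tn n \<omega>)"
    and int_E: "integrable M (\<lambda>\<omega>. complex_of_real (h \<omega> * E n \<omega>) * Tn n \<omega>)"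
    and int_i: "integrable M (\<lambda>\<omega>. complex_of_real (h \<omega>) * iexp (\<Sum>k<n. y n \<omega> k))" for n
    unfolding Tn_def using h1
    by (rule_tac [3] integrable_const_bound[where B=1])
       (auto intro!: integrable_bounded_mult_T[OF cn _ he, simplified] integrable_bounded_mult_T[OF cn _ hE, simplified]
        AE_I2 simp: norm_mult)
  let ?A = "\<lambda>n. \<integral>\<omega>. complex_of_real (h \<omega>) * iexp (\<Sum>k<n. y n \<omega> k) - complex_of_real (h \<omega> * E n \<omega>) * Tn n \<omega> \<partial>M"
  let ?B = "\<lambda>n. \<integral>\<omega>. complex_of_real (h \<omega> * E n \<omega>) * Tn n \<omega> - complex_of_real (h \<omega> * e \<omega>) * Tn n \<omega> \<partial>M"
  let ?C = "\<lambda>n. \<integral>\<omega>. complex_of_real (h \<omega> * e \<omega>) * Tn n \<omega> \<partial>M"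
  have split: "(\<integral>\<omega>. complex_of_real (h \<omega>) * iexp (\<Sum>k<n. y n \<omega> k) \<partial>M) = ?A n + ?B n + ?C n" for n
    by (subst (1 2) Bochner_Integration.integral_diff) (use int_e int_E int_i in simp_all)
  have "?A \<longlonglongrightarrow> 0"
  proof (rule Lim_null_comparison[OF _ iexp_stopped_approx[OF _ Q K, where c=c and t=t]])
    let ?D = "\<lambda>n \<omega>. cmod (iexp (\<Sum>k<n. y n \<omega> k) - Tn n \<omega> * complex_of_real (E n \<omega>))"
    have T: "Tn n \<omega> = (\<Prod>k<n. 1 + \<i> * complex_of_real (y n \<omega> k))" for n \<omega>
      by (simp add: Tn_def stopped_prod_def y_def)
    have D2: "?D n \<omega> \<le> 2" for n \<omega> unfolding E_def T by (rule iexp_sum_minus_prod_le(1))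
    have "norm (?A n) \<le> (\<integral>\<omega>. ?D n \<omega> \<partial>M)" for n
    proof (rule order_trans[OF integral_norm_bound integral_mono])
      fix \<omega>
      have "complex_of_real (h \<omega>) * iexp (\<Sum>k<n. y n \<omega> k) - complex_of_real (h \<omega> * E n \<omega>) * Tn n \<omega>
        = complex_of_real (h \<omega>) * (iexp (\<Sum>k<n. y n \<omega> k) - Tn n \<omega> * complex_of_real (E n \<omega>))"
        by (simp add: algebra_simps)
      then show "norm (complex_of_real (h \<omega>) * iexp (\<Sum>k<n. y n \<omega> k) - complex_of_real (h \<omega> * E n \<omega>) * Tn n \<omega>) \<le> ?D n \<omega>"
        using mult_right_mono[OF h1, of "?D n \<omega>" \<omega>] by (simp only: norm_mult norm_of_real norm_ge_zero mult_1_left)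
    qed (use int_i int_E D2 in \<open>auto intro!: integrable_const_bound[where B=2] AE_I2\<close>)
    then show "\<forall>\<^sub>F n in sequentially. norm (?A n) \<le>
      (\<integral>\<omega>. cmod (iexp (\<Sum>k<n. t / sqrt (real n) * stopped (c * real n) (\<lambda>j. Y j \<omega>) k)
        - T (c * real n) (t / sqrt (real n)) n \<omega>
          * complex_of_real (exp (- (\<Sum>k<n. (t / sqrt (real n) * stopped (c * real n) (\<lambda>j. Y j \<omega>) k)\<^sup>2) / 2))) \<partial>M)"
      unfolding E_def Tn_def y_def by (intro always_eventually allI)
  qed simp
  moreover have "?B \<longlonglongrightarrow> 0"
  proof (rule LIMSEQ_I)
    fix \<epsilon> :: real assume \<epsilon>: "\<epsilon> > 0"
    define C where "C = exp (t\<^sup>2 * c) * (1 + t\<^sup>2 * K)"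
    have "0 \<le> K" using K[of 0] by simp
    then have C: "C > 0" by (simp add: C_def add_pos_nonneg)
    define w where "w = 2 * C / \<epsilon>"
    have w: "w > 0" using C \<epsilon> by (simp add: w_def)
    have Cw: "C / w = \<epsilon> / 2" using C \<epsilon> by (simp add: w_def)
    have EL: "E n \<omega> = exp (- (t\<^sup>2 / 2 * ((\<Sum>k<n. (stopped (c * real n) (\<lambda>j. Y j \<omega>) k)\<^sup>2) / real n)))" for n \<omega>
      by (simp add: E_def y_def power_mult_distrib power_divide sum_distrib_left sum_divide_distrib
          mult.commute[of "real n" 2])
    have "(\<lambda>n. \<integral>\<omega>. (E n \<omega> - e \<omega>)\<^sup>2 \<partial>M) \<longlonglongrightarrow> 0"
    \<comment> \<open>Both \<open>E n\<close> and \<open>e\<close> lie in \<open>[0, 1]\<close>, so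
      the square is at most the distance, which the Lipschitz bound of \<open>exp\<close> controls
      with constant \<open>t^2 / 2\<close>; \<open>1\<close> is added for positivity when
      \<open>t = 0\<close>.\<close>
    proof (rule conv_in_prob_integral[OF _ _ _ conv_in_prob_stopped_variance[OF c _ Q], where C="t\<^sup>2 / 2 + 1"])
      fix n
      let ?V = "\<lambda>\<omega>. (\<Sum>k<n. (stopped (c * real n) (\<lambda>j. Y j \<omega>) k)\<^sup>2) / real n"
      show "AE \<omega> in M. 0 \<le> (E n \<omega> - e \<omega>)\<^sup>2 \<and> (E n \<omega> - e \<omega>)\<^sup>2 \<le> 1 \<and>
          (E n \<omega> - e \<omega>)\<^sup>2 \<le> (t\<^sup>2 / 2 + 1) * \<bar>?V \<omega> - min (max 0 (L \<omega>)) c\<bar>"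
      proof (rule AE_I2)
        fix \<omega>
        have 1: "\<bar>E n \<omega> - e \<omega>\<bar> \<le> 1" using e01[of \<omega>] E01[of n \<omega>] unfolding abs_le_iff by linarith
        have "\<bar>E n \<omega> - e \<omega>\<bar> \<le> \<bar>t\<^sup>2 / 2 * ?V \<omega> - t\<^sup>2 / 2 * min (max 0 (L \<omega>)) c\<bar>"
          unfolding EL e_def using c
          by (intro abs_exp_minus_diff_le mult_nonneg_nonneg divide_nonneg_nonneg sum_nonneg) auto
        also have "\<dots> = t\<^sup>2 / 2 * \<bar>?V \<omega> - min (max 0 (L \<omega>)) c\<bar>"
          unfolding right_diff_distrib[symmetric] abs_mult by simp
        also have "\<dots> \<le> (t\<^sup>2 / 2 + 1) * \<bar>?V \<omega> - min (max 0 (L \<omega>)) c\<bar>"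
          by (intro mult_right_mono) auto
        finally have 2: "\<bar>E n \<omega> - e \<omega>\<bar> \<le> (t\<^sup>2 / 2 + 1) * \<bar>?V \<omega> - min (max 0 (L \<omega>)) c\<bar>" .
        have "(E n \<omega> - e \<omega>)\<^sup>2 = \<bar>E n \<omega> - e \<omega>\<bar> * \<bar>E n \<omega> - e \<omega>\<bar>"
          by (simp add: power2_eq_square)
        also have "\<dots> \<le> \<bar>E n \<omega> - e \<omega>\<bar> * 1" using 1 by (intro mult_left_mono) auto
        finally have sq: "(E n \<omega> - e \<omega>)\<^sup>2 \<le> \<bar>E n \<omega> - e \<omega>\<bar>" by (simp only: mult_1_right)
        show "0 \<le> (E n \<omega> - e \<omega>)\<^sup>2 \<and> (E n \<omega> - e \<omega>)\<^sup>2 \<le> 1 \<and>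
          (E n \<omega> - e \<omega>)\<^sup>2 \<le> (t\<^sup>2 / 2 + 1) * \<bar>?V \<omega> - min (max 0 (L \<omega>)) c\<bar>"
          by (intro conjI zero_le_power2 order_trans[OF sq 1] order_trans[OF sq 2])
      qed
      show "0 < t\<^sup>2 / 2 + 1" by (rule add_nonneg_pos) simp_all
    qed measurable
    from LIMSEQ_D[OF this, of "\<epsilon> / (2 * w)"] \<epsilon> w obtain n0 where
      n0: "\<And>n. n0 \<le> n \<Longrightarrow> (\<integral>\<omega>. (E n \<omega> - e \<omega>)\<^sup>2 \<partial>M) < \<epsilon> / (2 * w)" by (auto simp: abs_less_iff)
    show "\<exists>no. \<forall>n\<ge>no. norm (?B n - 0) < \<epsilon>"
    proof (intro exI allI impI)
      fix n assume n: "n0 \<le> n"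
      have Ee: "AE \<omega> in M. \<bar>E n \<omega> - e \<omega>\<bar> \<le> 1"
      proof (rule AE_I2)
        fix \<omega> show "\<bar>E n \<omega> - e \<omega>\<bar> \<le> 1"
          using e01[of \<omega>] E01[of n \<omega>] unfolding abs_le_iff by linarith
      qed
      have "norm (?B n) \<le> (\<integral>\<omega>. cmod (complex_of_real (h \<omega> * E n \<omega>) * Tn n \<omega> - complex_of_real (h \<omega> * e \<omega>) * Tn n \<omega>) \<partial>M)"
        by (rule integral_norm_bound)
      also have "\<dots> \<le> (\<integral>\<omega>. \<bar>E n \<omega> - e \<omega>\<bar> * cmod (Tn n \<omega>) \<partial>M)"
      proof (rule integral_mono)
        fix \<omega>
        have "complex_of_real (h \<omega> * E n \<omega>) * Tn n \<omega> - complex_of_real (h \<omega> * e \<omega>) * Tn n \<omega>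
            = complex_of_real (h \<omega>) * (complex_of_real (E n \<omega> - e \<omega>) * Tn n \<omega>)"
          by (simp add: algebra_simps)
        then show "cmod (complex_of_real (h \<omega> * E n \<omega>) * Tn n \<omega> - complex_of_real (h \<omega> * e \<omega>) * Tn n \<omega>)
            \<le> \<bar>E n \<omega> - e \<omega>\<bar> * cmod (Tn n \<omega>)"
          using mult_right_mono[OF h1, of "\<bar>E n \<omega> - e \<omega>\<bar> * cmod (Tn n \<omega>)" \<omega>]
          by (simp only: norm_mult norm_of_real mult_1_left mult_nonneg_nonneg abs_ge_zero norm_ge_zero)
      next
        have "integrable M (\<lambda>\<omega>. complex_of_real (E n \<omega> - e \<omega>) * Tn n \<omega>)"
          unfolding Tn_def by (rule integrable_bounded_mult_T[OF cn _ Ee]) simp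
        from integrable_norm[OF this]
        show "integrable M (\<lambda>\<omega>. \<bar>E n \<omega> - e \<omega>\<bar> * cmod (Tn n \<omega>))"
          by (simp only: norm_mult norm_of_real)
      qed (use int_e int_E in auto)
      also have "\<dots> \<le> w * (\<integral>\<omega>. \<bar>E n \<omega> - e \<omega>\<bar>\<^sup>2 \<partial>M) + (\<integral>\<omega>. (cmod (Tn n \<omega>))\<^sup>2 \<partial>M) / w"
      proof (rule integral_mult_le_weighted)
        show "integrable M (\<lambda>\<omega>. \<bar>E n \<omega> - e \<omega>\<bar>\<^sup>2)"
        proof (rule integrable_const_bound[where B="1\<^sup>2"])
          show "AE \<omega> in M. norm (\<bar>E n \<omega> - e \<omega>\<bar>\<^sup>2) \<le> 1\<^sup>2"
            using Ee by eventually_elim (simp only: power2_abs real_norm_def square_le_of_abs_le abs_power2)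
        qed simp
      qed (use w integrable_T_square[OF cn] in \<open>auto simp: Tn_def\<close>)
      also have "\<dots> < w * (\<epsilon> / (2 * w)) + C / w"
        using n0[OF n] w integral_T_square_le[OF c K] unfolding C_def Tn_def
        by (intro add_less_le_mono mult_strict_left_mono divide_right_mono) auto
      also have "\<dots> = \<epsilon>" unfolding Cw using w by simp
      finally show "norm (?B n - 0) < \<epsilon>" by simp
    qed
  qed
  \<comment> \<open>Here the test function is \<open>h e\<close>, which involves \<open>L\<close>
    and is only \<open>M\<close>-measurable.\<close>
  moreover have "?C \<longlonglongrightarrow> (\<integral>\<omega>. complex_of_real (h \<omega> * e \<omega>) \<partial>M)"
    unfolding Tn_def by (rule tendsto_integral_T[OF c _ he K]) simp
  ultimately have "(\<lambda>n. ?A n + ?B n + ?C n) \<longlonglongrightarrow> 0 + 0 + (\<integral>\<omega>. complex_of_real (h \<omega> * e \<omega>) \<partial>M)"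
    by (intro tendsto_add)
  then show ?thesis unfolding split by (simp add: e_def)
qed

text \<open>Removal of the stopping. Stopped and unstopped sums agree unless
  \<open>Q_n \<ge> N\<close>, an event of probability at most \<open>K / N\<close> for all
  \<open>n\<close> at once; the limits for level \<open>N\<close> converge by dominated convergence.
  Fixing \<open>N\<close> first is legitimate because the first error is uniform in
  \<open>n\<close>.\<close>

theorem tendsto_integral_iexp:
  assumes [measurable]: "L \<in> borel_measurable M"
    and Q: "conv_in_prob M (\<lambda>n \<omega>. (\<Sum>k<n. (Y k \<omega>)\<^sup>2) / real n) L"
    and K: "\<And>n :: nat. (\<integral>\<omega>. (\<Sum>k<n. (Y k \<omega>)\<^sup>2) / real n \<partial>M) \<le> K"
    and h [measurable]: "h \<in> borel_measurable M" and h1: "\<And>\<omega>. \<bar>h \<omega>\<bar> \<le> 1"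
  shows "(\<lambda>n. \<integral>\<omega>. complex_of_real (h \<omega>) * iexp (t * ((\<Sum>k<n. Y k \<omega>) / sqrt (real n))) \<partial>M)
    \<longlonglongrightarrow> (\<integral>\<omega>. complex_of_real (h \<omega> * exp (- (t\<^sup>2 / 2 * max 0 (L \<omega>)))) \<partial>M)"
proof (rule LIMSEQ_I)
  fix \<epsilon> :: real assume \<epsilon>: "\<epsilon> > 0"
  let ?e = "\<lambda>c. \<integral>\<omega>. complex_of_real (h \<omega> * exp (- (t\<^sup>2 / 2 * min (max 0 (L \<omega>)) c))) \<partial>M"
  let ?e' = "\<integral>\<omega>. complex_of_real (h \<omega> * exp (- (t\<^sup>2 / 2 * max 0 (L \<omega>)))) \<partial>M"
  have "(\<lambda>N. ?e (real N)) \<longlonglongrightarrow> ?e'"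
  proof (rule integral_dominated_convergence[where w="\<lambda>_. 1"])
    show "AE \<omega> in M. (\<lambda>N. complex_of_real (h \<omega> * exp (- (t\<^sup>2 / 2 * min (max 0 (L \<omega>)) (real N)))))
        \<longlonglongrightarrow> complex_of_real (h \<omega> * exp (- (t\<^sup>2 / 2 * max 0 (L \<omega>))))"
    proof (rule AE_I2, rule tendsto_eventually)
      fix \<omega>
      obtain N0 where "max 0 (L \<omega>) \<le> real N0" using real_arch_simple by blast
      then have "min (max 0 (L \<omega>)) (real N) = max 0 (L \<omega>)" if "N0 \<le> N" for N
        using that by (intro min_absorb1) simp
      then show "\<forall>\<^sub>F N in sequentially. complex_of_real (h \<omega> * exp (- (t\<^sup>2 / 2 * min (max 0 (L \<omega>)) (real N))))
        = complex_of_real (h \<omega> * exp (- (t\<^sup>2 / 2 * max 0 (L \<omega>))))"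
        unfolding eventually_sequentially by (metis (no_types, lifting))
    qed
    show "AE \<omega> in M. norm (complex_of_real (h \<omega> * exp (- (t\<^sup>2 / 2 * min (max 0 (L \<omega>)) (real N))))) \<le> 1" for N
      using h1 by (intro AE_I2) (simp add: norm_mult mult_le_one)
  qed auto
  then have "\<forall>\<^sub>F N in sequentially. dist (?e (real N)) ?e' < \<epsilon> / 4"
    using \<epsilon> by (intro tendstoD) auto
  moreover have "\<forall>\<^sub>F N in sequentially. 2 * K / real N < \<epsilon> / 4"
    using \<epsilon> by (intro order_tendstoD[OF lim_const_over_n]) auto
  ultimately have "\<forall>\<^sub>F N in sequentially. 0 < N \<and> dist (?e (real N)) ?e' < \<epsilon> / 4 \<and> 2 * K / real N < \<epsilon> / 4"
    using eventually_gt_at_top[of 0] by eventually_elim auto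
  then obtain N where N: "0 < N" and 1: "cmod (?e (real N) - ?e') < \<epsilon> / 4" and KN: "2 * K / real N < \<epsilon> / 4"
    using eventually_happens'[OF sequentially_bot] unfolding dist_norm by blast
  define y where "y n \<omega> k = t / sqrt (real n) * stopped (real N * real n) (\<lambda>j. Y j \<omega>) k" for n \<omega> k
  have [measurable]: "(\<lambda>\<omega>. y n \<omega> k) \<in> borel_measurable M" for n k unfolding y_def by measurable
  have "(\<lambda>n. \<integral>\<omega>. complex_of_real (h \<omega>) * iexp (\<Sum>k<n. y n \<omega> k) \<partial>M) \<longlonglongrightarrow> ?e (real N)"
    unfolding y_def by (rule tendsto_integral_iexp_stopped[OF _ _ Q K h h1]) auto
  from LIMSEQ_D[OF this, of "\<epsilon> / 4"] \<epsilon> obtain n0 where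
    n0: "\<And>n. n0 \<le> n \<Longrightarrow> cmod ((\<integral>\<omega>. complex_of_real (h \<omega>) * iexp (\<Sum>k<n. y n \<omega> k) \<partial>M) - ?e (real N)) < \<epsilon> / 4"
    by auto
  let ?I = "\<lambda>n. \<integral>\<omega>. complex_of_real (h \<omega>) * iexp (t * ((\<Sum>k<n. Y k \<omega>) / sqrt (real n))) \<partial>M"
  let ?I' = "\<lambda>n. \<integral>\<omega>. complex_of_real (h \<omega>) * iexp (\<Sum>k<n. y n \<omega> k) \<partial>M"
  show "\<exists>no. \<forall>n\<ge>no. norm (?I n - ?e') < \<epsilon>"
  proof (intro exI allI impI)
    fix n assume n: "n0 \<le> n"
    let ?Q = "\<lambda>\<omega>. (\<Sum>k<n. (Y k \<omega>)\<^sup>2) / real n"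
    let ?A = "{\<omega> \<in> space M. ?Q \<omega> \<ge> real N}"
    let ?d = "\<lambda>\<omega>. complex_of_real (h \<omega>) * iexp (t * ((\<Sum>k<n. Y k \<omega>) / sqrt (real n)))
        - complex_of_real (h \<omega>) * iexp (\<Sum>k<n. y n \<omega> k)"
    have int: "integrable M (\<lambda>\<omega>. complex_of_real (h \<omega>) * iexp (t * ((\<Sum>k<n. Y k \<omega>) / sqrt (real n))))"
      "integrable M (\<lambda>\<omega>. complex_of_real (h \<omega>) * iexp (\<Sum>k<n. y n \<omega> k))"
      using h1 by (auto intro!: integrable_const_bound[where B=1] AE_I2 simp: norm_mult)
    have "?I n - ?I' n = (\<integral>\<omega>. ?d \<omega> \<partial>M)"
      using int by (subst Bochner_Integration.integral_diff) auto
    then have "cmod (?I n - ?I' n) \<le> (\<integral>\<omega>. cmod (?d \<omega>) \<partial>M)"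
      by (simp only: integral_norm_bound)
    also have "\<dots> \<le> (\<integral>\<omega>. 2 * indicator ?A \<omega> \<partial>M)"
    proof (rule integral_mono)
      show "integrable M (\<lambda>\<omega>. cmod (?d \<omega>))" using int by auto
      show "integrable M (\<lambda>\<omega>. 2 * indicator ?A \<omega> :: real)"
        by (intro integrable_mult_right integrable_real_indicator) (auto simp: less_top[symmetric])
      fix \<omega> assume \<omega>: "\<omega> \<in> space M"
      show "cmod (?d \<omega>) \<le> 2 * indicator ?A \<omega>"
      proof (cases "\<omega> \<in> ?A")
        case True
        have "cmod (?d \<omega>) \<le> \<bar>h \<omega>\<bar> + \<bar>h \<omega>\<bar>"
          by (rule order_trans[OF norm_triangle_ineq4]) (simp add: norm_mult)
        then show ?thesis using h1[of \<omega>] True by simp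
      next
        case False
        then have "?Q \<omega> \<le> real N" using \<omega> by auto
        then have "(\<Sum>k<n. (Y k \<omega>)\<^sup>2) \<le> real N * real n"
          by (cases "n = 0") (auto simp: divide_le_eq)
        from stopped_eq[OF this] have "(\<Sum>k<n. y n \<omega> k) = (\<Sum>k<n. t / sqrt (real n) * Y k \<omega>)"
          unfolding y_def by (intro sum.cong) auto
        also have "\<dots> = t * ((\<Sum>k<n. Y k \<omega>) / sqrt (real n))"
          by (simp add: sum_distrib_left sum_divide_distrib)
        finally show ?thesis using False by simp
      qed
    qed
    also have "\<dots> = 2 * prob ?A" by simp
    also have "prob ?A \<le> (\<integral>\<omega>. ?Q \<omega> \<partial>M) / real N"
      using N square_integrable
      by (intro integral_Markov_inequality_measure[where A="{}"]) (auto intro!: AE_I2 divide_nonneg_nonneg sum_nonneg)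
    also have "\<dots> \<le> K / real N" using K by (rule divide_right_mono) simp
    finally have 2: "cmod (?I n - ?I' n) < \<epsilon> / 4" using KN by simp
    have "cmod (?I n - ?e') \<le> cmod (?I n - ?I' n) + cmod (?I' n - ?e (real N)) + cmod (?e (real N) - ?e')"
      by (rule norm_diff_triangle3)
    also have "\<dots> < \<epsilon> / 4 + \<epsilon> / 4 + \<epsilon> / 4"
      by (intro add_strict_mono 1 2 n0 n)
    also have "\<dots> < \<epsilon>" using \<epsilon> by simp
    finally show "norm (?I n - ?e') < \<epsilon>" .
  qed
qed

end

section \<open>Characteristic functions and stable convergence\<close>

lemma Re_iexp: "Re (iexp x) = cos x" and Im_iexp: "Im (iexp x) = sin x"
  by (simp_all flip: cis_conv_exp)

lemma char_gauss:
  assumes "0 \<le> c"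
  shows "char (gauss c) t = complex_of_real (exp (- (t\<^sup>2 / 2 * c)))"
proof (cases "c = 0")
  case True
  then show ?thesis by (simp add: gauss_def char_def integral_return)
next
  case False
  then have c: "c > 0" using assms by simp
  interpret N: prob_space std_normal_distribution
    by (rule real_distribution.axioms(1)[OF real_dist_normal_dist])
  \<comment> \<open>For \<open>c > 0\<close>, \<open>gauss c\<close> is the image of the standard
    normal law under multiplication by \<open>sqrt c\<close>.\<close>
  have "distributed std_normal_distribution lborel (\<lambda>x. x) std_normal_density"
    by (auto simp: distributed_def intro!: distr_id2)
  from N.normal_density_affine[OF this, of "sqrt c" 0] c
  have "distr std_normal_distribution lborel (\<lambda>x. sqrt c * x) = density lborel (normal_density 0 (sqrt c))"
    by (simp add: distributed_def)
  also have "distr std_normal_distribution lborel (\<lambda>x. sqrt c * x) = distr std_normal_distribution borel (\<lambda>x. sqrt c * x)"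
    by (rule distr_cong) simp_all
  finally have "gauss c = distr std_normal_distribution borel (\<lambda>x. sqrt c * x)"
    using c by (simp add: gauss_def)
  then have "char (gauss c) t = (\<integral>x. iexp (t * (sqrt c * x)) \<partial>std_normal_distribution)"
    by (simp add: char_def integral_distr)
  also have "\<dots> = char std_normal_distribution (t * sqrt c)"
    by (simp add: char_def mult.assoc)
  also have "\<dots> = complex_of_real (exp (- (t\<^sup>2 / 2 * c)))"
    using c by (simp add: char_std_normal_distribution power_mult_distrib)
  finally show ?thesis .
qed

context prob_space begin

lemma integral_uniform_measure:
  fixes f :: "'a \<Rightarrow> 'b::{banach, second_countable_topology}"
  assumes H: "H \<in> events" "prob H > 0" and f: "f \<in> borel_measurable M"
  shows "(\<integral>\<omega>. f \<omega> \<partial>uniform_measure M H) = (\<integral>\<omega>. indicator H \<omega> *\<^sub>R f \<omega> \<partial>M) /\<^sub>R prob H"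
proof -
  have "uniform_measure M H = density M (\<lambda>\<omega>. ennreal (indicator H \<omega> / prob H))"
    unfolding uniform_measure_def emeasure_eq_measure using H
    using divide_ennreal[of 1 "prob H"] by (intro density_cong) (auto split: split_indicator)
  then have "(\<integral>\<omega>. f \<omega> \<partial>uniform_measure M H) = (\<integral>\<omega>. (indicator H \<omega> / prob H) *\<^sub>R f \<omega> \<partial>M)"
    using f H by (simp add: integral_density)
  also have "\<dots> = (\<integral>\<omega>. inverse (prob H) *\<^sub>R (indicator H \<omega> *\<^sub>R f \<omega>) \<partial>M)"
    by (simp add: divide_inverse mult.commute)
  also have "\<dots> = (\<integral>\<omega>. indicator H \<omega> *\<^sub>R f \<omega> \<partial>M) /\<^sub>R prob H"
    by (rule integral_scaleR_right)
  finally show ?thesis .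
qed

lemma prob_space_uniform: "H \<in> events \<Longrightarrow> prob H > 0 \<Longrightarrow> prob_space (uniform_measure M H)"
  by (intro prob_space_uniform_measure) (auto simp: emeasure_eq_measure)

text \<open>The integral over the mixture is an iterated integral, computed for cosine and sine
  separately; the sine part vanishes because centred Gaussian laws have real characteristic
  functions. Writing \<open>max 0 (L \<omega>)\<close> keeps the exponential bounded by
  \<open>1\<close> at every point, also on the null set where \<open>L\<close> is negative.\<close>

lemma char_gauss_mixture:
  assumes [measurable]: "L \<in> borel_measurable M" and L0: "AE \<omega> in M. 0 \<le> L \<omega>"
    and H: "H \<in> events" "prob H > 0"
  shows "char (gauss_mixture M L H) t
    = (\<integral>\<omega>. complex_of_real (indicator H \<omega> * exp (- (t\<^sup>2 / 2 * max 0 (L \<omega>)))) \<partial>M) /\<^sub>R prob H"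
proof -
  interpret U: prob_space "uniform_measure M H" by (rule prob_space_uniform[OF H])
  have N: "(\<lambda>\<omega>. gauss (L \<omega>)) \<in> measurable (uniform_measure M H) (subprob_algebra borel)"
    by measurable
  have LU: "AE \<omega> in uniform_measure M H. 0 \<le> L \<omega>"
    by (rule AE_uniform_measureI) (use H L0 in \<open>auto elim: eventually_mono\<close>)
  interpret G: real_distribution "gauss (L \<omega>)" for \<omega>
    by (intro real_distribution.intro real_distribution_axioms.intro prob_space_gauss) simp
  have bind: "(\<integral>x. g x \<partial>gauss_mixture M L H) = (\<integral>\<omega>. (\<integral>x. g x \<partial>gauss (L \<omega>)) \<partial>uniform_measure M H)"
    "integrable (gauss_mixture M L H) g"
    if [measurable]: "g \<in> borel_measurable borel" and g: "\<And>x. \<bar>g x\<bar> \<le> 1" for g :: "real \<Rightarrow> real"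
    unfolding gauss_mixture_def
    by (rule integral_bind[where B=1 and B'=1 and K=borel] integrable_bind[where B=1 and B'=1 and K=borel];
        use g N U.finite_measure_axioms G.emeasure_space_1 in simp)+
  have cs: "integrable (gauss (L \<omega>)) (\<lambda>x. iexp (t * x))" for \<omega>
    by (rule G.integrable_const_bound[where B=1]) auto
  define e where "e \<omega> = exp (- (t\<^sup>2 / 2 * max 0 (L \<omega>)))" for \<omega>
  have ge: "char (gauss (L \<omega>)) t = complex_of_real (e \<omega>)" if "0 \<le> L \<omega>" for \<omega>
    using that char_gauss[OF that] by (simp add: e_def max_def)
  have [measurable]: "e \<in> borel_measurable M" unfolding e_def by measurable
  have meas: "(\<lambda>\<omega>. \<integral>x. g x \<partial>gauss (L \<omega>)) \<in> borel_measurable (uniform_measure M H)"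
    if [measurable]: "g \<in> borel_measurable borel" for g :: "real \<Rightarrow> real"
    by (rule measurable_compose[OF N integral_measurable_subprob_algebra]) simp
  have c: "(\<integral>x. cos (t * x) \<partial>gauss_mixture M L H) = (\<integral>\<omega>. e \<omega> \<partial>uniform_measure M H)"
  proof (subst bind(1))
    show "(\<integral>\<omega>. (\<integral>x. cos (t * x) \<partial>gauss (L \<omega>)) \<partial>uniform_measure M H) = (\<integral>\<omega>. e \<omega> \<partial>uniform_measure M H)"
    proof (rule integral_cong_AE)
      show "AE \<omega> in uniform_measure M H. (\<integral>x. cos (t * x) \<partial>gauss (L \<omega>)) = e \<omega>"
        using LU
      proof eventually_elim
        case (elim \<omega>)
        have "(\<integral>x. cos (t * x) \<partial>gauss (L \<omega>)) = Re (char (gauss (L \<omega>)) t)"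
          unfolding char_def integral_Re[OF cs, symmetric] Re_iexp ..
        then show ?case using ge[OF elim] by simp
      qed
    qed (auto intro!: meas)
  qed auto
  have s: "(\<integral>x. sin (t * x) \<partial>gauss_mixture M L H) = 0"
  proof (subst bind(1))
    have "(\<integral>\<omega>. (\<integral>x. sin (t * x) \<partial>gauss (L \<omega>)) \<partial>uniform_measure M H) = (\<integral>\<omega>. 0 \<partial>uniform_measure M H)"
    proof (rule integral_cong_AE)
      show "AE \<omega> in uniform_measure M H. (\<integral>x. sin (t * x) \<partial>gauss (L \<omega>)) = 0"
        using LU
      proof eventually_elim
        case (elim \<omega>)
        have "(\<integral>x. sin (t * x) \<partial>gauss (L \<omega>)) = Im (char (gauss (L \<omega>)) t)"
          unfolding char_def integral_Im[OF cs, symmetric] Im_iexp ..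
        then show ?case using ge[OF elim] by simp
      qed
    qed (auto intro!: meas)
    then show "(\<integral>\<omega>. (\<integral>x. sin (t * x) \<partial>gauss (L \<omega>)) \<partial>uniform_measure M H) = 0" by simp
  qed auto
  have "integrable (gauss_mixture M L H) (\<lambda>x. complex_of_real (cos (t * x)) + \<i> * complex_of_real (sin (t * x)))"
    by (intro Bochner_Integration.integrable_add integrable_mult_right integrable_of_real bind(2)) auto
  moreover have "complex_of_real (cos (t * x)) + \<i> * complex_of_real (sin (t * x)) = iexp (t * x)" for x
    unfolding complex_eq_iff Re_iexp Im_iexp by simp
  ultimately have int: "integrable (gauss_mixture M L H) (\<lambda>x. iexp (t * x))" by simp
  have "char (gauss_mixture M L H) t = complex_of_real (\<integral>\<omega>. e \<omega> \<partial>uniform_measure M H)"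
    using c s unfolding char_def complex_eq_iff integral_Re[OF int, symmetric] integral_Im[OF int, symmetric]
      Re_iexp Im_iexp by simp
  also have "\<dots> = (\<integral>\<omega>. complex_of_real (indicator H \<omega> * e \<omega>) \<partial>M) /\<^sub>R prob H"
    unfolding integral_complex_of_real
    by (subst integral_uniform_measure[OF H]) (simp_all add: scaleR_conv_of_real)
  finally show ?thesis by (simp add: e_def)
qed

text \<open>Conditioning on \<open>H\<close> divides both sides by \<open>prob H\<close>, so Levy's
  continuity theorem under the conditional law reduces stable convergence to integrals weighted by
  \<open>indicator H\<close>.\<close>

lemma stably_conv_gaussI:
  assumes [measurable]: "\<And>n. Z n \<in> borel_measurable M" "L \<in> borel_measurable M"
    and L0: "AE \<omega> in M. 0 \<le> L \<omega>"
    and lim: "\<And>H t. H \<in> events \<Longrightarrow> (\<lambda>n. \<integral>\<omega>. complex_of_real (indicator H \<omega>) * iexp (t * Z n \<omega>) \<partial>M)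
      \<longlonglongrightarrow> (\<integral>\<omega>. complex_of_real (indicator H \<omega> * exp (- (t\<^sup>2 / 2 * max 0 (L \<omega>)))) \<partial>M)"
  shows "stably_conv_gauss M Z L"
  unfolding stably_conv_gauss_def
proof (intro conjI allI ballI impI L0)
  fix H assume H: "H \<in> events" "0 < prob H"
  interpret U: prob_space "uniform_measure M H" by (rule prob_space_uniform[OF H])
  show "weak_conv_m (\<lambda>n. distr (uniform_measure M H) borel (Z n)) (gauss_mixture M L H)"
  proof (rule levy_continuity)
    show "real_distribution (distr (uniform_measure M H) borel (Z n))" for n
      by (rule U.real_distribution_distr) simp
    have N: "(\<lambda>\<omega>. gauss (L \<omega>)) \<in> measurable (uniform_measure M H) (subprob_algebra borel)"
      by measurable
    show "real_distribution (gauss_mixture M L H)"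
    proof (intro real_distribution.intro real_distribution_axioms.intro)
      show "prob_space (gauss_mixture M L H)"
        unfolding gauss_mixture_def by (rule U.prob_space_bind[OF _ N]) (simp add: prob_space_gauss)
      show "sets (gauss_mixture M L H) = sets borel"
        unfolding gauss_mixture_def by (rule sets_bind) (simp_all add: not_empty)
    qed
    fix t
    have "char (distr (uniform_measure M H) borel (Z n)) t
      = (\<integral>\<omega>. complex_of_real (indicator H \<omega>) * iexp (t * Z n \<omega>) \<partial>M) /\<^sub>R prob H" for n
      unfolding char_def
      by (subst integral_distr) (auto simp: integral_uniform_measure[OF H] scaleR_conv_of_real[of "indicator H _"])
    then show "(\<lambda>n. char (distr (uniform_measure M H) borel (Z n)) t) \<longlonglongrightarrow> char (gauss_mixture M L H) t"
      unfolding char_gauss_mixture[OF assms(2) L0 H] by (simp only: tendsto_scaleR[OF tendsto_const lim[OF H(1)]])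
  qed
qed simp_all

text \<open>Weak convergence to the point mass at \<open>0\<close> amounts to convergence in
  probability, since the limiting distribution function is continuous at \<open>- \<epsilon>\<close>
  and at \<open>\<epsilon>\<close>.\<close>

lemma conv_in_prob_0_of_char:
  assumes [measurable]: "\<And>n. Z n \<in> borel_measurable M"
    and lim: "\<And>t. (\<lambda>n. \<integral>\<omega>. iexp (t * Z n \<omega>) \<partial>M) \<longlonglongrightarrow> 1"
  shows "conv_in_prob M Z (\<lambda>_. 0)"
  unfolding conv_in_prob_def
proof (intro allI impI)
  fix \<epsilon> :: real assume \<epsilon>: "\<epsilon> > 0"
  let ?R = "return borel (0 :: real)"
  interpret R: real_distribution ?R
    by (intro real_distribution.intro real_distribution_axioms.intro prob_space_return) auto
  have cdf_R: "cdf ?R x = (if 0 \<le> x then 1 else 0)" for x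
    by (simp add: cdf_def measure_return)
  have "weak_conv_m (\<lambda>n. distr M borel (Z n)) ?R"
  proof (rule levy_continuity)
    fix t
    show "(\<lambda>n. char (distr M borel (Z n)) t) \<longlonglongrightarrow> char ?R t"
      using lim[of t] by (simp add: char_def integral_distr integral_return)
  qed (auto intro: R.real_distribution_axioms)
  then have conv: "(\<lambda>n. cdf (distr M borel (Z n)) x) \<longlonglongrightarrow> cdf ?R x" if "x \<noteq> 0" for x
    unfolding weak_conv_m_def weak_conv_def using that by (auto simp: R.isCont_cdf measure_return)
  have cdf_Z: "cdf (distr M borel (Z n)) x = prob {\<omega> \<in> space M. Z n \<omega> \<le> x}" for n x
    by (simp add: cdf_def measure_distr vimage_def Int_def conj_commute)
  have "(\<lambda>n. prob {\<omega> \<in> space M. Z n \<omega> \<le> - \<epsilon>} + (1 - prob {\<omega> \<in> space M. Z n \<omega> \<le> \<epsilon>})) \<longlonglongrightarrow> 0 + (1 - 1)"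
    using conv[of "- \<epsilon>"] conv[of \<epsilon>] \<epsilon> unfolding cdf_Z cdf_R
    by (intro tendsto_add tendsto_diff tendsto_const) simp_all
  moreover have "prob {\<omega> \<in> space M. \<bar>Z n \<omega> - 0\<bar> > \<epsilon>}
      \<le> prob {\<omega> \<in> space M. Z n \<omega> \<le> - \<epsilon>} + (1 - prob {\<omega> \<in> space M. Z n \<omega> \<le> \<epsilon>})" for n
  proof -
    have "prob {\<omega> \<in> space M. \<bar>Z n \<omega> - 0\<bar> > \<epsilon>}
        \<le> prob {\<omega> \<in> space M. Z n \<omega> \<le> - \<epsilon>} + prob (space M - {\<omega> \<in> space M. Z n \<omega> \<le> \<epsilon>})"
      by (rule order_trans[OF finite_measure_mono measure_Un_le]) auto
    then show ?thesis by (subst (asm) prob_compl) auto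
  qed
  ultimately show "(\<lambda>n. prob {\<omega> \<in> space M. \<bar>Z n \<omega> - 0\<bar> > \<epsilon>}) \<longlonglongrightarrow> 0"
    by (intro LIMSEQ_null_sandwich[OF measure_nonneg]) auto
qed

text \<open>A single real random variable is tight: \<open>\<bar>V\<bar> \<le> N\<close> off an
  event of small probability, and there the product is controlled by
  \<open>N \<bar>Z n\<bar>\<close>.\<close>

lemma conv_in_prob_mult_rv:
  assumes [measurable]: "V \<in> borel_measurable M" "\<And>n. Z n \<in> borel_measurable M"
    and Z: "conv_in_prob M Z (\<lambda>_. 0)"
  shows "conv_in_prob M (\<lambda>n \<omega>. V \<omega> * Z n \<omega>) (\<lambda>_. 0)"
  unfolding conv_in_prob_def
proof (intro allI impI LIMSEQ_I)
  fix \<epsilon> \<eta> :: real assume \<epsilon>: "\<epsilon> > 0" and \<eta>: "\<eta> > 0"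
  have "conv_in_prob M (\<lambda>N \<omega>. V \<omega> / real N) (\<lambda>_. 0)"
    by (intro conv_in_prob_AE AE_I2 lim_const_over_n) auto
  then have "(\<lambda>N. prob {\<omega> \<in> space M. \<bar>V \<omega> / real N - 0\<bar> > 1}) \<longlonglongrightarrow> 0"
    by (rule conv_in_probD) simp
  then have "\<forall>\<^sub>F N in sequentially. prob {\<omega> \<in> space M. \<bar>V \<omega> / real N - 0\<bar> > 1} < \<eta> / 2"
    using \<eta> by (intro order_tendstoD) auto
  with eventually_gt_at_top[of 0]
  have "\<forall>\<^sub>F N in sequentially. 0 < N \<and> prob {\<omega> \<in> space M. \<bar>V \<omega> / real N - 0\<bar> > 1} < \<eta> / 2"
    by eventually_elim auto
  then obtain N where N: "0 < N" "prob {\<omega> \<in> space M. \<bar>V \<omega> / real N - 0\<bar> > 1} < \<eta> / 2"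
    using eventually_happens'[OF sequentially_bot] by blast
  have "\<epsilon> / real N > 0" using \<epsilon> N by simp
  from LIMSEQ_D[OF conv_in_probD[OF Z this], of "\<eta> / 2"] \<eta>
  obtain n0 where n0: "\<And>n. n \<ge> n0 \<Longrightarrow> prob {\<omega> \<in> space M. \<bar>Z n \<omega> - 0\<bar> > \<epsilon> / real N} < \<eta> / 2"
    by auto
  show "\<exists>no. \<forall>n\<ge>no. norm (prob {\<omega> \<in> space M. \<epsilon> < \<bar>V \<omega> * Z n \<omega> - 0\<bar>} - 0) < \<eta>"
  proof (intro exI allI impI)
    fix n assume n: "n \<ge> n0"
    let ?A = "{\<omega> \<in> space M. \<bar>V \<omega> / real N - 0\<bar> > 1}"
    let ?B = "{\<omega> \<in> space M. \<bar>Z n \<omega> - 0\<bar> > \<epsilon> / real N}"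
    have "{\<omega> \<in> space M. \<epsilon> < \<bar>V \<omega> * Z n \<omega> - 0\<bar>} \<subseteq> ?A \<union> ?B"
    proof (rule subsetI, rule ccontr)
      fix \<omega> assume *: "\<omega> \<in> {\<omega> \<in> space M. \<epsilon> < \<bar>V \<omega> * Z n \<omega> - 0\<bar>}" "\<omega> \<notin> ?A \<union> ?B"
      then have "\<bar>V \<omega>\<bar> \<le> real N" "\<bar>Z n \<omega>\<bar> \<le> \<epsilon> / real N"
        using N by (auto simp: not_less abs_divide divide_le_eq)
      then have "\<bar>V \<omega>\<bar> * \<bar>Z n \<omega>\<bar> \<le> real N * (\<epsilon> / real N)" by (intro mult_mono) auto
      then show False using * N by (simp add: abs_mult)
    qed
    then have "prob {\<omega> \<in> space M. \<epsilon> < \<bar>V \<omega> * Z n \<omega> - 0\<bar>} \<le> prob ?A + prob ?B"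
      by (intro order_trans[OF finite_measure_mono measure_Un_le]) auto
    then show "norm (prob {\<omega> \<in> space M. \<epsilon> < \<bar>V \<omega> * Z n \<omega> - 0\<bar>} - 0) < \<eta>"
      using n0[OF n] N(2) unfolding diff_0_right real_norm_def abs_of_nonneg[OF measure_nonneg] by linarith
  qed
qed

end

lemma cesaro_mean_tendsto:
  fixes a :: "nat \<Rightarrow> real"
  assumes "a \<longlonglongrightarrow> l"
  shows "(\<lambda>n. (\<Sum>k<n. a k) / real n) \<longlonglongrightarrow> l"
proof -
  have zero: "(\<lambda>n. (\<Sum>k<n. b k) / real n) \<longlonglongrightarrow> 0" if b: "b \<longlonglongrightarrow> 0" for b :: "nat \<Rightarrow> real"
  proof (rule LIMSEQ_I)
    fix \<epsilon> :: real assume \<epsilon>: "\<epsilon> > 0"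
    from LIMSEQ_D[OF b, of "\<epsilon> / 2"] \<epsilon> obtain m where m: "\<And>k. m \<le> k \<Longrightarrow> \<bar>b k\<bar> < \<epsilon> / 2" by auto
    define B where "B = (\<Sum>k<m. \<bar>b k\<bar>)"
    from LIMSEQ_D[OF lim_const_over_n[of B], of "\<epsilon> / 2"] \<epsilon> obtain n0 where
      n0: "\<And>n. n0 \<le> n \<Longrightarrow> \<bar>B / real n\<bar> < \<epsilon> / 2" by auto
    show "\<exists>no. \<forall>n\<ge>no. norm ((\<Sum>k<n. b k) / real n - 0) < \<epsilon>"
    proof (intro exI allI impI)
      fix n assume n: "max (Suc m) n0 \<le> n"
      then have s: "{..<n} = {..<m} \<union> {m..<n}" by auto
      have "\<bar>\<Sum>k<n. b k\<bar> \<le> (\<Sum>k<n. \<bar>b k\<bar>)" by (rule sum_abs)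
      also have "\<dots> = B + (\<Sum>k\<in>{m..<n}. \<bar>b k\<bar>)"
        unfolding s B_def by (rule sum.union_disjoint) auto
      also have "(\<Sum>k\<in>{m..<n}. \<bar>b k\<bar>) \<le> (\<Sum>k\<in>{m..<n}. \<epsilon> / 2)"
        using m by (intro sum_mono) (auto intro: less_imp_le)
      also have "\<dots> \<le> real n * (\<epsilon> / 2)" using \<epsilon> by (simp add: mult_right_mono)
      finally have "\<bar>\<Sum>k<n. b k\<bar> / real n \<le> (B + real n * (\<epsilon> / 2)) / real n"
        by (intro divide_right_mono) auto
      also have "\<dots> = B / real n + \<epsilon> / 2" using n by (simp add: add_divide_distrib)
      also have "B / real n \<le> \<bar>B / real n\<bar>" by (rule abs_ge_self)
      also have "\<dots> < \<epsilon> / 2" using n by (intro n0) simp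
      finally show "norm ((\<Sum>k<n. b k) / real n - 0) < \<epsilon>" by simp
    qed
  qed
  have "(\<lambda>n. (\<Sum>k<n. a k - l) / real n + l) \<longlonglongrightarrow> 0 + l"
    using assms by (intro tendsto_add zero tendsto_const) (simp add: LIM_zero)
  moreover have "\<forall>\<^sub>F n in sequentially. (\<Sum>k<n. a k - l) / real n + l = (\<Sum>k<n. a k) / real n"
    using eventually_gt_at_top[of 0] by eventually_elim (simp add: sum_subtractf field_simps)
  ultimately show ?thesis by (simp add: tendsto_cong)
qed

section \<open>Conditionally identically distributed sequences\<close>

lemma integral_mean_le:
  fixes u :: "nat \<Rightarrow> 'a \<Rightarrow> real"
  assumes "\<And>k. integrable M (u k)" "\<And>k. (\<integral>\<omega>. u k \<omega> \<partial>M) \<le> K" "0 \<le> K"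
  shows "integrable M (\<lambda>\<omega>. (\<Sum>k<n. u k \<omega>) / real n)" "(\<integral>\<omega>. (\<Sum>k<n. u k \<omega>) / real n \<partial>M) \<le> K"
proof -
  show "integrable M (\<lambda>\<omega>. (\<Sum>k<n. u k \<omega>) / real n)" using assms(1) by auto
  have "(\<Sum>k<n. \<integral>\<omega>. u k \<omega> \<partial>M) / real n \<le> (\<Sum>k<n. K) / real n"
    by (intro divide_right_mono sum_mono assms(2)) simp
  \<comment> \<open>For \<open>n = 0\<close> the mean is \<open>0\<close> by division by zero; this
    is where \<open>0 \<le> K\<close> enters.\<close>
  also have "\<dots> \<le> K" using assms(3) by (cases "n = 0") auto
  finally show "(\<integral>\<omega>. (\<Sum>k<n. u k \<omega>) / real n \<partial>M) \<le> K" using assms(1) by simp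
qed

text \<open>The absolute value on the right matches the shape required by
  \<open>conv_in_prob_tight_product\<close>.\<close>

lemma Cauchy_Schwarz_mean:
  fixes a b :: "nat \<Rightarrow> real"
  shows "((\<Sum>k<n. a k * b k) / real n)\<^sup>2 \<le> (\<Sum>k<n. (a k)\<^sup>2) / real n * \<bar>(\<Sum>k<n. (b k)\<^sup>2) / real n\<bar>"
proof -
  have "((\<Sum>k<n. a k * b k) / real n)\<^sup>2 = (\<Sum>k<n. a k * b k)\<^sup>2 / (real n)\<^sup>2"
    by (simp add: power_divide)
  also have "\<dots> \<le> ((\<Sum>k<n. (a k)\<^sup>2) * (\<Sum>k<n. (b k)\<^sup>2)) / (real n)\<^sup>2"
    by (intro divide_right_mono Cauchy_Schwarz_ineq_sum) simp
  finally show ?thesis by (simp add: power2_eq_square sum_nonneg)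
qed

lemma (in sigma_finite_subalgebra) real_cond_exp_L1_le:
  assumes f: "integrable M f"
  shows "(\<integral>x. \<bar>real_cond_exp M F f x\<bar> \<partial>M) \<le> (\<integral>x. \<bar>f x\<bar> \<partial>M)"
proof -
  have af: "integrable M (\<lambda>x. \<bar>f x\<bar>)" using f by simp
  have "AE x in M. real_cond_exp M F f x \<le> real_cond_exp M F (\<lambda>x. \<bar>f x\<bar>) x"
    by (rule real_cond_exp_mono[OF _ f af]) auto
  moreover have "AE x in M. real_cond_exp M F (\<lambda>x. - f x) x \<le> real_cond_exp M F (\<lambda>x. \<bar>f x\<bar>) x"
    by (rule real_cond_exp_mono[OF _ _ af]) (use f in auto)
  moreover have "AE x in M. real_cond_exp M F (\<lambda>x. - f x) x = - real_cond_exp M F f x"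
    using real_cond_exp_cmult[OF f, of "- 1"] by simp
  ultimately have "AE x in M. \<bar>real_cond_exp M F f x\<bar> \<le> real_cond_exp M F (\<lambda>x. \<bar>f x\<bar>) x"
    by eventually_elim auto
  then have "(\<integral>x. \<bar>real_cond_exp M F f x\<bar> \<partial>M) \<le> (\<integral>x. real_cond_exp M F (\<lambda>x. \<bar>f x\<bar>) x \<partial>M)"
    using real_cond_exp_int(1)[OF f] real_cond_exp_int(1)[OF af] by (intro integral_mono_AE) auto
  then show ?thesis using real_cond_exp_int(2)[OF af] by simp
qed

lemma (in sigma_finite_subalgebra) real_cond_exp_L2:
  assumes f: "integrable M f" and f2: "integrable M (\<lambda>x. (f x)\<^sup>2)"
  shows "integrable M (\<lambda>x. (real_cond_exp M F f x)\<^sup>2)"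
    and "(\<integral>x. (real_cond_exp M F f x)\<^sup>2 \<partial>M) \<le> (\<integral>x. (f x)\<^sup>2 \<partial>M)"
proof -
  have conv: "convex_on UNIV (\<lambda>x::real. x\<^sup>2)" by (rule convex_power2)
  show int: "integrable M (\<lambda>x. (real_cond_exp M F f x)\<^sup>2)"
    by (rule integrable_convex_cond_exp[OF f, where I=UNIV]) (use f2 conv in auto)
  have "AE x in M. (real_cond_exp M F f x)\<^sup>2 \<le> real_cond_exp M F (\<lambda>x. (f x)\<^sup>2) x"
    by (rule real_cond_exp_jensens_inequality(2)[OF f, where I=UNIV]) (use f2 conv in auto)
  then have "(\<integral>x. (real_cond_exp M F f x)\<^sup>2 \<partial>M) \<le> (\<integral>x. real_cond_exp M F (\<lambda>x. (f x)\<^sup>2) x \<partial>M)"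
    using int real_cond_exp_int(1)[OF f2] by (intro integral_mono_AE) auto
  then show "(\<integral>x. (real_cond_exp M F f x)\<^sup>2 \<partial>M) \<le> (\<integral>x. (f x)\<^sup>2 \<partial>M)"
    using real_cond_exp_int(2)[OF f2] by simp
qed

lemma set_integrable_space_iff:
  fixes f :: "'a \<Rightarrow> 'b::{banach, second_countable_topology}"
  shows "set_integrable M (space M) f \<longleftrightarrow> integrable M f"
  unfolding set_integrable_def by (rule Bochner_Integration.integrable_cong) auto

section \<open>From bounded to integrable functions of a c.i.d. sequence\<close>

locale cid_sequence = filtered_prob_space M G for M :: "'a measure" and G +
  fixes E :: "'e measure" and X :: "nat \<Rightarrow> 'a \<Rightarrow> 'e"
  assumes cid: "cid M G E X"
begin

lemma measurable_X_G: "X (Suc n) \<in> measurable (G (Suc n)) E"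
  using cid by (simp add: cid_def)

lemma measurable_X [measurable]: "X (Suc n) \<in> measurable M E"
  by (rule measurable_G_M[OF measurable_X_G])

text \<open>The c.i.d. property is postulated for bounded functions only. Rephrased as an equality of
  laws it extends to all integrable functions.\<close>

lemma law_X_on_G:
  assumes A: "A \<in> sets (G n)" and nk: "n \<le> k"
  shows "distr (density M (indicator A)) E (X (Suc k)) = distr (density M (indicator A)) E (X (Suc n))"
proof (rule measure_eqI)
  interpret F: sigma_finite_subalgebra M "G n" by (rule sigma_finite_sub)
  have [measurable]: "A \<in> events" by (rule sets_G_M[OF A])
  fix B assume "B \<in> sets (distr (density M (indicator A)) E (X (Suc k)))"
  then have [measurable]: "B \<in> sets E" by simp
  have e: "emeasure (distr (density M (indicator A)) E (X (Suc i))) B = ennreal (\<integral>\<omega>\<in>A. indicator B (X (Suc i) \<omega>) \<partial>M)" for i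
  proof -
    have "emeasure (distr (density M (indicator A)) E (X (Suc i))) B
        = emeasure M (A \<inter> (X (Suc i) -` B \<inter> space M))"
      by (simp add: emeasure_distr emeasure_restricted)
    also have "\<dots> = ennreal (\<integral>\<omega>. indicator (A \<inter> (X (Suc i) -` B \<inter> space M)) \<omega> \<partial>M)"
      by (simp add: emeasure_eq_measure)
    also have "(\<integral>\<omega>. indicator (A \<inter> (X (Suc i) -` B \<inter> space M)) \<omega> \<partial>M :: real) = (\<integral>\<omega>\<in>A. indicator B (X (Suc i) \<omega>) \<partial>M)"
      unfolding set_lebesgue_integral_def
      by (intro Bochner_Integration.integral_cong) (auto split: split_indicator)
    finally show ?thesis .
  qed
  have int: "integrable M (\<lambda>\<omega>. indicator B (X (Suc i) \<omega>) :: real)" for i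
    by (rule integrable_const_bound[where B=1]) auto
  \<comment> \<open>The defining equation of \<open>cid\<close> is applied to indicators only, which
    are bounded; everything else follows from equality of laws.\<close>
  have "AE \<omega> in M. real_cond_exp M (G n) (\<lambda>\<omega>. indicator B (X (Suc k) \<omega>)) \<omega>
      = real_cond_exp M (G n) (\<lambda>\<omega>. indicator B (X (n + 1) \<omega>)) \<omega>"
  proof -
    have "bounded ((indicator B :: 'e \<Rightarrow> real) ` space E)"
      by (rule boundedI[of _ 1]) (auto simp: indicator_def)
    moreover have "(indicator B :: 'e \<Rightarrow> real) \<in> borel_measurable E" by measurable
    ultimately show ?thesis using cid nk unfolding cid_def by (simp add: less_Suc_eq_le)
  qed
  then have "(\<integral>\<omega>\<in>A. real_cond_exp M (G n) (\<lambda>\<omega>. indicator B (X (Suc k) \<omega>)) \<omega> \<partial>M)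
      = (\<integral>\<omega>\<in>A. real_cond_exp M (G n) (\<lambda>\<omega>. indicator B (X (Suc n) \<omega>)) \<omega> \<partial>M)"
    unfolding set_lebesgue_integral_def by (intro integral_cong_AE) auto
  then show "emeasure (distr (density M (indicator A)) E (X (Suc k))) B
      = emeasure (distr (density M (indicator A)) E (X (Suc n))) B"
    unfolding e by (simp add: F.real_cond_exp_intA[OF int A])
qed simp

lemma
  fixes f :: "'e \<Rightarrow> real"
  assumes A: "A \<in> sets (G n)" and nk: "n \<le> k" and f [measurable]: "f \<in> borel_measurable E"
  shows set_integrable_X_iff: "set_integrable M A (\<lambda>\<omega>. f (X (Suc k) \<omega>)) \<longleftrightarrow> set_integrable M A (\<lambda>\<omega>. f (X (Suc n) \<omega>))"
    and set_integral_X_eq: "(\<integral>\<omega>\<in>A. f (X (Suc k) \<omega>) \<partial>M) = (\<integral>\<omega>\<in>A. f (X (Suc n) \<omega>) \<partial>M)"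
proof -
  have [measurable]: "A \<in> events" by (rule sets_G_M[OF A])
  let ?N = "density M (\<lambda>\<omega>. ennreal (indicator A \<omega>))"
  have N: "distr ?N E (X (Suc k)) = distr ?N E (X (Suc n))"
    using law_X_on_G[OF A nk] by (simp add: ennreal_indicator)
  have i: "integrable (distr ?N E (X (Suc i))) f \<longleftrightarrow> set_integrable M A (\<lambda>\<omega>. f (X (Suc i) \<omega>))" for i
    by (simp add: integrable_distr_eq integrable_density set_integrable_def)
  have j: "integral\<^sup>L (distr ?N E (X (Suc i))) f = (\<integral>\<omega>\<in>A. f (X (Suc i) \<omega>) \<partial>M)" for i
    by (simp add: integral_distr integral_density set_lebesgue_integral_def)
  show "set_integrable M A (\<lambda>\<omega>. f (X (Suc k) \<omega>)) \<longleftrightarrow> set_integrable M A (\<lambda>\<omega>. f (X (Suc n) \<omega>))"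
    using N i by metis
  show "(\<integral>\<omega>\<in>A. f (X (Suc k) \<omega>) \<partial>M) = (\<integral>\<omega>\<in>A. f (X (Suc n) \<omega>) \<partial>M)"
    using N j by metis
qed

lemma class_H_measurable: "f \<in> class_H M E X \<Longrightarrow> f \<in> borel_measurable E"
  by (simp add: class_H_def)

lemma integrable_X:
  assumes f: "f \<in> class_H M E X"
  shows "integrable M (\<lambda>\<omega>. f (X (Suc k) \<omega>))"
proof -
  have "set_integrable M (space M) (\<lambda>\<omega>. f (X (Suc 0) \<omega>))"
    using f by (simp add: class_H_def set_integrable_space_iff)
  then show ?thesis
    using set_integrable_X_iff[OF space_in_G le0 class_H_measurable[OF f]] by (simp add: set_integrable_space_iff)
qed

lemma integral_X:
  fixes f :: "'e \<Rightarrow> real"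
  assumes f: "f \<in> borel_measurable E"
  shows "(\<integral>\<omega>. f (X (Suc k) \<omega>) \<partial>M) = (\<integral>\<omega>. f (X (Suc 0) \<omega>) \<partial>M)"
proof -
  have "(\<integral>\<omega>\<in>space M. f (X (Suc k) \<omega>) \<partial>M) = (\<integral>\<omega>. f (X (Suc k) \<omega>) \<partial>M)" for k
    unfolding set_lebesgue_integral_def by (intro Bochner_Integration.integral_cong) auto
  then show ?thesis using set_integral_X_eq[OF space_in_G le0 f] by simp
qed

abbreviation P :: "('e \<Rightarrow> real) \<Rightarrow> nat \<Rightarrow> 'a \<Rightarrow> real" where
  "P \<equiv> pred_mean M G X"

lemma measurable_P_G: "P f n \<in> borel_measurable (G n)"
  by (simp add: pred_mean_def)

lemma measurable_P [measurable]: "P f n \<in> borel_measurable M"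
  by (simp add: pred_mean_def)

lemma integrable_P: "f \<in> class_H M E X \<Longrightarrow> integrable M (P f n)"
  unfolding pred_mean_def using integrable_X[of f n]
  by (intro sigma_finite_subalgebra.real_cond_exp_int(1)[OF sigma_finite_sub]) simp

text \<open>A conditional expectation is determined by its integrals over the sets of
  \<open>G n\<close>, and by equality of laws these are the same for every
  \<open>k \<ge> n\<close>.\<close>

lemma cond_exp_X:
  assumes f: "f \<in> class_H M E X" and nk: "n \<le> k"
  shows "AE \<omega> in M. real_cond_exp M (G n) (\<lambda>\<omega>. f (X (Suc k) \<omega>)) \<omega> = P f n \<omega>"
proof -
  interpret F: sigma_finite_subalgebra M "G n" by (rule sigma_finite_sub)
  show ?thesis
  proof (rule F.real_cond_exp_charact)
    fix A assume A: "A \<in> sets (G n)"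
    have "(\<integral>\<omega>\<in>A. f (X (Suc k) \<omega>) \<partial>M) = (\<integral>\<omega>\<in>A. f (X (Suc n) \<omega>) \<partial>M)"
      by (rule set_integral_X_eq[OF A nk class_H_measurable[OF f]])
    also have "\<dots> = (\<integral>\<omega>\<in>A. P f n \<omega> \<partial>M)"
      unfolding pred_mean_def Suc_eq_plus1[symmetric] by (rule F.real_cond_exp_intA[OF integrable_X[OF f] A])
    finally show "(\<integral>\<omega>\<in>A. f (X (Suc k) \<omega>) \<partial>M) = (\<integral>\<omega>\<in>A. P f n \<omega> \<partial>M)" .
  qed (use f measurable_P_G in \<open>auto intro: integrable_X integrable_P\<close>)
qed

text \<open>The predictive means form a martingale: the tower property yields
  \<open>E[f (X (n + 2)) | G n]\<close>, and the c.i.d. property lowers the index to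
  \<open>n + 1\<close>.\<close>

lemma cond_exp_P:
  assumes f: "f \<in> class_H M E X"
  shows "AE \<omega> in M. real_cond_exp M (G n) (P f (Suc n)) \<omega> = P f n \<omega>"
proof -
  interpret F: sigma_finite_subalgebra M "G n" by (rule sigma_finite_sub)
  have "AE \<omega> in M. real_cond_exp M (G n) (P f (Suc n)) \<omega> = real_cond_exp M (G n) (\<lambda>\<omega>. f (X (Suc (Suc n)) \<omega>)) \<omega>"
    unfolding pred_mean_def
    using F.real_cond_exp_nested_subalg[OF subalg subalgebra_G[of n "Suc n"] integrable_X[OF f, of "Suc n"]] by simp
  with cond_exp_X[OF f, of n "Suc n"] show ?thesis by auto
qed

text \<open>One statement for three sequences: innovations (\<open>a = 1\<close>,
  \<open>b = 0\<close>), the differences of the theorem (\<open>a = 1\<close>,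
  \<open>b k = k + 1\<close>) and the drift alone (\<open>a = 0\<close>,
  \<open>b k = - (k + 1)\<close>). Both brackets have conditional mean zero, the first by definition
  of \<open>P\<close> and the second since \<open>P\<close> is a martingale.\<close>

lemma square_integrable_mds_combination:
  assumes f: "f \<in> class_H M E X" and f2: "(\<lambda>x. (f x)\<^sup>2) \<in> class_H M E X"
  shows "square_integrable_mds M G (\<lambda>k \<omega>. a * (f (X (Suc k) \<omega>) - P f k \<omega>) - b k * (P f (Suc k) \<omega> - P f k \<omega>))"
proof (intro square_integrable_mds.intro square_integrable_mds_axioms.intro filtered_prob_space_axioms)
  fix k
  interpret F: sigma_finite_subalgebra M "G k" by (rule sigma_finite_sub)
  note [measurable] = class_H_measurable[OF f]
  have [measurable]: "(\<lambda>\<omega>. f (X (Suc k) \<omega>)) \<in> borel_measurable (G (Suc k))" "P f (Suc k) \<in> borel_measurable (G (Suc k))"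
    "P f k \<in> borel_measurable (G (Suc k))"
    using measurable_compose[OF measurable_X_G class_H_measurable[OF f]] measurable_P_G
      measurable_from_subalg[OF subalgebra_G[of k "Suc k"] measurable_P_G] by auto
  show "(\<lambda>\<omega>. a * (f (X (Suc k) \<omega>) - P f k \<omega>) - b k * (P f (Suc k) \<omega> - P f k \<omega>)) \<in> borel_measurable (G (Suc k))"
    by measurable
  have L2f: "integrable M (\<lambda>\<omega>. (f (X (Suc k) \<omega>))\<^sup>2)" for k using integrable_X[OF f2] .
  have L2P: "integrable M (\<lambda>\<omega>. (P f n \<omega>)\<^sup>2)" for n
    unfolding pred_mean_def Suc_eq_plus1[symmetric]
    by (rule sigma_finite_subalgebra.real_cond_exp_L2(1)[OF sigma_finite_sub integrable_X[OF f] L2f])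
  have L2c: "integrable M (\<lambda>\<omega>. (c * u \<omega>)\<^sup>2)" if "integrable M (\<lambda>\<omega>. (u \<omega>)\<^sup>2)" for c and u :: "'a \<Rightarrow> real"
    using that by (simp add: power_mult_distrib)
  have e: "a * (f (X (Suc k) \<omega>) - P f k \<omega>) - b k * (P f (Suc k) \<omega> - P f k \<omega>)
      = a * f (X (Suc k) \<omega>) + ((b k - a) * P f k \<omega> + (- b k) * P f (Suc k) \<omega>)" for \<omega>
    by (simp add: algebra_simps)
  show "integrable M (\<lambda>\<omega>. (a * (f (X (Suc k) \<omega>) - P f k \<omega>) - b k * (P f (Suc k) \<omega> - P f k \<omega>))\<^sup>2)"
    unfolding e by (intro integrable_square_add L2c L2f L2P) measurable
  note if' = integrable_X[OF f, of k] and iP = integrable_P[OF f]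
  have "AE \<omega> in M. real_cond_exp M (G k) (\<lambda>\<omega>. a * f (X (Suc k) \<omega>) + ((b k - a) * P f k \<omega> + (- b k) * P f (Suc k) \<omega>)) \<omega>
     = real_cond_exp M (G k) (\<lambda>\<omega>. a * f (X (Suc k) \<omega>)) \<omega>
       + real_cond_exp M (G k) (\<lambda>\<omega>. (b k - a) * P f k \<omega> + (- b k) * P f (Suc k) \<omega>) \<omega>"
    using if' iP by (intro F.real_cond_exp_add Bochner_Integration.integrable_add integrable_mult_right)
  moreover have "AE \<omega> in M. real_cond_exp M (G k) (\<lambda>\<omega>. (b k - a) * P f k \<omega> + (- b k) * P f (Suc k) \<omega>) \<omega>
     = real_cond_exp M (G k) (\<lambda>\<omega>. (b k - a) * P f k \<omega>) \<omega> + real_cond_exp M (G k) (\<lambda>\<omega>. (- b k) * P f (Suc k) \<omega>) \<omega>"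
    using iP by (intro F.real_cond_exp_add integrable_mult_right)
  moreover note F.real_cond_exp_cmult[OF if', of a] F.real_cond_exp_cmult[OF iP, of "b k - a" k]
    F.real_cond_exp_cmult[OF iP, of "- b k" "Suc k"] F.real_cond_exp_F_meas[OF iP measurable_P_G]
    cond_exp_P[OF f, of k] cond_exp_X[OF f order_refl, of k]
  ultimately show "AE \<omega> in M. real_cond_exp M (G k) (\<lambda>\<omega>. a * (f (X (Suc k) \<omega>) - P f k \<omega>) - b k * (P f (Suc k) \<omega> - P f k \<omega>)) \<omega> = 0"
    unfolding e
  proof eventually_elim
    case (elim \<omega>)
    have "real_cond_exp M (G k) (\<lambda>\<omega>. a * f (X (Suc k) \<omega>) + ((b k - a) * P f k \<omega> + (- b k) * P f (Suc k) \<omega>)) \<omega>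
      = a * P f k \<omega> + ((b k - a) * P f k \<omega> + (- b k) * P f k \<omega>)"
      using elim by (simp only:)
    then show ?case by (simp add: algebra_simps)
  qed
qed

text \<open>The innovations are orthogonal and bounded by \<open>2 B\<close>, so their mean has
  second moment at most \<open>(2 B)^2 / n\<close>; the weighted inequality turns this into an
  \<open>L^1\<close> bound.\<close>

lemma lln_bounded:
  assumes [measurable]: "f \<in> borel_measurable E" and B: "\<And>x. \<bar>f x\<bar> \<le> B"
  shows "(\<lambda>n. \<integral>\<omega>. \<bar>(\<Sum>k<n. f (X (Suc k) \<omega>) - P f k \<omega>) / real n\<bar> \<partial>M) \<longlonglongrightarrow> 0"
proof -
  have int: "integrable M (\<lambda>\<omega>. f (X (Suc k) \<omega>))" "integrable M (\<lambda>\<omega>. (f (X (Suc k) \<omega>))\<^sup>2)" for k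
    by (rule integrable_const_bound[where B=B]; use B in auto)
       (rule integrable_const_bound[where B="B\<^sup>2"]; use B in \<open>auto intro!: square_le_of_abs_le\<close>)
  have f: "f \<in> class_H M E X" and f2: "(\<lambda>x. (f x)\<^sup>2) \<in> class_H M E X"
    using int[of 0] by (simp_all add: class_H_def)
  define Y where "Y k \<omega> = f (X (Suc k) \<omega>) - P f k \<omega>" for k \<omega>
  interpret mds: square_integrable_mds M G Y
    using square_integrable_mds_combination[OF f f2, of 1 "\<lambda>_. 0"] by (simp add: Y_def[abs_def])
  have P_le: "AE \<omega> in M. \<bar>P f k \<omega>\<bar> \<le> B" for k
    unfolding pred_mean_def Suc_eq_plus1[symmetric]
    by (rule sigma_finite_subalgebra.real_cond_exp_abs_le[OF sigma_finite_sub int(1)]) (use B in simp)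
  have Y2: "(\<integral>\<omega>. (Y k \<omega>)\<^sup>2 \<partial>M) \<le> (2 * B)\<^sup>2" for k
  proof -
    have "AE \<omega> in M. (Y k \<omega>)\<^sup>2 \<le> (2 * B)\<^sup>2"
      using P_le[of k]
    proof eventually_elim
      case (elim \<omega>)
      then have "\<bar>Y k \<omega>\<bar> \<le> 2 * B" using B[of "X (Suc k) \<omega>"] unfolding Y_def by linarith
      then show ?case by (rule square_le_of_abs_le)
    qed
    then have "(\<integral>\<omega>. (Y k \<omega>)\<^sup>2 \<partial>M) \<le> (\<integral>\<omega>. (2 * B)\<^sup>2 \<partial>M)"
      using mds.square_integrable by (intro integral_mono_AE) auto
    then show ?thesis by (simp add: prob_space)
  qed
  let ?W = "\<lambda>n \<omega>. (\<Sum>k<n. Y k \<omega>) / real n"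
  have W2: "(\<integral>\<omega>. (?W n \<omega>)\<^sup>2 \<partial>M) \<le> (2 * B)\<^sup>2 / real n" for n
  proof (cases "n = 0")
    case False
    have "(\<integral>\<omega>. (?W n \<omega>)\<^sup>2 \<partial>M) = (\<Sum>k<n. \<integral>\<omega>. (Y k \<omega>)\<^sup>2 \<partial>M) / (real n)\<^sup>2"
      by (simp add: power_divide mds.integral_square_sum)
    also have "\<dots> \<le> (\<Sum>k<n. (2 * B)\<^sup>2) / (real n)\<^sup>2"
      by (intro divide_right_mono sum_mono Y2) simp
    also have "\<dots> = (2 * B)\<^sup>2 / real n" using False by (simp add: power2_eq_square)
    finally show ?thesis .
  qed simp
  have "(\<lambda>n. \<integral>\<omega>. \<bar>?W n \<omega>\<bar> \<partial>M) \<longlonglongrightarrow> 0"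
  proof (rule LIMSEQ_I)
    fix \<epsilon> :: real assume \<epsilon>: "\<epsilon> > 0"
    then have w: "\<epsilon> / 2 > 0" by simp
    from LIMSEQ_D[OF lim_const_over_n[of "(2 * B)\<^sup>2 / (\<epsilon> / 2)"] w] obtain n0
      where n0': "\<And>n. n0 \<le> n \<Longrightarrow> norm ((2 * B)\<^sup>2 / (\<epsilon> / 2) / real n - 0) < \<epsilon> / 2" by blast
    have n0: "(2 * B)\<^sup>2 / (\<epsilon> / 2) / real n < \<epsilon> / 2" if "n0 \<le> n" for n
      using n0'[OF that] unfolding diff_0_right real_norm_def by (rule le_less_trans[OF abs_ge_self])
    show "\<exists>no. \<forall>n\<ge>no. norm ((\<integral>\<omega>. \<bar>?W n \<omega>\<bar> \<partial>M) - 0) < \<epsilon>"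
    proof (intro exI allI impI)
      fix n assume n: "n0 \<le> n"
      have i2: "integrable M (\<lambda>\<omega>. \<bar>?W n \<omega>\<bar>\<^sup>2)"
        using mds.integrable_square_sum by (simp add: power_divide)
      have "(\<integral>\<omega>. \<bar>?W n \<omega>\<bar> \<partial>M) = (\<integral>\<omega>. 1 * \<bar>?W n \<omega>\<bar> \<partial>M)" by simp
      also have "\<dots> \<le> \<epsilon> / 2 * (\<integral>\<omega>. 1\<^sup>2 \<partial>M) + (\<integral>\<omega>. \<bar>?W n \<omega>\<bar>\<^sup>2 \<partial>M) / (\<epsilon> / 2)"
        by (rule integral_mult_le_weighted[OF _ _ _ i2 w]) simp_all
      also have "\<dots> \<le> \<epsilon> / 2 + (2 * B)\<^sup>2 / real n / (\<epsilon> / 2)"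
        unfolding power2_abs using W2[of n] w by (intro add_mono divide_right_mono) (simp_all add: prob_space)
      also have "(2 * B)\<^sup>2 / real n / (\<epsilon> / 2) = (2 * B)\<^sup>2 / (\<epsilon> / 2) / real n"
        by (simp add: mult.commute)
      also have "\<epsilon> / 2 + \<dots> < \<epsilon> / 2 + \<epsilon> / 2" by (intro add_strict_left_mono n0 n)
      finally show "norm ((\<integral>\<omega>. \<bar>?W n \<omega>\<bar> \<partial>M) - 0) < \<epsilon>"
        by simp
    qed
  qed
  then show ?thesis by (simp add: Y_def)
qed

text \<open>The law is also needed for \<open>f^2\<close>, which is merely integrable, so the
  \<open>L^2\<close> argument is preceded by a truncation of \<open>f\<close>. The remainder is
  small in \<open>L^1\<close> uniformly in the index.\<close>

lemma lln:
  assumes f: "f \<in> class_H M E X"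
  shows "conv_in_prob M (\<lambda>n \<omega>. (\<Sum>k<n. f (X (Suc k) \<omega>) - P f k \<omega>) / real n) (\<lambda>_. 0)"
proof (rule conv_in_prob_L1)
  note [measurable] = class_H_measurable[OF f]
  note iX = integrable_X[OF f] and iP = integrable_P[OF f]
  show int: "integrable M (\<lambda>\<omega>. (\<Sum>k<n. f (X (Suc k) \<omega>) - P f k \<omega>) / real n)" for n
    using iX iP by auto
  show "(\<lambda>n. \<integral>\<omega>. \<bar>(\<Sum>k<n. f (X (Suc k) \<omega>) - P f k \<omega>) / real n\<bar> \<partial>M) \<longlonglongrightarrow> 0"
  proof (rule LIMSEQ_I)
    fix \<epsilon> :: real assume \<epsilon>: "\<epsilon> > 0"
    define b where "b N x = (if \<bar>f x\<bar> \<le> real N then f x else 0)" for N :: nat and x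
    define r where "r N x = (if \<bar>f x\<bar> \<le> real N then 0 else f x)" for N :: nat and x
    have [measurable]: "b N \<in> borel_measurable E" "r N \<in> borel_measurable E" for N
      unfolding b_def r_def by measurable
    have "(\<lambda>N. \<integral>\<omega>. \<bar>r N (X (Suc 0) \<omega>)\<bar> \<partial>M) \<longlonglongrightarrow> (\<integral>\<omega>. 0 \<partial>M)"
    proof (rule integral_dominated_convergence[where w="\<lambda>\<omega>. \<bar>f (X (Suc 0) \<omega>)\<bar>"])
      show "AE \<omega> in M. (\<lambda>N. \<bar>r N (X (Suc 0) \<omega>)\<bar>) \<longlonglongrightarrow> 0"
      proof (rule AE_I2, rule tendsto_eventually)
        fix \<omega>
        obtain N0 where N0: "\<bar>f (X (Suc 0) \<omega>)\<bar> \<le> real N0" using real_arch_simple by blast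
        show "\<forall>\<^sub>F N in sequentially. \<bar>r N (X (Suc 0) \<omega>)\<bar> = 0"
          using eventually_ge_at_top[of N0] by eventually_elim (use N0 in \<open>simp add: r_def\<close>)
      qed
    qed (use iX in \<open>auto simp: r_def\<close>)
    from LIMSEQ_D[OF this, of "\<epsilon> / 4"] \<epsilon> obtain N where N: "(\<integral>\<omega>. \<bar>r N (X (Suc 0) \<omega>)\<bar> \<partial>M) < \<epsilon> / 4"
      by fastforce
    have bH: "b N \<in> class_H M E X" and rH: "r N \<in> class_H M E X"
      using Bochner_Integration.integrable_bound[OF iX[of 0], of "\<lambda>\<omega>. b N (X (Suc 0) \<omega>)"]
        Bochner_Integration.integrable_bound[OF iX[of 0], of "\<lambda>\<omega>. r N (X (Suc 0) \<omega>)"]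
      by (auto simp: class_H_def b_def r_def)
    have "\<bar>b N x\<bar> \<le> real N" for x by (simp add: b_def)
    then have lim_b: "(\<lambda>n. \<integral>\<omega>. \<bar>(\<Sum>k<n. b N (X (Suc k) \<omega>) - P (b N) k \<omega>) / real n\<bar> \<partial>M) \<longlonglongrightarrow> 0"
      by (intro lln_bounded) simp_all
    have "\<forall>\<^sub>F n in sequentially. (\<integral>\<omega>. \<bar>(\<Sum>k<n. b N (X (Suc k) \<omega>) - P (b N) k \<omega>) / real n\<bar> \<partial>M) < \<epsilon> / 2"
      using \<epsilon> by (intro order_tendstoD(2)[OF lim_b]) simp
    then obtain n0 where
      n0: "\<And>n. n0 \<le> n \<Longrightarrow> (\<integral>\<omega>. \<bar>(\<Sum>k<n. b N (X (Suc k) \<omega>) - P (b N) k \<omega>) / real n\<bar> \<partial>M) < \<epsilon> / 2"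
      unfolding eventually_sequentially by blast
    note irX = integrable_X[OF rH] and irP = integrable_P[OF rH]
    note ibX = integrable_X[OF bH] and ibP = integrable_P[OF bH]
    \<comment> \<open>Uniformity in \<open>k\<close>: all \<open>X (Suc k)\<close> have the same
      law, and conditional expectation contracts the \<open>L^1\<close> norm.\<close>
    have r1: "(\<integral>\<omega>. \<bar>r N (X (Suc k) \<omega>)\<bar> \<partial>M) < \<epsilon> / 4" for k
      using integral_X[of "\<lambda>x. \<bar>r N x\<bar>" k] N by simp
    have r2: "(\<integral>\<omega>. \<bar>P (r N) k \<omega>\<bar> \<partial>M) < \<epsilon> / 4" for k
      unfolding pred_mean_def Suc_eq_plus1[symmetric]
      by (rule le_less_trans[OF sigma_finite_subalgebra.real_cond_exp_L1_le[OF sigma_finite_sub irX] r1])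
    \<comment> \<open>Conditional expectation is additive only almost everywhere; countability of
      the indices yields one common null set.\<close>
    have Pf: "AE \<omega> in M. \<forall>k. P f k \<omega> = P (b N) k \<omega> + P (r N) k \<omega>"
      unfolding AE_all_countable
    proof
      fix k
      have fbr: "f x = b N x + r N x" for x by (simp add: b_def r_def)
      show "AE \<omega> in M. P f k \<omega> = P (b N) k \<omega> + P (r N) k \<omega>"
        unfolding pred_mean_def Suc_eq_plus1[symmetric] fbr
        by (rule sigma_finite_subalgebra.real_cond_exp_add[OF sigma_finite_sub ibX irX])
    qed
    show "\<exists>no. \<forall>n\<ge>no. norm ((\<integral>\<omega>. \<bar>(\<Sum>k<n. f (X (Suc k) \<omega>) - P f k \<omega>) / real n\<bar> \<partial>M) - 0) < \<epsilon>"
    proof (intro exI allI impI)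
      fix n assume n: "max 1 n0 \<le> n"
      let ?b = "\<lambda>\<omega>. \<bar>(\<Sum>k<n. b N (X (Suc k) \<omega>) - P (b N) k \<omega>) / real n\<bar>"
      let ?r = "\<lambda>k \<omega>. \<bar>r N (X (Suc k) \<omega>)\<bar> + \<bar>P (r N) k \<omega>\<bar>"
      have i_b: "integrable M ?b"
        using ibX ibP by (intro integrable_abs) auto
      have i_r: "integrable M (\<lambda>\<omega>. (\<Sum>k<n. ?r k \<omega>) / real n)"
        using irX irP by auto
      have "AE \<omega> in M. \<bar>(\<Sum>k<n. f (X (Suc k) \<omega>) - P f k \<omega>) / real n\<bar> \<le> ?b \<omega> + (\<Sum>k<n. ?r k \<omega>) / real n"
        using Pf
      proof eventually_elim
        case (elim \<omega>)
        have "f (X (Suc k) \<omega>) - P f k \<omega> = (b N (X (Suc k) \<omega>) - P (b N) k \<omega>) + (r N (X (Suc k) \<omega>) - P (r N) k \<omega>)" for k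
          using elim by (simp add: b_def r_def)
        then have eq: "(\<Sum>k<n. f (X (Suc k) \<omega>) - P f k \<omega>) / real n
          = (\<Sum>k<n. b N (X (Suc k) \<omega>) - P (b N) k \<omega>) / real n + (\<Sum>k<n. r N (X (Suc k) \<omega>) - P (r N) k \<omega>) / real n"
          by (simp only: sum.distrib add_divide_distrib)
        have "\<bar>(\<Sum>k<n. r N (X (Suc k) \<omega>) - P (r N) k \<omega>) / real n\<bar> \<le> (\<Sum>k<n. ?r k \<omega>) / real n"
          unfolding abs_divide abs_of_nat
          by (rule divide_right_mono[OF order_trans[OF sum_abs sum_mono[OF abs_triangle_ineq4]]]) simp
        then show ?case
          unfolding eq by (rule order_trans[OF abs_triangle_ineq add_left_mono])
      qed
      then have "(\<integral>\<omega>. \<bar>(\<Sum>k<n. f (X (Suc k) \<omega>) - P f k \<omega>) / real n\<bar> \<partial>M) \<le> (\<integral>\<omega>. ?b \<omega> + (\<Sum>k<n. ?r k \<omega>) / real n \<partial>M)"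
        by (rule integral_mono_AE[OF integrable_abs[OF int] Bochner_Integration.integrable_add[OF i_b i_r]])
      also have "\<dots> = (\<integral>\<omega>. ?b \<omega> \<partial>M) + (\<Sum>k<n. (\<integral>\<omega>. \<bar>r N (X (Suc k) \<omega>)\<bar> \<partial>M) + (\<integral>\<omega>. \<bar>P (r N) k \<omega>\<bar> \<partial>M)) / real n"
        using irX irP by (simp add: Bochner_Integration.integral_add[OF i_b i_r] del: abs_divide)
      also have "\<dots> \<le> (\<integral>\<omega>. ?b \<omega> \<partial>M) + (\<Sum>k<n. \<epsilon> / 4 + \<epsilon> / 4) / real n"
        by (intro add_left_mono divide_right_mono sum_mono add_mono less_imp_le[OF r1] less_imp_le[OF r2]) simp
      also have "\<dots> = (\<integral>\<omega>. ?b \<omega> \<partial>M) + \<epsilon> / 2" using n by simp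
      also have "\<dots> < \<epsilon> / 2 + \<epsilon> / 2"
        by (intro add_strict_right_mono n0) (use n in simp)
      finally show "norm ((\<integral>\<omega>. \<bar>(\<Sum>k<n. f (X (Suc k) \<omega>) - P f k \<omega>) / real n\<bar> \<partial>M) - 0) < \<epsilon>" by simp
    qed
  qed
qed

end

section \<open>Innovations and drift: the statistics as martingale sums\<close>

context cid_sequence begin

definition innov :: "('e \<Rightarrow> real) \<Rightarrow> nat \<Rightarrow> 'a \<Rightarrow> real" where
  "innov f k \<omega> = f (X (Suc k) \<omega>) - P f k \<omega>"

text \<open>The martingale differences of the theorem,
  \<open>f (X k) - k E[f (X (k + 1)) | G k] + (k - 1) E[f (X k) | G (k - 1)]\<close> for \<open>k \<ge> 1\<close>, are
  \<open>innov f (k - 1) - drift f (k - 1)\<close>.\<close>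

definition drift :: "('e \<Rightarrow> real) \<Rightarrow> nat \<Rightarrow> 'a \<Rightarrow> real" where
  "drift f k \<omega> = real (Suc k) * (P f (Suc k) \<omega> - P f k \<omega>)"

text \<open>The summand equals \<open>f (X (k + 1)) - (k + 1) P (k + 1) + k P k\<close>, so the
  predictive means telescope; the lower boundary term is \<open>0 * P 0\<close>.\<close>

lemma sum_innov_minus_drift:
  "(\<Sum>k<n. innov f k \<omega> - drift f k \<omega>) = (\<Sum>k<n. f (X (Suc k) \<omega>)) - real n * P f n \<omega>"
  by (induction n) (simp_all add: innov_def drift_def algebra_simps)

lemma C_stat_eq: "C_stat M G X f n \<omega> = (\<Sum>k<n. innov f k \<omega> - drift f k \<omega>) / sqrt (real n)"
  unfolding sum_innov_minus_drift by (simp add: C_stat_def sum.atLeast1_atMost_eq)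

lemma B_stat_eq: "B_stat M G X f n \<omega> = (\<Sum>k<n. innov f k \<omega>) / sqrt (real n)"
  by (simp add: B_stat_def innov_def sum.atLeast1_atMost_eq)

lemma M_stat_eq: "M_stat M G X f n \<omega> = (\<Sum>k<n. (innov f k \<omega> - drift f k \<omega>)\<^sup>2) / real n"
proof -
  have "(\<Sum>k=1..n. (f (X k \<omega>) - real k * P f k \<omega> + (real k - 1) * P f (k - 1) \<omega>)\<^sup>2)
      = (\<Sum>k<n. (innov f k \<omega> - drift f k \<omega>)\<^sup>2)"
    unfolding One_nat_def sum.atLeast1_atMost_eq
    by (intro sum.cong refl arg_cong[where f="\<lambda>x. x\<^sup>2"]) (simp add: innov_def drift_def algebra_simps)
  then show ?thesis by (simp add: M_stat_def)
qed

lemma drift_stat_eq: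
  "1 / real n * (\<Sum>k=1..n. (real k)\<^sup>2 * (P f k \<omega> - P f (k - 1) \<omega>)\<^sup>2) = (\<Sum>k<n. (drift f k \<omega>)\<^sup>2) / real n"
proof -
  have "(\<Sum>k=1..n. (real k)\<^sup>2 * (P f k \<omega> - P f (k - 1) \<omega>)\<^sup>2) = (\<Sum>k<n. (drift f k \<omega>)\<^sup>2)"
    unfolding One_nat_def sum.atLeast1_atMost_eq by (simp add: drift_def power_mult_distrib)
  then show ?thesis by simp
qed

context
  fixes f :: "'e \<Rightarrow> real"
  assumes f: "f \<in> class_H M E X" and f2: "(\<lambda>x. (f x)\<^sup>2) \<in> class_H M E X"
begin

lemma f_measurable [measurable]: "f \<in> borel_measurable E"
  by (rule class_H_measurable[OF f])

lemma innov_minus_drift_mds: "square_integrable_mds M G (\<lambda>k \<omega>. innov f k \<omega> - drift f k \<omega>)"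
  using square_integrable_mds_combination[OF f f2, of 1 "\<lambda>k. real (Suc k)"]
  by (simp add: innov_def drift_def)

lemma drift_mds: "square_integrable_mds M G (drift f)"
proof -
  have "drift f = (\<lambda>k \<omega>. 0 * (f (X (Suc k) \<omega>) - P f k \<omega>) - (- real (Suc k)) * (P f (Suc k) \<omega> - P f k \<omega>))"
    by (intro ext) (simp add: drift_def algebra_simps)
  then show ?thesis
    using square_integrable_mds_combination[OF f f2, of 0 "\<lambda>k. - real (Suc k)"] by (simp only:)
qed

lemma measurable_innov [measurable]: "innov f k \<in> borel_measurable M"
  unfolding innov_def[abs_def] by measurable

lemma measurable_drift [measurable]: "drift f k \<in> borel_measurable M"
  unfolding drift_def[abs_def] by measurable

lemma innov_square:
  shows "integrable M (\<lambda>\<omega>. (innov f k \<omega>)\<^sup>2)"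
    and "(\<integral>\<omega>. (innov f k \<omega>)\<^sup>2 \<partial>M) \<le> 4 * (\<integral>\<omega>. (f (X (Suc 0) \<omega>))\<^sup>2 \<partial>M)"
proof -
  have if2: "integrable M (\<lambda>\<omega>. (f (X (Suc k) \<omega>))\<^sup>2)" by (rule integrable_X[OF f2])
  note P2 = sigma_finite_subalgebra.real_cond_exp_L2[OF sigma_finite_sub[of k] integrable_X[OF f, of k] if2]
  have iP2: "integrable M (\<lambda>\<omega>. (P f k \<omega>)\<^sup>2)" and PF: "(\<integral>\<omega>. (P f k \<omega>)\<^sup>2 \<partial>M) \<le> (\<integral>\<omega>. (f (X (Suc k) \<omega>))\<^sup>2 \<partial>M)"
    using P2 unfolding pred_mean_def Suc_eq_plus1[symmetric] by auto
  show int: "integrable M (\<lambda>\<omega>. (innov f k \<omega>)\<^sup>2)"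
    using integrable_square_add[of "\<lambda>\<omega>. f (X (Suc k) \<omega>)" M "\<lambda>\<omega>. - P f k \<omega>"] if2 iP2
    by (simp add: innov_def)
  have "(\<integral>\<omega>. (innov f k \<omega>)\<^sup>2 \<partial>M) \<le> (\<integral>\<omega>. 2 * (f (X (Suc k) \<omega>))\<^sup>2 + 2 * (P f k \<omega>)\<^sup>2 \<partial>M)"
  proof (rule integral_mono[OF int])
    fix \<omega>
    \<comment> \<open>That is, \<open>(x - y)^2 \<le> 2 x^2 + 2 y^2\<close>. The final constant
      \<open>4\<close> arises because the second moment of \<open>P f k\<close> is at most that of
      \<open>f (X (k + 1))\<close>, by Jensen.\<close>
    have "0 \<le> (f (X (Suc k) \<omega>) + P f k \<omega>)\<^sup>2" by simp
    then show "(innov f k \<omega>)\<^sup>2 \<le> 2 * (f (X (Suc k) \<omega>))\<^sup>2 + 2 * (P f k \<omega>)\<^sup>2"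
      by (simp add: innov_def power2_eq_square algebra_simps)
  qed (use if2 iP2 in auto)
  also have "\<dots> = 2 * (\<integral>\<omega>. (f (X (Suc k) \<omega>))\<^sup>2 \<partial>M) + 2 * (\<integral>\<omega>. (P f k \<omega>)\<^sup>2 \<partial>M)"
    using if2 iP2 by simp
  also have "\<dots> \<le> 4 * (\<integral>\<omega>. (f (X (Suc k) \<omega>))\<^sup>2 \<partial>M)" using PF by simp
  also have "(\<integral>\<omega>. (f (X (Suc k) \<omega>))\<^sup>2 \<partial>M) = (\<integral>\<omega>. (f (X (Suc 0) \<omega>))\<^sup>2 \<partial>M)"
    by (rule integral_X) measurable
  finally show "(\<integral>\<omega>. (innov f k \<omega>)\<^sup>2 \<partial>M) \<le> 4 * (\<integral>\<omega>. (f (X (Suc 0) \<omega>))\<^sup>2 \<partial>M)" .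
qed

text \<open>The squares are expanded so that each mean is treatable: laws of large numbers for
  \<open>f^2\<close> and \<open>f\<close> (\<open>?T1\<close>, \<open>?T4\<close>), Cesaro limits of
  predictive means (\<open>?R\<close>), and Cauchy-Schwarz for the rest (\<open>?T3\<close>,
  \<open>?T7\<close>). The product \<open>f (X (k + 1)) P k\<close> has no law of large numbers of
  its own; replacing \<open>P k\<close> by its limit \<open>V\<close> leaves a small error and pulls
  \<open>V\<close> out of the sum.\<close>

lemma conv_in_prob_square_mean:
  assumes D: "conv_in_prob M (\<lambda>n \<omega>. (\<Sum>k<n. (drift f k \<omega>)\<^sup>2) / real n) (\<lambda>_. 0)"
    and V: "is_V M G X f V" and V2: "is_V M G X (\<lambda>x. (f x)\<^sup>2) V2"
  shows "conv_in_prob M (\<lambda>n \<omega>. (\<Sum>k<n. (innov f k \<omega> - drift f k \<omega>)\<^sup>2) / real n) (\<lambda>\<omega>. V2 \<omega> - (V \<omega>)\<^sup>2)"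
proof -
  have [measurable]: "V \<in> borel_measurable M" "V2 \<in> borel_measurable M"
    using V V2 by (simp_all add: is_V_def)
  have limV: "AE \<omega> in M. (\<lambda>n. P f n \<omega>) \<longlonglongrightarrow> V \<omega>" and limV2: "AE \<omega> in M. (\<lambda>n. P (\<lambda>x. (f x)\<^sup>2) n \<omega>) \<longlonglongrightarrow> V2 \<omega>"
    using V V2 by (simp_all add: is_V_def)
  let ?p = "\<lambda>k \<omega>. P f k \<omega>" and ?p2 = "\<lambda>k \<omega>. P (\<lambda>x. (f x)\<^sup>2) k \<omega>" and ?f = "\<lambda>k \<omega>. f (X (Suc k) \<omega>)"
  let ?T1 = "\<lambda>n \<omega>. (\<Sum>k<n. (?f k \<omega>)\<^sup>2 - ?p2 k \<omega>) / real n"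
  \<comment> \<open>The three Cesaro means tend to \<open>V2\<close>, \<open>V\<close> and
    \<open>V^2\<close>, which gives \<open>V2 - 2 V^2 + V^2\<close>.\<close>
  let ?R = "\<lambda>n \<omega>. (\<Sum>k<n. ?p2 k \<omega>) / real n - 2 * (V \<omega> * ((\<Sum>k<n. ?p k \<omega>) / real n)) + (\<Sum>k<n. (?p k \<omega>)\<^sup>2) / real n"
  let ?T3 = "\<lambda>n \<omega>. (\<Sum>k<n. ?f k \<omega> * (?p k \<omega> - V \<omega>)) / real n"
  let ?T4 = "\<lambda>n \<omega>. V \<omega> * ((\<Sum>k<n. ?f k \<omega> - ?p k \<omega>) / real n)"
  let ?T7 = "\<lambda>n \<omega>. (\<Sum>k<n. innov f k \<omega> * drift f k \<omega>) / real n"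
  let ?T8 = "\<lambda>n \<omega>. (\<Sum>k<n. (drift f k \<omega>)\<^sup>2) / real n"
  let ?F = "\<integral>\<omega>. (f (X (Suc 0) \<omega>))\<^sup>2 \<partial>M"
  have F0: "0 \<le> ?F" by simp
  then have F4: "0 \<le> 4 * ?F" by simp
  have T1: "conv_in_prob M ?T1 (\<lambda>_. 0)" by (rule lln[OF f2])
  have T4: "conv_in_prob M ?T4 (\<lambda>_. 0)"
    by (rule conv_in_prob_mult_rv[OF _ _ lln[OF f]]) measurable
  have R: "conv_in_prob M ?R (\<lambda>\<omega>. V2 \<omega> - (V \<omega>)\<^sup>2)"
  proof (rule conv_in_prob_AE)
    show "AE \<omega> in M. (\<lambda>n. ?R n \<omega>) \<longlonglongrightarrow> V2 \<omega> - (V \<omega>)\<^sup>2"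
      using limV limV2
    proof eventually_elim
      case (elim \<omega>)
      have "(\<lambda>n. ?R n \<omega>) \<longlonglongrightarrow> V2 \<omega> - 2 * (V \<omega> * V \<omega>) + (V \<omega>)\<^sup>2"
        by (intro tendsto_add tendsto_diff tendsto_mult tendsto_const cesaro_mean_tendsto elim tendsto_power)
      then show ?case by (simp add: power2_eq_square)
    qed
  qed measurable
  have T3: "conv_in_prob M ?T3 (\<lambda>_. 0)"
  proof (rule conv_in_prob_tight_product)
    have "(\<integral>\<omega>. (?f k \<omega>)\<^sup>2 \<partial>M) \<le> ?F" for k
      by (rule eq_refl[OF integral_X]) measurable
    note mean = integral_mean_le[OF integrable_X[OF f2] this F0]
    show "integrable M (\<lambda>\<omega>. (\<Sum>k<n. (?f k \<omega>)\<^sup>2) / real n)" for n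
      by (rule mean(1))
    show "(\<integral>\<omega>. (\<Sum>k<n. (?f k \<omega>)\<^sup>2) / real n \<partial>M) \<le> ?F" for n
      by (rule mean(2))
    show "conv_in_prob M (\<lambda>n \<omega>. (\<Sum>k<n. (?p k \<omega> - V \<omega>)\<^sup>2) / real n) (\<lambda>_. 0)"
    proof (rule conv_in_prob_AE)
      show "AE \<omega> in M. (\<lambda>n. (\<Sum>k<n. (?p k \<omega> - V \<omega>)\<^sup>2) / real n) \<longlonglongrightarrow> 0"
        using limV
      proof eventually_elim
        case (elim \<omega>)
        have "(\<lambda>k. (?p k \<omega> - V \<omega>)\<^sup>2) \<longlonglongrightarrow> (V \<omega> - V \<omega>)\<^sup>2"
          by (intro tendsto_power tendsto_diff tendsto_const elim)
        then show ?case by (intro cesaro_mean_tendsto) simp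
      qed
    qed measurable
    show "(?T3 n \<omega>)\<^sup>2 \<le> (\<Sum>k<n. (?f k \<omega>)\<^sup>2) / real n * \<bar>(\<Sum>k<n. (?p k \<omega> - V \<omega>)\<^sup>2) / real n\<bar>" for n \<omega>
      by (rule Cauchy_Schwarz_mean)
  qed (auto intro!: divide_nonneg_nonneg sum_nonneg)
  have T7: "conv_in_prob M ?T7 (\<lambda>_. 0)"
  proof (rule conv_in_prob_tight_product[OF _ _ _ _ D])
    show "integrable M (\<lambda>\<omega>. (\<Sum>k<n. (innov f k \<omega>)\<^sup>2) / real n)" for n
      by (rule integral_mean_le(1)[OF innov_square F4])
    show "(\<integral>\<omega>. (\<Sum>k<n. (innov f k \<omega>)\<^sup>2) / real n \<partial>M) \<le> 4 * ?F" for n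
      by (rule integral_mean_le(2)[OF innov_square F4])
    show "(?T7 n \<omega>)\<^sup>2 \<le> (\<Sum>k<n. (innov f k \<omega>)\<^sup>2) / real n * \<bar>?T8 n \<omega>\<bar>" for n \<omega>
      by (rule Cauchy_Schwarz_mean)
  qed (auto intro!: divide_nonneg_nonneg sum_nonneg)
  have sum_eq: "(\<Sum>k<n. (innov f k \<omega> - drift f k \<omega>)\<^sup>2)
    = (\<Sum>k<n. (?f k \<omega>)\<^sup>2 - ?p2 k \<omega>)
      + ((\<Sum>k<n. ?p2 k \<omega>) - 2 * (V \<omega> * (\<Sum>k<n. ?p k \<omega>)) + (\<Sum>k<n. (?p k \<omega>)\<^sup>2))
      + (- 2) * (\<Sum>k<n. ?f k \<omega> * (?p k \<omega> - V \<omega>)) + (- 2) * (V \<omega> * (\<Sum>k<n. ?f k \<omega> - ?p k \<omega>))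
      + (- 2) * (\<Sum>k<n. innov f k \<omega> * drift f k \<omega>) + (\<Sum>k<n. (drift f k \<omega>)\<^sup>2)" for n \<omega>
  proof (induction n)
    case (Suc n)
    \<comment> \<open>Only the square of the innovation is multiplied out; its product with the
      drift stays whole as the summand of \<open>?T7\<close>.\<close>
    have "(innov f n \<omega> - drift f n \<omega>)\<^sup>2 = (?f n \<omega>)\<^sup>2 - 2 * (?f n \<omega> * ?p n \<omega>) + (?p n \<omega>)\<^sup>2
        - 2 * (innov f n \<omega> * drift f n \<omega>) + (drift f n \<omega>)\<^sup>2"
      by (simp add: power2_diff) (simp add: innov_def power2_eq_square algebra_simps)
    then show ?case
      using Suc by (simp add: algebra_simps)
  qed simp
  have eq: "(\<Sum>k<n. (innov f k \<omega> - drift f k \<omega>)\<^sup>2) / real n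
    = ?T1 n \<omega> + ?R n \<omega> + (- 2) * ?T3 n \<omega> + (- 2) * ?T4 n \<omega> + (- 2) * ?T7 n \<omega> + ?T8 n \<omega>" for n \<omega>
    unfolding sum_eq by (simp add: add_divide_distrib diff_divide_distrib)
  have "conv_in_prob M (\<lambda>n \<omega>. ?T1 n \<omega> + ?R n \<omega> + (- 2) * ?T3 n \<omega> + (- 2) * ?T4 n \<omega> + (- 2) * ?T7 n \<omega> + ?T8 n \<omega>)
     (\<lambda>\<omega>. 0 + (V2 \<omega> - (V \<omega>)\<^sup>2) + (- 2) * 0 + (- 2) * 0 + (- 2) * 0 + 0)"
    by (intro conv_in_prob_add conv_in_prob_cmult T1 R T3 T4 T7 D) measurable
  then show ?thesis unfolding eq by simp
qed

section \<open>Consequences of the bound on the second moments of \<open>C_stat\<close>\<close>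

context
  assumes sup: "(SUP n\<in>{1..}. \<integral>\<^sup>+ \<omega>. ennreal ((C_stat M G X f n \<omega>)\<^sup>2) \<partial>M) < \<infinity>"
begin

text \<open>By orthogonality of the differences, the mean of their averaged squares is exactly
  \<open>E[C_n^2]\<close>.\<close>

lemma mean_square_bound:
  "\<exists>K. \<forall>n. (\<integral>\<omega>. (\<Sum>k<n. (innov f k \<omega> - drift f k \<omega>)\<^sup>2) / real n \<partial>M) \<le> K"
proof -
  interpret mds: square_integrable_mds M G "\<lambda>k \<omega>. innov f k \<omega> - drift f k \<omega>" by (rule innov_minus_drift_mds)
  define s where "s = (SUP n\<in>{1..}. \<integral>\<^sup>+ \<omega>. ennreal ((C_stat M G X f n \<omega>)\<^sup>2) \<partial>M)"
  have s: "s = ennreal (enn2real s)" using sup by (simp add: s_def)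
  have "(\<integral>\<omega>. (\<Sum>k<n. (innov f k \<omega> - drift f k \<omega>)\<^sup>2) / real n \<partial>M) \<le> enn2real s" for n
  \<comment> \<open>The supremum starts at \<open>n = 1\<close>; for \<open>n = 0\<close> the left
    side is \<open>0\<close>.\<close>
  proof (cases "n = 0")
    case False
    have C2: "(C_stat M G X f n \<omega>)\<^sup>2 = (\<Sum>k<n. innov f k \<omega> - drift f k \<omega>)\<^sup>2 / real n" for \<omega>
      by (simp add: C_stat_eq power_divide)
    have int: "integrable M (\<lambda>\<omega>. (C_stat M G X f n \<omega>)\<^sup>2)"
      unfolding C2 using mds.integrable_square_sum by auto
    have "(\<integral>\<omega>. (\<Sum>k<n. (innov f k \<omega> - drift f k \<omega>)\<^sup>2) / real n \<partial>M) = (\<integral>\<omega>. (C_stat M G X f n \<omega>)\<^sup>2 \<partial>M)"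
      unfolding C2 using mds.square_integrable by (simp add: mds.integral_square_sum)
    also have "ennreal \<dots> = (\<integral>\<^sup>+ \<omega>. ennreal ((C_stat M G X f n \<omega>)\<^sup>2) \<partial>M)"
      using int by (intro nn_integral_eq_integral[symmetric]) auto
    also have "\<dots> \<le> s" unfolding s_def using False by (intro SUP_upper) auto
    also note s
    finally show ?thesis by (subst (asm) ennreal_le_iff) auto
  qed simp
  then show ?thesis by blast
qed

lemma stably_conv_C_stat:
  assumes [measurable]: "L \<in> borel_measurable M"
    and Q: "conv_in_prob M (\<lambda>n \<omega>. (\<Sum>k<n. (innov f k \<omega> - drift f k \<omega>)\<^sup>2) / real n) L"
  shows "stably_conv_gauss M (C_stat M G X f) L"
proof -
  interpret mds: square_integrable_mds M G "\<lambda>k \<omega>. innov f k \<omega> - drift f k \<omega>" by (rule innov_minus_drift_mds)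
  obtain K where K: "\<And>n. (\<integral>\<omega>. (\<Sum>k<n. (innov f k \<omega> - drift f k \<omega>)\<^sup>2) / real n \<partial>M) \<le> K" using mean_square_bound by blast
  show ?thesis
  proof (rule stably_conv_gaussI)
    show "C_stat M G X f n \<in> borel_measurable M" for n
      unfolding C_stat_eq[abs_def] by measurable
    \<comment> \<open>Nonnegativity of the limiting variance is inherited from the averaged
      squares.\<close>
    show "AE \<omega> in M. 0 \<le> L \<omega>"
      by (rule conv_in_prob_nonneg_limit[OF _ _ Q]) (auto intro!: divide_nonneg_nonneg sum_nonneg)
    fix H t assume H: "H \<in> events"
    show "(\<lambda>n. \<integral>\<omega>. complex_of_real (indicator H \<omega>) * iexp (t * C_stat M G X f n \<omega>) \<partial>M)
      \<longlonglongrightarrow> (\<integral>\<omega>. complex_of_real (indicator H \<omega> * exp (- (t\<^sup>2 / 2 * max 0 (L \<omega>)))) \<partial>M)"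
      unfolding C_stat_eq by (rule mds.tendsto_integral_iexp[OF _ Q K]) (use H in \<open>auto simp: indicator_def\<close>)
  qed measurable
qed

text \<open>The limit theorem with \<open>L = 0\<close> also asks for an \<open>L^1\<close> bound on
  the averaged squares of the drift, which the hypothesis in probability does not give. It comes
  from writing the drift as the innovation minus the bounded-in-mean-square difference
  \<open>innov - drift\<close>.\<close>

lemma conv_in_prob_B_minus_C:
  assumes D: "conv_in_prob M (\<lambda>n \<omega>. (\<Sum>k<n. (drift f k \<omega>)\<^sup>2) / real n) (\<lambda>_. 0)"
  shows "conv_in_prob M (\<lambda>n \<omega>. B_stat M G X f n \<omega> - C_stat M G X f n \<omega>) (\<lambda>_. 0)"
proof -
  interpret Z: square_integrable_mds M G "\<lambda>k \<omega>. innov f k \<omega> - drift f k \<omega>" by (rule innov_minus_drift_mds)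
  interpret D: square_integrable_mds M G "drift f" by (rule drift_mds)
  obtain K where K: "\<And>n. (\<integral>\<omega>. (\<Sum>k<n. (innov f k \<omega> - drift f k \<omega>)\<^sup>2) / real n \<partial>M) \<le> K" using mean_square_bound by blast
  let ?F = "4 * (\<integral>\<omega>. (f (X (Suc 0) \<omega>))\<^sup>2 \<partial>M)"
  have F: "integrable M (\<lambda>\<omega>. (\<Sum>k<n. (innov f k \<omega>)\<^sup>2) / real n)" "(\<integral>\<omega>. (\<Sum>k<n. (innov f k \<omega>)\<^sup>2) / real n \<partial>M) \<le> ?F" for n
    by (rule integral_mean_le(1)[OF innov_square], simp) (rule integral_mean_le(2)[OF innov_square], simp)
  have KD: "(\<integral>\<omega>. (\<Sum>k<n. (drift f k \<omega>)\<^sup>2) / real n \<partial>M) \<le> 2 * ?F + 2 * K" for n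
  proof -
    have iZ: "integrable M (\<lambda>\<omega>. (\<Sum>k<n. (innov f k \<omega> - drift f k \<omega>)\<^sup>2) / real n)"
      using Z.square_integrable by auto
    have "(\<integral>\<omega>. (\<Sum>k<n. (drift f k \<omega>)\<^sup>2) / real n \<partial>M)
      \<le> (\<integral>\<omega>. 2 * ((\<Sum>k<n. (innov f k \<omega>)\<^sup>2) / real n) + 2 * ((\<Sum>k<n. (innov f k \<omega> - drift f k \<omega>)\<^sup>2) / real n) \<partial>M)"
    proof (rule integral_mono)
      fix \<omega>
      have "(\<Sum>k<n. (drift f k \<omega>)\<^sup>2) \<le> (\<Sum>k<n. 2 * (innov f k \<omega>)\<^sup>2 + 2 * (innov f k \<omega> - drift f k \<omega>)\<^sup>2)"
      proof (rule sum_mono)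
        fix k
        have "0 \<le> (innov f k \<omega> + (innov f k \<omega> - drift f k \<omega>))\<^sup>2" by simp
        then show "(drift f k \<omega>)\<^sup>2 \<le> 2 * (innov f k \<omega>)\<^sup>2 + 2 * (innov f k \<omega> - drift f k \<omega>)\<^sup>2"
          by (simp add: power2_eq_square algebra_simps)
      qed
      then have "(\<Sum>k<n. (drift f k \<omega>)\<^sup>2) / real n \<le> (\<Sum>k<n. 2 * (innov f k \<omega>)\<^sup>2 + 2 * (innov f k \<omega> - drift f k \<omega>)\<^sup>2) / real n"
        by (rule divide_right_mono) simp
      then show "(\<Sum>k<n. (drift f k \<omega>)\<^sup>2) / real n
        \<le> 2 * ((\<Sum>k<n. (innov f k \<omega>)\<^sup>2) / real n) + 2 * ((\<Sum>k<n. (innov f k \<omega> - drift f k \<omega>)\<^sup>2) / real n)"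
        by (simp only: sum.distrib sum_distrib_left[symmetric] add_divide_distrib times_divide_eq_right)
    next
      show "integrable M (\<lambda>\<omega>. (\<Sum>k<n. (drift f k \<omega>)\<^sup>2) / real n)"
        using D.square_integrable by auto
    qed (intro Bochner_Integration.integrable_add integrable_mult_right F(1) iZ)
    also have "\<dots> = 2 * (\<integral>\<omega>. (\<Sum>k<n. (innov f k \<omega>)\<^sup>2) / real n \<partial>M) + 2 * (\<integral>\<omega>. (\<Sum>k<n. (innov f k \<omega> - drift f k \<omega>)\<^sup>2) / real n \<partial>M)"
      using F(1)[of n] iZ
      by (simp only: Bochner_Integration.integral_add[OF integrable_mult_right integrable_mult_right] integral_mult_right_zero)
    also have "\<dots> \<le> 2 * ?F + 2 * K"
      by (intro add_mono mult_left_mono F(2) K) simp_all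
    finally show ?thesis .
  qed
  have BC: "B_stat M G X f n \<omega> - C_stat M G X f n \<omega> = (\<Sum>k<n. drift f k \<omega>) / sqrt (real n)" for n \<omega>
    by (simp add: B_stat_eq C_stat_eq sum_subtractf diff_divide_distrib)
  show ?thesis
    unfolding BC
  proof (rule conv_in_prob_0_of_char)
    fix t
    show "(\<lambda>n. \<integral>\<omega>. iexp (t * ((\<Sum>k<n. drift f k \<omega>) / sqrt (real n))) \<partial>M) \<longlonglongrightarrow> 1"
      \<comment> \<open>With \<open>h = 1\<close> and \<open>L = 0\<close> the limit of the
        characteristic functions is \<open>1\<close>.\<close>
      using D.tendsto_integral_iexp[OF _ D KD, of "\<lambda>_. 1" t] by (simp add: prob_space)
  qed measurable
qed

end
end
end

theorem theorem3p3:
  fixes M :: "'a measure" and G :: "nat \<Rightarrow> 'a measure"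
    and E :: "'e measure" and X :: "nat \<Rightarrow> 'a \<Rightarrow> 'e" and f :: "'e \<Rightarrow> real"
  assumes "prob_space M"
    and "filtration (space M) G" and "\<And>n. subalgebra M (G n)"
    and "cid M G E X"
    and "f \<in> class_H M E X" and "(\<lambda>x. (f x)\<^sup>2) \<in> class_H M E X"
    and "(SUP n\<in>{1..}. \<integral>\<^sup>+ \<omega>. ennreal ((C_stat M G X f n \<omega>)\<^sup>2) \<partial>M) < \<infinity>"
  shows "(\<forall>S. S \<in> borel_measurable M \<longrightarrow>
              (AE \<omega> in M. (\<lambda>n. M_stat M G X f n \<omega>) \<longlonglongrightarrow> S \<omega>) \<longrightarrow>
              stably_conv_gauss M (C_stat M G X f) S)
       \<and> (conv_in_prob M
              (\<lambda>n \<omega>. 1 / real n * (\<Sum>k=1..n. (real k)\<^sup>2 *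
                 (pred_mean M G X f k \<omega> - pred_mean M G X f (k - 1) \<omega>)\<^sup>2)) (\<lambda>_. 0) \<longrightarrow>
            conv_in_prob M (\<lambda>n \<omega>. B_stat M G X f n \<omega> - C_stat M G X f n \<omega>) (\<lambda>_. 0) \<and>
            (\<forall>V V2. is_V M G X f V \<longrightarrow> is_V M G X (\<lambda>x. (f x)\<^sup>2) V2 \<longrightarrow>
               stably_conv_gauss M (C_stat M G X f) (\<lambda>\<omega>. V2 \<omega> - (V \<omega>)\<^sup>2)))"
proof -
  interpret cid_sequence M G E X
    by (intro cid_sequence.intro cid_sequence_axioms.intro filtered_prob_space.intro
        filtered_prob_space_axioms.intro assms)
  note ff = assms(5,6) and sup = assms(7)
  note [measurable] = measurable_innov[OF ff] measurable_drift[OF ff]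
  show ?thesis
    unfolding drift_stat_eq M_stat_eq
  proof (intro conjI allI impI)
    fix S
    assume S [measurable]: "S \<in> borel_measurable M"
      and lim: "AE \<omega> in M. (\<lambda>n. (\<Sum>k<n. (innov f k \<omega> - drift f k \<omega>)\<^sup>2) / real n) \<longlonglongrightarrow> S \<omega>"
    show "stably_conv_gauss M (C_stat M G X f) S"
      by (rule stably_conv_C_stat[OF ff sup S conv_in_prob_AE[OF _ S lim]]) measurable
  next
    assume D: "conv_in_prob M (\<lambda>n \<omega>. (\<Sum>k<n. (drift f k \<omega>)\<^sup>2) / real n) (\<lambda>_. 0)"
    show "conv_in_prob M (\<lambda>n \<omega>. B_stat M G X f n \<omega> - C_stat M G X f n \<omega>) (\<lambda>_. 0)"
      by (rule conv_in_prob_B_minus_C[OF ff sup D])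
    fix V V2 assume V: "is_V M G X f V" and V2: "is_V M G X (\<lambda>x. (f x)\<^sup>2) V2"
    then have [measurable]: "V \<in> borel_measurable M" "V2 \<in> borel_measurable M"
      by (simp_all add: is_V_def)
    show "stably_conv_gauss M (C_stat M G X f) (\<lambda>\<omega>. V2 \<omega> - (V \<omega>)\<^sup>2)"
      by (rule stably_conv_C_stat[OF ff sup _ conv_in_prob_square_mean[OF ff D V V2]]) measurable
  qed
qed

end
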